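(* Let $\widetilde{\mathrm{Diff}}{}^3$ be the central extension, determined by the Bott cocycle, of the universal covering group of the group of orientation preserving $C^3$-diffeomorphisms of the circle, and let $\mathrm{SL}_2(\mathbb{R})^\sim$ be the universal covering group of $\mathrm{SL}_2(\mathbb{R})$, regarded as a subgroup of $\widetilde{\mathrm{Diff}}{}^3$. Then $\mathrm{SL}_2(\mathbb{R})^\sim$ is a spherical subgroup of $\widetilde{\mathrm{Diff}}{}^3$.
   Context: A subgroup $K$ of a topological group $G$ is called spherical in $G$ if for every irreducible unitary representation of $G$ (continuous, in a complex Hilbert space) the space of $K$-invariant vectors has dimension $\le 1$. Let $\mathrm{Diff}^3$ be the group of orientation preserving $C^3$-diffeomorphisms of the circle $\mathbb{R}/2\pi\mathbb{Z}$ with the $C^3$-topology. Its universal covering $(\mathrm{Diff}^3)^\sim$ is realized as the group of orientation preserving $C^3$-diffeomorphisms $q$ of the line $\mathbb{R}$ satisfying $q(\phi+2\pi)=q(\phi)+2\pi$, with composition as the product and the $C^3$-topology. The Bott cocycle on it is $$c(q_1,q_2)=\int_0^{2\pi}\ln q_1'(q_2(\phi))\, d\ln q_2'(\phi).$$ The central extension $\widetilde{\mathrm{Diff}}{}^3$ of $(\mathrm{Diff}^3)^\sim$ by $\mathbb{R}$ is the set $(\mathrm{Diff}^3)^\sim\times\mathbb{R}$ with the product topology and the multiplication $(q_1,t_1)(q_2,t_2)=(q_1\circ q_2,\ t_1+t_2+c(q_1,q_2))$. Identify the circle $\mathbb{R}/2\pi\mathbb{Z}$ with $\mathbb{RP}^1=\mathbb{R}\cup\{\infty\}$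 via $\phi\mapsto x=\tan(\phi/2)$. Then $\mathrm{PSL}_2(\mathbb{R})$, acting by linear fractional transformations, is a subgroup of $\mathrm{Diff}^3$, and its preimage in $(\mathrm{Diff}^3)^\sim$ is the universal covering group $\mathrm{SL}_2(\mathbb{R})^\sim$ of $\mathrm{SL}_2(\mathbb{R})$ (equivalently, of $\mathrm{PSL}_2(\mathbb{R})$). The central extension $\widetilde{\mathrm{Diff}}{}^3\to(\mathrm{Diff}^3)^\sim$ splits over this preimage: there is a unique continuous homomorphism $\mathrm{SL}_2(\mathbb{R})^\sim\to\widetilde{\mathrm{Diff}}{}^3$ lifting the inclusion $\mathrm{SL}_2(\mathbb{R})^\sim\subset(\mathrm{Diff}^3)^\sim$, and $\mathrm{SL}_2(\mathbb{R})^\sim$ is regarded as a subgroup of $\widetilde{\mathrm{Diff}}{}^3$ via this homomorphism. *)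

theory Defs
  imports "HOL-Analysis.Analysis" "HOL-Algebra.Group"
begin

section \<open>Complex Hilbert spaces\<close>

class complex_hilbert_space = banach +
  fixes scaleC :: "complex \<Rightarrow> 'a \<Rightarrow> 'a"
    and cinner :: "'a \<Rightarrow> 'a \<Rightarrow> complex"
  assumes scaleC_of_real: "scaleC (complex_of_real r) x = scaleR r x"
    and scaleC_add_right: "scaleC a (x + y) = scaleC a x + scaleC a y"
    and scaleC_add_left: "scaleC (a + b) x = scaleC a x + scaleC b x"
    and scaleC_scaleC: "scaleC a (scaleC b x) = scaleC (a * b) x"
    and cinner_commute: "cinner x y = cnj (cinner y x)"
    and cinner_add_left: "cinner (x + y) z = cinner x z + cinner y z"
    and cinner_scaleC_left: "cinner (scaleC a x) y = a * cinner x y"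
    and cinner_self: "cinner x x = complex_of_real ((norm x)\<^sup>2)"

lemma scaleC_one: "scaleC 1 x = (x :: 'a::complex_hilbert_space)"
  using scaleC_of_real[of 1 x] by simp

global_interpretation complex_vector:
  vector_space "scaleC :: complex \<Rightarrow> 'a \<Rightarrow> 'a::complex_hilbert_space"
  by unfold_locales (simp_all add: scaleC_add_right scaleC_add_left scaleC_scaleC scaleC_one)

instantiation complex :: complex_hilbert_space
begin

definition scaleC_complex :: "complex \<Rightarrow> complex \<Rightarrow> complex"
  where "scaleC_complex a x = a * x"

definition cinner_complex :: "complex \<Rightarrow> complex \<Rightarrow> complex"
  where "cinner_complex x y = x * cnj y"

instance
proof
  fix a b x y z :: complex and r :: real
  show "scaleC (complex_of_real r) x = scaleR r x"
    by (simp add: scaleC_complex_def scaleR_conv_of_real)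
  show "scaleC a (x + y) = scaleC a x + scaleC a y"
    by (simp add: scaleC_complex_def distrib_left)
  show "scaleC (a + b) x = scaleC a x + scaleC b x"
    by (simp add: scaleC_complex_def distrib_right)
  show "scaleC a (scaleC b x) = scaleC (a * b) x"
    by (simp add: scaleC_complex_def mult.assoc)
  show "cinner x y = cnj (cinner y x)"
    by (simp add: cinner_complex_def mult.commute)
  show "cinner (x + y) z = cinner x z + cinner y z"
    by (simp add: cinner_complex_def distrib_right)
  show "cinner (scaleC a x) y = a * cinner x y"
    by (simp add: scaleC_complex_def cinner_complex_def mult.assoc)
  show "cinner x x = complex_of_real ((norm x)\<^sup>2)"
    unfolding cinner_complex_def by (rule complex_norm_square[symmetric])
qed

end

definition unitary_operator :: "('h::complex_hilbert_space \<Rightarrow> 'h) \<Rightarrow> bool"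
  where "unitary_operator U \<longleftrightarrow>
    Vector_Spaces.linear scaleC scaleC U \<and> surj U \<and> (\<forall>x y. cinner (U x) (U y) = cinner x y)"


section \<open>Topological groups, unitary representations, spherical subgroups\<close>

definition topological_group :: "('g, 'm) monoid_scheme \<Rightarrow> 'g topology \<Rightarrow> bool"
  where "topological_group G T \<longleftrightarrow>
    group G \<and> topspace T = carrier G \<and>
    continuous_map (prod_topology T T) T (\<lambda>(x, y). x \<otimes>\<^bsub>G\<^esub> y) \<and>
    continuous_map T T (\<lambda>x. inv\<^bsub>G\<^esub> x)"

text \<open>Continuity of a unitary representation is strong continuity (continuity of all orbit maps).\<close>

definition unitary_rep ::
    "('g, 'm) monoid_scheme \<Rightarrow> 'g topology \<Rightarrow> ('g \<Rightarrow> 'h::complex_hilbert_space \<Rightarrow> 'h) \<Rightarrow> bool"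
  where "unitary_rep G T \<rho> \<longleftrightarrow>
    (\<forall>g\<in>carrier G. unitary_operator (\<rho> g)) \<and>
    (\<forall>g\<in>carrier G. \<forall>h\<in>carrier G. \<rho> (g \<otimes>\<^bsub>G\<^esub> h) = \<rho> g \<circ> \<rho> h) \<and>
    (\<forall>v. continuous_map T euclidean (\<lambda>g. \<rho> g v))"

definition irreducible_unitary_rep ::
    "('g, 'm) monoid_scheme \<Rightarrow> 'g topology \<Rightarrow> ('g \<Rightarrow> 'h::complex_hilbert_space \<Rightarrow> 'h) \<Rightarrow> bool"
  where "irreducible_unitary_rep G T \<rho> \<longleftrightarrow>
    unitary_rep G T \<rho> \<and> (UNIV :: 'h set) \<noteq> {0} \<and>
    (\<forall>S. complex_vector.subspace S \<and> closed S \<and> (\<forall>g\<in>carrier G. \<rho> g ` S \<subseteq> S)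
       \<longrightarrow> S = {0} \<or> S = UNIV)"

definition invariant_vectors :: "('g \<Rightarrow> 'h \<Rightarrow> 'h) \<Rightarrow> 'g set \<Rightarrow> 'h set"
  where "invariant_vectors \<rho> K = {v. \<forall>k\<in>K. \<rho> k v = v}"

text \<open>The dimension bound is expressed by a basis with at most one element, because
  \<^const>\<open>complex_vector.dim\<close> is 0 on infinite-dimensional subspaces.  HOL cannot quantify over
  all Hilbert spaces inside a definition, so the representation space is the type \<open>'h\<close>; a
  statement about \<open>spherical_subgroup TYPE('h)\<close> with \<open>'h\<close> a free type variable concerns
  all complex Hilbert spaces.\<close>

definition spherical_subgroup ::
    "'h::complex_hilbert_space itself \<Rightarrow> ('g, 'm) monoid_scheme \<Rightarrow> 'g topology \<Rightarrow> 'g set \<Rightarrow> bool"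
  where "spherical_subgroup (h :: 'h itself) G T K \<longleftrightarrow>
    topological_group G T \<and> subgroup K G \<and>
    (\<forall>\<rho> :: 'g \<Rightarrow> 'h \<Rightarrow> 'h. irreducible_unitary_rep G T \<rho> \<longrightarrow>
       (\<exists>B. complex_vector.independent B \<and> complex_vector.span B = invariant_vectors \<rho> K \<and>
            finite B \<and> card B \<le> 1))"


section \<open>The universal covering of the group of circle diffeomorphisms\<close>

definition C3_function :: "(real \<Rightarrow> real) \<Rightarrow> bool"
  where "C3_function f \<longleftrightarrow>
    (\<forall>k<3. \<forall>x. (deriv ^^ k) f field_differentiable at x) \<and> continuous_on UNIV ((deriv ^^ 3) f)"

definition Diff3_cover :: "(real \<Rightarrow> real) set"
  where "Diff3_cover =
    {q. bij q \<and> strict_mono q \<and> C3_function q \<and> C3_function (inv_into UNIV q) \<and>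
        (\<forall>\<phi>. q (\<phi> + 2 * pi) = q \<phi> + 2 * pi)}"

definition Diff3_cover_group :: "(real \<Rightarrow> real) monoid"
  where "Diff3_cover_group = \<lparr>carrier = Diff3_cover, mult = (\<circ>), one = id\<rparr>"

text \<open>The \<open>C\<^sup>3\<close>-topology: uniform convergence of the derivatives of order \<open>0, \<dots>, 3\<close>.
  The difference of two elements is periodic, so uniformity over the
  line is the same as uniformity over a period.\<close>

definition C3_near :: "real \<Rightarrow> (real \<Rightarrow> real) \<Rightarrow> (real \<Rightarrow> real) \<Rightarrow> bool"
  where "C3_near \<epsilon> p q \<longleftrightarrow> (\<forall>k\<le>3. \<forall>\<phi>. \<bar>(deriv ^^ k) p \<phi> - (deriv ^^ k) q \<phi>\<bar> < \<epsilon>)"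

definition C3_topology :: "(real \<Rightarrow> real) topology"
  where "C3_topology = topology (\<lambda>U. U \<subseteq> Diff3_cover \<and>
    (\<forall>p\<in>U. \<exists>\<epsilon>>0. \<forall>q\<in>Diff3_cover. C3_near \<epsilon> p q \<longrightarrow> q \<in> U))"

lemma openin_C3_topology:
  "openin C3_topology U \<longleftrightarrow> U \<subseteq> Diff3_cover \<and>
    (\<forall>p\<in>U. \<exists>\<epsilon>>0. \<forall>q\<in>Diff3_cover. C3_near \<epsilon> p q \<longrightarrow> q \<in> U)"
proof -
  have mono: "C3_near \<epsilon> p q" if "C3_near \<delta> p q" "\<delta> \<le> \<epsilon>" for \<delta> \<epsilon> p q
    using that unfolding C3_near_def by (auto intro: less_le_trans)
  let ?O = "\<lambda>U. U \<subseteq> Diff3_cover \<and>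
    (\<forall>p\<in>U. \<exists>\<epsilon>>0. \<forall>q\<in>Diff3_cover. C3_near \<epsilon> p q \<longrightarrow> q \<in> U)"
  have "istopology ?O"
    unfolding istopology_def
  proof (intro conjI allI impI)
    fix S T assume S: "?O S" and T: "?O T"
    show "S \<inter> T \<subseteq> Diff3_cover" using S by blast
    show "\<forall>p\<in>S \<inter> T. \<exists>\<epsilon>>0. \<forall>q\<in>Diff3_cover. C3_near \<epsilon> p q \<longrightarrow> q \<in> S \<inter> T"
    proof
      fix p assume "p \<in> S \<inter> T"
      then have "p \<in> S" "p \<in> T" by simp_all
      from S \<open>p \<in> S\<close> obtain a where a: "a > 0" "\<forall>q\<in>Diff3_cover. C3_near a p q \<longrightarrow> q \<in> S"
        by blast
      from T \<open>p \<in> T\<close> obtain b where b: "b > 0" "\<forall>q\<in>Diff3_cover. C3_near b p q \<longrightarrow> q \<in> T"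
        by blast
      have "\<forall>q\<in>Diff3_cover. C3_near (min a b) p q \<longrightarrow> q \<in> S \<inter> T"
        using a(2) b(2) mono[of "min a b" p _ a] mono[of "min a b" p _ b] by simp
      moreover have "min a b > 0" using a(1) b(1) by simp
      ultimately show "\<exists>\<epsilon>>0. \<forall>q\<in>Diff3_cover. C3_near \<epsilon> p q \<longrightarrow> q \<in> S \<inter> T"
        by blast
    qed
  next
    fix \<K> assume K: "\<forall>K\<in>\<K>. ?O K"
    show "\<Union>\<K> \<subseteq> Diff3_cover" using K by blast
    show "\<forall>p\<in>\<Union>\<K>. \<exists>\<epsilon>>0. \<forall>q\<in>Diff3_cover. C3_near \<epsilon> p q \<longrightarrow> q \<in> \<Union>\<K>"
    proof
      fix p assume "p \<in> \<Union>\<K>"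
      then obtain X where X: "X \<in> \<K>" "p \<in> X" by blast
      with K obtain \<epsilon> where "\<epsilon> > 0" "\<forall>q\<in>Diff3_cover. C3_near \<epsilon> p q \<longrightarrow> q \<in> X"
        by blast
      with X(1) show "\<exists>\<epsilon>>0. \<forall>q\<in>Diff3_cover. C3_near \<epsilon> p q \<longrightarrow> q \<in> \<Union>\<K>"
        by blast
    qed
  qed
  then show ?thesis
    unfolding C3_topology_def by (simp add: topology_inverse')
qed

lemma topspace_C3_topology: "topspace C3_topology = Diff3_cover"
proof (rule antisym)
  show "topspace C3_topology \<subseteq> Diff3_cover"
    using openin_topspace[of C3_topology] unfolding openin_C3_topology by blast
  have "openin C3_topology Diff3_cover"
    unfolding openin_C3_topology using zero_less_one by blast
  then show "Diff3_cover \<subseteq> topspace C3_topology"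
    by (rule openin_subset)
qed


section \<open>The central extension given by the Bott cocycle\<close>

text \<open>The integrator \<open>ln q\<^sub>2'\<close> is \<open>C\<^sup>2\<close>, so \<open>d ln q\<^sub>2'\<close> is \<open>(ln q\<^sub>2')' d\<phi>\<close>.\<close>

definition bott_cocycle :: "(real \<Rightarrow> real) \<Rightarrow> (real \<Rightarrow> real) \<Rightarrow> real"
  where "bott_cocycle q1 q2 =
    integral {0..2 * pi} (\<lambda>\<phi>. ln (deriv q1 (q2 \<phi>)) * deriv (\<lambda>\<psi>. ln (deriv q2 \<psi>)) \<phi>)"

definition bott_extension :: "((real \<Rightarrow> real) \<times> real) monoid"
  where "bott_extension =
    \<lparr>carrier = Diff3_cover \<times> UNIV,
     mult = (\<lambda>(q1, t1) (q2, t2). (q1 \<circ> q2, t1 + t2 + bott_cocycle q1 q2)),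
     one = (id, 0)\<rparr>"

definition bott_extension_topology :: "((real \<Rightarrow> real) \<times> real) topology"
  where "bott_extension_topology = prod_topology C3_topology euclideanreal"


section \<open>The universal covering of \<open>SL\<^sub>2(\<real>)\<close>\<close>

text \<open>The real projective line is \<open>real option\<close>, with \<^const>\<open>None\<close> as the point at infinity.\<close>

definition angle_to_RP1 :: "real \<Rightarrow> real option"
  where "angle_to_RP1 \<phi> = (if cos (\<phi> / 2) = 0 then None else Some (tan (\<phi> / 2)))"

fun linear_fractional :: "real \<Rightarrow> real \<Rightarrow> real \<Rightarrow> real \<Rightarrow> real option \<Rightarrow> real option"
  where
    "linear_fractional a b c d None = (if c = 0 then None else Some (a / c))"
  | "linear_fractional a b c d (Some x) =
      (if c * x + d = 0 then None else Some ((a * x + b) / (c * x + d)))"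

definition SL2_cover :: "(real \<Rightarrow> real) set"
  where "SL2_cover =
    {q \<in> Diff3_cover. \<exists>a b c d. a * d - b * c = 1 \<and>
       (\<forall>\<phi>. angle_to_RP1 (q \<phi>) = linear_fractional a b c d (angle_to_RP1 \<phi>))}"

text \<open>A continuous homomorphism into the extension lifting the inclusion of
  \<^const>\<open>SL2_cover\<close>; it is unique up to its irrelevant values outside \<^const>\<open>SL2_cover\<close>.\<close>

definition SL2_cover_lift :: "((real \<Rightarrow> real) \<Rightarrow> (real \<Rightarrow> real) \<times> real) \<Rightarrow> bool"
  where "SL2_cover_lift s \<longleftrightarrow>
    s \<in> hom (Diff3_cover_group\<lparr>carrier := SL2_cover\<rparr>) bott_extension \<and>
    continuous_map (subtopology C3_topology SL2_cover) bott_extension_topology s \<and>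
    (\<forall>q\<in>SL2_cover. fst (s q) = q)"

end

theory Submission
  imports Defs
begin

text \<open>
  Let \<open>\<rho>\<close> be an irreducible unitary representation of the extension, \<open>V\<close> the space of vectors invariant under the
  subgroup \<open>K = SL\<^sub>2(\<real>)\<^sup>~\<close>, and \<open>P\<close> the orthogonal projection onto \<open>V\<close>.  The point is that the compressions
  \<open>P \<rho>(g) P\<close> commute with each other.  They form a family closed under adjoints and acting irreducibly on \<open>V\<close>, so
  commutativity forces them to be scalars and \<open>V\<close> to have dimension at most one
  (\<open>commuting_compressions_dim_le_1\<close>).  Instead of the spectral theorem this step uses only square roots: for a
  symmetric operator \<open>B\<close> that commutes with the family and \<open>R = (B\<^sup>2)\<^sup>1\<^sup>/\<^sup>2\<close>, the product \<open>(R - B)(R + B)\<close> vanishes,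
  and the kernel of \<open>R - B\<close> is an invariant subspace.

  Commutativity comes from the noncompactness of \<open>K\<close>.  Let \<open>a\<close> be the element of \<open>K\<close> over \<open>x \<mapsto> x / 2\<close>.  A vector fixed by \<open>a\<close> is
  fixed by the unipotent elements, which conjugation by powers of \<open>a\<close> contracts to the identity (Mautner
  phenomenon), hence by \<open>K\<close>.  By the mean ergodic theorem the means of \<open>\<rho>(a\<^sup>n)\<close> and of \<open>\<rho>(a\<^sup>-\<^sup>n)\<close> therefore converge
  strongly to \<open>P\<close>.  If \<open>g\<close> is the identity near the point \<open>0\<close> of the circle and \<open>h\<close> is the identity near the antipodal point \<open>\<pi>\<close>,
  then for large \<open>n\<close> the supports of \<open>g\<close> and of \<open>a\<^sup>n h a\<^sup>-\<^sup>n\<close> are disjoint.  Such elements commute in the extension, because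
  the integrand of the Bott cocycle vanishes.  Thus \<open>P g a\<^sup>n h P = P h a\<^sup>-\<^sup>n g P\<close>, and averaging over \<open>n\<close> yields
  \<open>P g P h P = P h P g P\<close> (\<open>commuting_disjoint\<close>).

  It remains to reach all elements.  The compression depends only on the double coset \<open>K g K\<close> and is continuous in
  \<open>g\<close>.  A Sturm comparison argument (\<open>projective_Schwarzian_zero\<close>) shows that every diffeomorphism \<open>q\<close> agrees to third order
  with some projective map at some point.  Its double coset thus contains an element with the 3-jet of the identity at \<open>0\<close>
  (\<open>double_coset_flat\<close>), and such an element is a limit, in the topology of three derivatives, of diffeomorphisms that are the
  identity near \<open>0\<close> (\<open>flatten_near_zero\<close>).

  That the extension is a topological group is proved by expressing convergence through uniform limits of the first three
  derivatives.
\<close>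

section \<open>Geometry of complex Hilbert spaces\<close>

lemma cinner_scaleR_left: "cinner (scaleR r x) y = scaleR r (cinner x y)"
  for x y :: "'a::complex_hilbert_space"
  by (metis cinner_scaleC_left scaleC_of_real scaleR_conv_of_real)

lemma cinner_scaleC_right: "cinner x (scaleC a y) = cnj a * cinner x y"
  for x y :: "'a::complex_hilbert_space"
  by (metis cinner_commute cinner_scaleC_left complex_cnj_mult)

lemma cinner_scaleR_right: "cinner x (scaleR r y) = scaleR r (cinner x y)"
  for x y :: "'a::complex_hilbert_space"
  by (metis cinner_scaleC_right complex_cnj_complex_of_real scaleC_of_real scaleR_conv_of_real)

lemma cinner_add_right: "cinner x (y + z) = cinner x y + cinner x z"
  for x y z :: "'a::complex_hilbert_space"
  by (metis cinner_add_left cinner_commute complex_cnj_add)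

lemma cinner_diff_left: "cinner (x - y) z = cinner x z - cinner y z"
  for x y z :: "'a::complex_hilbert_space"
  by (metis add_diff_cancel_right' cinner_add_left diff_add_cancel)

lemma cinner_diff_right: "cinner x (y - z) = cinner x y - cinner x z"
  for x y z :: "'a::complex_hilbert_space"
  by (metis add_diff_cancel_right' cinner_add_right diff_add_cancel)

lemma cinner_zero_left [simp]: "cinner 0 x = 0" and cinner_zero_right [simp]: "cinner x 0 = 0"
  for x :: "'a::complex_hilbert_space"
  using cinner_diff_left[of 0 0 x] cinner_diff_right[of x 0 0] by simp_all

lemma cinner_eq_zero_iff: "cinner x x = 0 \<longleftrightarrow> x = 0" for x :: "'a::complex_hilbert_space"
  by (simp add: cinner_self)

lemma norm_diff_squared:
  "(norm (x - y))\<^sup>2 = (norm x)\<^sup>2 - 2 * Re (cinner x y) + (norm y)\<^sup>2"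
  for x y :: "'a::complex_hilbert_space"
proof -
  have "complex_of_real ((norm (x - y))\<^sup>2) = cinner x x - (cinner x y + cnj (cinner x y)) + cinner y y"
    by (simp add: cinner_self[symmetric] cinner_diff_left cinner_diff_right cinner_commute[of y x]
        del: of_real_power)
  then have "(norm (x - y))\<^sup>2 = Re (cinner x x - (cinner x y + cnj (cinner x y)) + cinner y y)"
    by (metis Re_complex_of_real)
  then show ?thesis by (simp add: cinner_self del: of_real_power)
qed

lemma norm_add_squared:
  "(norm (x + y))\<^sup>2 = (norm x)\<^sup>2 + 2 * Re (cinner x y) + (norm y)\<^sup>2"
  for x y :: "'a::complex_hilbert_space"
proof -
  have "cinner x (- y) = - cinner x y"
    using cinner_diff_right[of x 0 y] by simp
  then show ?thesis using norm_diff_squared[of x "- y"] by simp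
qed

lemma norm_scaleC: "norm (scaleC a x) = cmod a * norm x" for x :: "'a::complex_hilbert_space"
proof -
  have "complex_of_real ((norm (scaleC a x))\<^sup>2) = (a * cnj a) * complex_of_real ((norm x)\<^sup>2)"
    unfolding cinner_self[symmetric] cinner_scaleC_left cinner_scaleC_right by (simp add: mult.assoc)
  also have "\<dots> = complex_of_real ((cmod a * norm x)\<^sup>2)"
    by (simp only: complex_norm_square[symmetric] power_mult_distrib of_real_mult)
  finally have "(norm (scaleC a x))\<^sup>2 = (cmod a * norm x)\<^sup>2"
    using of_real_eq_iff by blast
  then show ?thesis by (simp add: power2_eq_iff_nonneg)
qed

text \<open>Subtracting from \<open>x\<close> its component along \<open>y\<close> shortens it by exactly the length of
  that component.  Nonnegativity of the left side is the Cauchy-Schwarz inequality, and minimality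
  of a distance forces the component to vanish in the projection theorem.\<close>

lemma norm_minus_component:
  fixes x y :: "'a::complex_hilbert_space"
  assumes "y \<noteq> 0"
  shows "(norm (x - scaleC (cinner x y / (norm y)\<^sup>2) y))\<^sup>2
           = (norm x)\<^sup>2 - (cmod (cinner x y))\<^sup>2 / (norm y)\<^sup>2"
proof -
  let ?c = "cinner x y"
  have "Re (cnj ?c * ?c / complex_of_real ((norm y)\<^sup>2)) = (cmod ?c)\<^sup>2 / (norm y)\<^sup>2"
    by (simp only: Re_divide_of_real cmod_power2 mult.commute[of "cnj _"]) (simp add: power2_eq_square)
  then have "Re (cinner x (scaleC (?c / (norm y)\<^sup>2) y)) = (cmod ?c)\<^sup>2 / (norm y)\<^sup>2"
    by (simp add: cinner_scaleC_right)
  moreover have "norm (scaleC (?c / (norm y)\<^sup>2) y) = cmod ?c / norm y"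
  proof -
    have "norm (complex_of_real ((norm y)\<^sup>2)) = (norm y)\<^sup>2" by (simp only: norm_of_real abs_power2)
    then show ?thesis using assms by (simp only: norm_scaleC norm_divide) (simp add: power2_eq_square)
  qed
  ultimately show ?thesis by (simp add: norm_diff_squared power_divide)
qed

lemma cinner_Cauchy_Schwarz: "cmod (cinner x y) \<le> norm x * norm y"
  for x y :: "'a::complex_hilbert_space"
proof (cases "y = 0")
  case False
  have "0 \<le> (norm x)\<^sup>2 - (cmod (cinner x y))\<^sup>2 / (norm y)\<^sup>2"
    using norm_minus_component[OF False, of x] by (metis zero_le_power2)
  then have "(cmod (cinner x y))\<^sup>2 \<le> (norm x * norm y)\<^sup>2"
    using False by (simp add: field_simps power_mult_distrib)
  then show ?thesis by (rule power2_le_imp_le) simp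
qed simp

lemma bounded_bilinear_cinner: "bounded_bilinear (cinner :: 'a::complex_hilbert_space \<Rightarrow> _)"
  by (rule bounded_bilinear.intro)
    (auto simp: cinner_add_left cinner_add_right cinner_scaleR_left cinner_scaleR_right
      intro!: exI[of _ 1] cinner_Cauchy_Schwarz)

lemmas tendsto_cinner = bounded_bilinear.tendsto[OF bounded_bilinear_cinner]
  and continuous_on_cinner = bounded_bilinear.continuous_on[OF bounded_bilinear_cinner]

lemma bounded_linear_scaleC: "bounded_linear (scaleC a :: 'a::complex_hilbert_space \<Rightarrow> 'a)"
proof (rule bounded_linear_intro[where K = "cmod a"])
  fix r and x :: 'a
  show "scaleC a (r *\<^sub>R x) = r *\<^sub>R scaleC a x"
    by (metis mult.commute scaleC_of_real scaleC_scaleC)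
qed (simp_all add: scaleC_add_right norm_scaleC mult.commute)

lemma subspace_real:
  assumes "complex_vector.subspace M" "x \<in> M"
  shows "scaleR r x \<in> M"
  using assms by (metis complex_vector.subspace_scale scaleC_of_real)

text \<open>A minimizing sequence for the distance is Cauchy by the parallelogram law.\<close>

theorem orthogonal_projection_exists:
  fixes M :: "'a::complex_hilbert_space set"
  assumes M: "complex_vector.subspace M" "closed M"
  shows "\<exists>m\<in>M. \<forall>y\<in>M. cinner (x - m) y = 0"
proof -
  have ne: "M \<noteq> {}" using complex_vector.subspace_0[OF M(1)] by blast
  define d where "d = infdist x M"
  have d0: "d \<ge> 0" by (simp add: d_def infdist_nonneg)
  have dle: "d \<le> norm (x - m)" if "m \<in> M" for m
    using infdist_le[OF that, of x] by (simp add: d_def dist_norm)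
  have "\<exists>m\<in>M. norm (x - m) < d + 1 / Suc n" for n
  proof -
    have "infdist x M < d + 1 / Suc n" by (simp add: d_def)
    then have "(INF a\<in>M. dist x a) < d + 1 / Suc n"
      using ne by (simp add: infdist_def)
    then show ?thesis
      using ne by (subst (asm) cINF_less_iff) (auto simp: dist_norm intro!: bdd_belowI[of _ 0])
  qed
  then obtain m where m: "\<And>n. m n \<in> M" "\<And>n. norm (x - m n) < d + 1 / Suc n" by metis
  have close: "(norm (m i - m j))\<^sup>2 \<le> 2 * ((norm (x - m i))\<^sup>2 + (norm (x - m j))\<^sup>2) - 4 * d\<^sup>2" for i j
  proof -
    let ?a = "x - m i" and ?b = "x - m j"
    have mid: "(1/2) *\<^sub>R (m i + m j) \<in> M"
      using M(1) m(1) by (intro subspace_real complex_vector.subspace_add)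
    have "?a + ?b = 2 *\<^sub>R (x - (1/2) *\<^sub>R (m i + m j))"
      by (simp add: algebra_simps scaleR_2)
    then have "norm (?a + ?b) = 2 * norm (x - (1/2) *\<^sub>R (m i + m j))" by simp
    then have "2 * d \<le> norm (?a + ?b)" using dle[OF mid] by simp
    then have "(2 * d)\<^sup>2 \<le> (norm (?a + ?b))\<^sup>2" using d0 by (intro power_mono) auto
    moreover have "norm (m i - m j) = norm (?a - ?b)" by (simp add: norm_minus_commute)
    moreover have "(norm (?a + ?b))\<^sup>2 + (norm (?a - ?b))\<^sup>2 = 2 * ((norm ?a)\<^sup>2 + (norm ?b)\<^sup>2)"
      using norm_add_squared[of ?a ?b] norm_diff_squared[of ?a ?b] by (simp only:) simp
    ultimately show ?thesis by (simp add: power_mult_distrib)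
  qed
  have lim: "(\<lambda>n. d + 1 / Suc n) \<longlonglongrightarrow> d"
    using LIMSEQ_Suc[OF lim_1_over_n[where 'a=real]] tendsto_add[OF tendsto_const, of "\<lambda>n. 1 / Suc n" 0 sequentially d]
    by simp
  have nlim: "(\<lambda>n. norm (x - m n)) \<longlonglongrightarrow> d"
    by (rule tendsto_sandwich[OF _ _ tendsto_const lim]) (intro always_eventually allI dle m(1) less_imp_le[OF m(2)])+
  have "Cauchy m"
  proof (rule CauchyI)
    fix e :: real assume e: "e > 0"
    have "(\<lambda>n. (norm (x - m n))\<^sup>2) \<longlonglongrightarrow> d\<^sup>2" by (intro tendsto_power nlim)
    then have "\<forall>\<^sub>F n in sequentially. (norm (x - m n))\<^sup>2 < d\<^sup>2 + e\<^sup>2 / 4"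
      using e by (intro order_tendstoD(2)) auto
    then obtain N where N: "\<And>n. n \<ge> N \<Longrightarrow> (norm (x - m n))\<^sup>2 < d\<^sup>2 + e\<^sup>2 / 4"
      by (auto simp: eventually_sequentially)
    show "\<exists>N. \<forall>i\<ge>N. \<forall>j\<ge>N. norm (m i - m j) < e"
    proof (intro exI allI impI)
      fix i j assume "i \<ge> N" "j \<ge> N"
      then have "(norm (m i - m j))\<^sup>2 < e\<^sup>2"
        using close[of i j] N[of i] N[of j] by simp
      then show "norm (m i - m j) < e" using e by (simp add: power2_less_imp_less)
    qed
  qed
  then obtain l where l: "m \<longlonglongrightarrow> l" using Cauchy_convergent_iff convergent_def by blast
  have lM: "l \<in> M" by (rule closed_sequentially[OF M(2) m(1) l])
  have "(\<lambda>n. norm (x - m n)) \<longlonglongrightarrow> norm (x - l)" by (intro tendsto_intros l)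
  then have dl: "norm (x - l) = d" using nlim LIMSEQ_unique by blast
  have "cinner (x - l) y = 0" if y: "y \<in> M" for y
  proof (cases "y = 0")
    case False
    let ?t = "scaleC (cinner (x - l) y / (norm y)\<^sup>2) y"
    have "l + ?t \<in> M"
      using lM y M(1) by (intro complex_vector.subspace_add complex_vector.subspace_scale)
    then have "d \<le> norm (x - l - ?t)" using dle by (metis diff_diff_eq)
    then have "d\<^sup>2 \<le> (norm (x - l - ?t))\<^sup>2" using d0 by (intro power_mono) auto
    then have "(cmod (cinner (x - l) y))\<^sup>2 / (norm y)\<^sup>2 \<le> 0"
      using norm_minus_component[OF False, of "x - l"] dl by simp
    then show ?thesis using False by (simp add: divide_le_0_iff)
  qed simp
  with lM show ?thesis by blast
qed


definition orthogonal_projection_onto :: "'a::complex_hilbert_space set \<Rightarrow> ('a \<Rightarrow> 'a) \<Rightarrow> bool"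
  where "orthogonal_projection_onto V P \<longleftrightarrow> (\<forall>x. P x \<in> V \<and> (\<forall>y\<in>V. cinner (x - P x) y = 0))"

lemma orthogonal_projection_unique:
  assumes "complex_vector.subspace V" "orthogonal_projection_onto V P"
    and "n \<in> V" "\<And>y. y \<in> V \<Longrightarrow> cinner (x - n) y = 0"
  shows "P x = n"
proof -
  have d: "P x - n \<in> V"
    using assms by (intro complex_vector.subspace_diff) (auto simp: orthogonal_projection_onto_def)
  have "cinner (x - P x) (P x - n) = 0"
    using assms(2) d unfolding orthogonal_projection_onto_def by blast
  then have "cinner ((x - n) - (x - P x)) (P x - n) = 0"
    using assms(4)[OF d] by (simp only: cinner_diff_left[of "x - n" "x - P x"] diff_self)
  then show ?thesis by (simp add: cinner_eq_zero_iff)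
qed

section \<open>The mean ergodic theorem\<close>

lemma unitary_operatorD:
  assumes "unitary_operator U"
  shows "U (x + y) = U x + U y" "U (x - y) = U x - U y" "U (scaleC a x) = scaleC a (U x)"
    "cinner (U x) (U y) = cinner x y" "norm (U x) = norm x" "surj U" "inj U" "bounded_linear U"
proof -
  have lin: "Vector_Spaces.linear scaleC scaleC U"
    and inner: "\<And>x y. cinner (U x) (U y) = cinner x y"
    using assms by (auto simp: unitary_operator_def)
  interpret Vector_Spaces.linear scaleC scaleC U by (rule lin)
  show a: "U (x + y) = U x + U y" "U (scaleC a x) = scaleC a (U x)" for x y a
    by (simp_all add: add scale)
  show d: "U (x - y) = U x - U y" for x y by (simp add: diff)
  show "cinner (U x) (U y) = cinner x y" by (rule inner)
  have "complex_of_real ((norm (U x))\<^sup>2) = complex_of_real ((norm x)\<^sup>2)" for x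
    unfolding cinner_self[symmetric] by (rule inner)
  then have "(norm (U x))\<^sup>2 = (norm x)\<^sup>2" for x using of_real_eq_iff by blast
  then show n: "norm (U x) = norm x" for x by (simp add: power2_eq_iff_nonneg)
  show "surj U" using assms by (simp add: unitary_operator_def)
  show "inj U" by (rule injI) (metis d n eq_iff_diff_eq_0 norm_eq_zero)
  show "bounded_linear U"
    by (rule bounded_linear_intro[where K = 1]) (auto simp: a n, metis a(2) scaleC_of_real)
qed

lemma subspace_fixed_points:
  assumes "unitary_operator U" shows "complex_vector.subspace {x. U x = x}"
  using unitary_operatorD[OF assms] by (auto simp: complex_vector.subspace_def)
    (metis cancel_comm_monoid_add_class.diff_cancel)

text \<open>The orthogonal complement of the closure \<open>M\<close> of the range of \<open>1 - U\<close> is the fixed space of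
  \<open>U\<close>.  The means of the powers leave fixed vectors alone, and telescope to zero on \<open>M\<close>.\<close>

theorem mean_ergodic:
  fixes U :: "'a::complex_hilbert_space \<Rightarrow> 'a"
  assumes U: "unitary_operator U" and P: "orthogonal_projection_onto {x. U x = x} P"
  shows "(\<lambda>N. (1 / real N) *\<^sub>R (\<Sum>n<N. (U ^^ n) x)) \<longlonglongrightarrow> P x"
proof -
  note UD = unitary_operatorD[OF U]
  define R where "R = range (\<lambda>y. y - U y)"
  define M where "M = closure R"
  have R0: "0 \<in> R" unfolding R_def by (rule range_eqI[of _ _ 0]) (metis UD(2) diff_self)
  have Radd: "u + v \<in> R" if uv: "u \<in> R" "v \<in> R" for u v
  proof -
    obtain y z where "u = y - U y" "v = z - U z" using uv by (auto simp: R_def)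
    then have "u + v = (y + z) - U (y + z)" by (simp add: UD(1))
    then show ?thesis by (auto simp: R_def)
  qed
  have Rscale: "scaleC a u \<in> R" if u: "u \<in> R" for a u
  proof -
    obtain y where "u = y - U y" using u by (auto simp: R_def)
    then have "scaleC a u = scaleC a y - U (scaleC a y)"
      by (simp add: UD(3) complex_vector.scale_right_diff_distrib)
    then show ?thesis by (auto simp: R_def)
  qed
  have M: "complex_vector.subspace M" unfolding complex_vector.subspace_def
  proof (intro conjI ballI allI)
    show "0 \<in> M" using R0 closure_subset unfolding M_def by blast
    fix u assume u: "u \<in> M"
    then obtain f where f: "\<And>n. f n \<in> R" "f \<longlonglongrightarrow> u" by (auto simp: M_def closure_sequential)
    show "scaleC a u \<in> M" for a
      unfolding M_def closure_sequential
      by (intro exI[of _ "\<lambda>n. scaleC a (f n)"] conjI allI Rscale f(1)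
          bounded_linear.tendsto[OF bounded_linear_scaleC f(2)])
    fix v assume v: "v \<in> M"
    then obtain g where g: "\<And>n. g n \<in> R" "g \<longlonglongrightarrow> v" by (auto simp: M_def closure_sequential)
    show "u + v \<in> M"
      unfolding M_def closure_sequential
      by (intro exI[of _ "\<lambda>n. f n + g n"] conjI allI Radd f(1) g(1) tendsto_add[OF f(2) g(2)])
  qed
  obtain m where m: "m \<in> M" "\<And>y. y \<in> M \<Longrightarrow> cinner (x - m) y = 0"
    using orthogonal_projection_exists[OF M, of x] by (auto simp: M_def)
  define n where "n = x - m"
  have "U n = n"
  proof -
    have "n - U n \<in> M" using closure_subset[of R] by (auto simp: M_def R_def)
    then have "cinner n (n - U n) = 0" using m(2) by (simp add: n_def)
    then have "cinner n (U n) = cinner n n" by (simp add: cinner_diff_right)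
    then have "(norm (n - U n))\<^sup>2 = 0"
      by (simp add: norm_diff_squared UD(5) cinner_self del: of_real_power)
    then show ?thesis by simp
  qed
  moreover have "cinner (x - n) y = 0" if y: "U y = y" for y
  proof -
    have 0: "cinner u y = 0" if u: "u \<in> R" for u
    proof -
      obtain z where "u = z - U z" using u by (auto simp: R_def)
      then show ?thesis using UD(4)[of z y] y by (simp add: cinner_diff_left)
    qed
    obtain f where f: "\<And>n. f n \<in> R" "f \<longlonglongrightarrow> m" using m(1) by (auto simp: M_def closure_sequential)
    have "(\<lambda>n. cinner (f n) y) \<longlonglongrightarrow> cinner m y" by (intro tendsto_cinner f tendsto_const)
    then have "cinner m y = 0" using 0 f(1) by (simp add: LIMSEQ_const_iff)
    then show ?thesis by (simp add: n_def)
  qed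
  ultimately have Px: "P x = n"
    using orthogonal_projection_unique[OF subspace_fixed_points[OF U] P] by auto
  define A where "A = (\<lambda>N z. (1 / real N) *\<^sub>R (\<Sum>n<N. (U ^^ n) z))"
  have pow_add: "(U ^^ k) (u + v) = (U ^^ k) u + (U ^^ k) v" for k u v
    by (induction k) (simp_all add: UD)
  have pow_norm: "norm ((U ^^ k) u) = norm u" for k u by (induction k) (simp_all add: UD)
  have A_add: "A N (u + v) = A N u + A N v" for N u v
    by (simp add: A_def pow_add sum.distrib scaleR_add_right)
  have A_norm: "norm (A N u) \<le> norm u" for N u
  proof (cases "N = 0")
    case False
    have "norm (\<Sum>n<N. (U ^^ n) u) \<le> (\<Sum>n<N. norm u)"
      by (rule order_trans[OF norm_sum]) (simp add: pow_norm)
    then show ?thesis using False by (simp add: A_def field_simps)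
  qed (simp add: A_def)
  have A_n: "A N n = n" if "N > 0" for N
  proof -
    have "(U ^^ k) n = n" for k by (induction k) (simp_all add: \<open>U n = n\<close>)
    then show ?thesis using that by (simp add: A_def scaleR_conv_of_real sum_constant_scaleR)
  qed
  have A_R: "norm (A N (y - U y)) \<le> 2 * norm y / N" for N y
  proof -
    have pow_diff: "(U ^^ k) (u - v) = (U ^^ k) u - (U ^^ k) v" for k u v
      by (induction k) (simp_all add: UD)
    have "(\<Sum>n<N. (U ^^ n) (y - U y)) = y - (U ^^ N) y"
      by (induction N) (simp_all add: pow_diff funpow_swap1)
    moreover have "norm (y - (U ^^ N) y) \<le> 2 * norm y"
      using norm_triangle_ineq4[of y "(U ^^ N) y"] by (simp add: pow_norm)
    ultimately show ?thesis by (simp add: A_def divide_right_mono)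
  qed
  have "(\<lambda>N. A N m) \<longlonglongrightarrow> 0"
  proof (rule LIMSEQ_I)
    fix e :: real assume e: "e > 0"
    obtain u where u: "u \<in> R" "dist u m < e / 2"
      using m(1) e unfolding M_def by (meson closure_approachable half_gt_zero)
    obtain y where y: "u = y - U y" using u(1) by (auto simp: R_def)
    obtain N0 :: nat where N0: "N0 > 4 * norm y / e" using reals_Archimedean2 by blast
    have "norm (A N m) < e" if "N \<ge> Suc N0" for N
    proof -
      have "A N m = A N (m - u) + A N u" using A_add[of N "m - u" u] by simp
      then have "norm (A N m) \<le> norm (m - u) + 2 * norm y / N"
        using A_norm[of N "m - u"] A_R[of N y] norm_triangle_ineq[of "A N (m - u)" "A N u"] y by simp
      moreover have "2 * norm y / N < e / 2"
      proof -
        have "4 * norm y / e < N" using N0 that by (smt (verit) Suc_le_lessD of_nat_less_iff)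
        then show ?thesis using e that by (simp add: field_simps)
      qed
      ultimately show ?thesis using u(2) by (simp add: dist_norm norm_minus_commute)
    qed
    then show "\<exists>no. \<forall>N\<ge>no. norm (A N m - 0) < e" by auto
  qed
  then have "(\<lambda>N. A N m + n) \<longlonglongrightarrow> 0 + n" by (intro tendsto_add tendsto_const)
  moreover have "\<forall>\<^sub>F N in sequentially. A N m + n = A N x"
  proof (rule eventually_sequentiallyI[of 1])
    fix N :: nat assume "1 \<le> N"
    then show "A N m + n = A N x" using A_add[of N m n] A_n[of N] by (simp add: n_def)
  qed
  ultimately have "(\<lambda>N. A N x) \<longlonglongrightarrow> n" using Lim_transform_eventually by fastforce
  then show ?thesis by (simp add: A_def Px)
qed

section \<open>Commuting operators on a Hilbert space\<close>

text \<open>\<open>nonneg_poly T A a\<close> holds if \<open>A\<close> is the value at \<open>T\<close> of a polynomial with zero constant term and nonnegative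
  coefficients, and \<open>a\<close> is the value of the same polynomial at \<open>1\<close>.\<close>

inductive nonneg_poly :: "('a::real_normed_vector \<Rightarrow>\<^sub>L 'a) \<Rightarrow> ('a \<Rightarrow>\<^sub>L 'a) \<Rightarrow> real \<Rightarrow> bool"
  for T where
  base: "nonneg_poly T T 1"
| zero: "nonneg_poly T 0 0"
| add: "nonneg_poly T A a \<Longrightarrow> nonneg_poly T B b \<Longrightarrow> nonneg_poly T (A + B) (a + b)"
| comp: "nonneg_poly T A a \<Longrightarrow> nonneg_poly T B b \<Longrightarrow> nonneg_poly T (A o\<^sub>L B) (a * b)"
| scale: "nonneg_poly T A a \<Longrightarrow> r \<ge> 0 \<Longrightarrow> nonneg_poly T (r *\<^sub>R A) (r * a)"

lemmas blinfun_compose_simps = 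
  bounded_bilinear.add_left[OF bounded_bilinear_blinfun_compose]
  bounded_bilinear.add_right[OF bounded_bilinear_blinfun_compose]
  bounded_bilinear.diff_left[OF bounded_bilinear_blinfun_compose]
  bounded_bilinear.diff_right[OF bounded_bilinear_blinfun_compose]
  bounded_bilinear.scaleR_left[OF bounded_bilinear_blinfun_compose]
  bounded_bilinear.scaleR_right[OF bounded_bilinear_blinfun_compose]
  bounded_bilinear.zero_left[OF bounded_bilinear_blinfun_compose]
  bounded_bilinear.zero_right[OF bounded_bilinear_blinfun_compose]

lemma blinfun_compose_assoc: "(A o\<^sub>L B) o\<^sub>L C = A o\<^sub>L (B o\<^sub>L C)"
  by (rule blinfun_eqI) simp

lemma blinfun_compose_id [simp]: "id_blinfun o\<^sub>L A = A" "A o\<^sub>L id_blinfun = A"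
  by (rule blinfun_eqI, simp)+

lemma nonneg_poly_norm:
  assumes "nonneg_poly T A a" "norm T \<le> 1" shows "norm A \<le> a"
  using assms
proof induction
  case (add A a B b)
  then show ?case by (smt (verit) norm_triangle_ineq)
next
  case (comp A a B b)
  then show ?case
    by (intro order_trans[OF norm_blinfun_compose] mult_mono) (auto intro: order_trans[OF norm_ge_zero])
next
  case (scale A a r)
  then show ?case by (simp add: mult_left_mono)
qed auto

lemma nonneg_poly_commute:
  assumes "nonneg_poly T A a" "C o\<^sub>L T = T o\<^sub>L C" shows "C o\<^sub>L A = A o\<^sub>L C"
  using assms
proof induction
  case (comp A a B b)
  then have c: "C o\<^sub>L A = A o\<^sub>L C" "C o\<^sub>L B = B o\<^sub>L C" by blast+
  have "C o\<^sub>L (A o\<^sub>L B) = A o\<^sub>L (C o\<^sub>L B)" by (simp only: blinfun_compose_assoc[symmetric] c(1))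
  also have "\<dots> = (A o\<^sub>L B) o\<^sub>L C" by (simp only: blinfun_compose_assoc c(2))
  finally show ?case .
qed (simp_all add: blinfun_compose_simps)

text \<open>The iteration \<open>Y \<mapsto> (T + Y\<^sup>2) / 2\<close> started at \<open>0\<close> produces polynomials in \<open>T\<close> with nonnegative
  coefficients, and so are the differences of consecutive terms.  The norm of such a polynomial is
  at most its value at \<open>1\<close>, so the scalar iteration for \<open>T = 1\<close> dominates, and it converges.  The
  limit \<open>Y\<close> satisfies \<open>(1 - Y)\<^sup>2 = 1 - T\<close>.\<close>

theorem blinfun_sqrt_exists:
  fixes T :: "'a::banach \<Rightarrow>\<^sub>L 'a"
  assumes T: "norm T \<le> 1"
  obtains Y where "norm Y \<le> 1"
    "(id_blinfun - Y) o\<^sub>L (id_blinfun - Y) = id_blinfun - T"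
    "\<And>C. C o\<^sub>L T = T o\<^sub>L C \<Longrightarrow> C o\<^sub>L Y = Y o\<^sub>L C"
proof -
  define Y where "Y = rec_nat (0 :: 'a \<Rightarrow>\<^sub>L 'a) (\<lambda>_ Z. (1/2) *\<^sub>R (T + (Z o\<^sub>L Z)))"
  define y where "y = rec_nat (0 :: real) (\<lambda>_ z. (1/2) * (1 + z * z))"
  have Y0: "Y 0 = 0" and YS: "Y (Suc n) = (1/2) *\<^sub>R (T + (Y n o\<^sub>L Y n))" for n by (simp_all add: Y_def)
  have y0: "y 0 = 0" and yS: "y (Suc n) = (1/2) * (1 + y n * y n)" for n by (simp_all add: y_def)
  have pos: "nonneg_poly T (Y n) (y n)" for n
  proof (induction n)
    case (Suc n)
    then show ?case unfolding YS yS
      by (intro nonneg_poly.intros) auto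
  qed (simp add: Y0 y0 nonneg_poly.zero)
  have step: "nonneg_poly T (Y (Suc n) - Y n) (y (Suc n) - y n)" for n
  proof (induction n)
    case 0
    show ?case
      using nonneg_poly.scale[OF nonneg_poly.base, of "1/2" T]
      by (simp add: YS yS Y0 y0 blinfun_compose_simps)
  next
    case (Suc n)
    let ?p = "Y (Suc n)" and ?q = "Y n"
    have com: "?p o\<^sub>L ?q = ?q o\<^sub>L ?p"
      using pos nonneg_poly_commute by metis
    have 1: "(1/2) *\<^sub>R ((?p + ?q) o\<^sub>L (?p - ?q)) = Y (Suc (Suc n)) - ?p"
    proof -
      have "Y (Suc (Suc n)) - ?p = (1/2) *\<^sub>R (T + (?p o\<^sub>L ?p)) - (1/2) *\<^sub>R (T + (?q o\<^sub>L ?q))"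
        unfolding YS[of "Suc n", symmetric] YS[of n, symmetric] ..
      also have "\<dots> = (1/2) *\<^sub>R ((?p o\<^sub>L ?p) - (?q o\<^sub>L ?q))"
        by (simp add: scaleR_diff_right[symmetric])
      finally show ?thesis using com by (simp add: blinfun_compose_simps)
    qed
    have 2: "(1/2) * ((y (Suc n) + y n) * (y (Suc n) - y n)) = y (Suc (Suc n)) - y (Suc n)"
    proof -
      have "y (Suc (Suc n)) - y (Suc n)
          = (1/2) * (1 + y (Suc n) * y (Suc n)) - (1/2) * (1 + y n * y n)"
        unfolding yS[of "Suc n", symmetric] yS[of n, symmetric] ..
      then show ?thesis by (simp add: algebra_simps)
    qed
    have "nonneg_poly T ((1/2) *\<^sub>R ((?p + ?q) o\<^sub>L (?p - ?q)))
           ((1/2) * ((y (Suc n) + y n) * (y (Suc n) - y n)))"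
      by (intro nonneg_poly.scale nonneg_poly.comp nonneg_poly.add pos Suc) simp
    then show ?case unfolding 1 2 .
  qed
  have diff: "nonneg_poly T (Y (n + k) - Y n) (y (n + k) - y n)" for n k
  proof (induction k)
    case (Suc k)
    from nonneg_poly.add[OF step[of "n + k"] Suc] show ?case by (simp add: algebra_simps)
  qed (simp add: nonneg_poly.zero)
  have y_mono: "incseq y"
    using nonneg_poly_norm[OF step T] by (intro incseq_SucI) (smt (verit) norm_ge_zero)
  have y_bounds: "0 \<le> y n \<and> y n \<le> 1" for n
  proof (induction n)
    case (Suc n)
    then have "y n * y n \<le> 1 * 1" by (intro mult_mono) auto
    then show ?case by (auto simp: yS)
  qed (simp add: y0)
  have "Cauchy y"
    using y_mono y_bounds
    by (intro convergent_Cauchy Bseq_mono_convergent BseqI'[of _ 1]) (auto simp: incseq_def)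
  have "Cauchy Y"
  proof (rule CauchyI')
    fix e :: real assume "e > 0"
    then obtain N where N: "\<And>m n. m \<ge> N \<Longrightarrow> n \<ge> N \<Longrightarrow> norm (y m - y n) < e"
      using CauchyD[OF \<open>Cauchy y\<close>] by blast
    have "norm (Y m - Y n) < e" if "m \<ge> N" "n > m" for m n
    proof -
      have "norm (Y n - Y m) \<le> y n - y m"
        using nonneg_poly_norm[OF diff[of m "n - m"] T] that by simp
      also have "\<dots> < e" using N[of n m] that by simp
      finally show ?thesis by (simp add: norm_minus_commute)
    qed
    then show "\<exists>M. \<forall>m\<ge>M. \<forall>n>m. dist (Y m) (Y n) < e" unfolding dist_norm by blast
  qed
  then obtain L where L: "Y \<longlonglongrightarrow> L" by (meson Cauchy_convergent convergentD)
  have comp_lim: "(\<lambda>n. F n o\<^sub>L G n) \<longlonglongrightarrow> (f o\<^sub>L g)" if "F \<longlonglongrightarrow> f" "G \<longlonglongrightarrow> g"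
    for F G and f g :: "'a \<Rightarrow>\<^sub>L 'a"
    using that by (rule bounded_bilinear.tendsto[OF bounded_bilinear_blinfun_compose])
  show ?thesis
  proof (rule that)
    show "norm L \<le> 1"
      using tendsto_norm[OF L] nonneg_poly_norm[OF pos T] y_bounds
      by (intro LIMSEQ_le_const2[of "\<lambda>n. norm (Y n)"]) (auto intro: order_trans)
    have "(\<lambda>n. Y (Suc n)) \<longlonglongrightarrow> (1/2) *\<^sub>R (T + (L o\<^sub>L L))"
      unfolding YS by (intro tendsto_intros comp_lim L)
    then have "L = (1/2) *\<^sub>R (T + (L o\<^sub>L L))" using L LIMSEQ_Suc LIMSEQ_unique by blast
    then have "L + L = (1/2) *\<^sub>R (T + (L o\<^sub>L L)) + (1/2) *\<^sub>R (T + (L o\<^sub>L L))"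
      by (rule arg_cong2[where f = "(+)"]) fact
    also have "\<dots> = T + (L o\<^sub>L L)" by (simp only: scaleR_add_left[symmetric]) simp
    finally have "L + L = T + (L o\<^sub>L L)" .
    then show "(id_blinfun - L) o\<^sub>L (id_blinfun - L) = id_blinfun - T"
      by (simp add: blinfun_compose_simps algebra_simps)
    show "C o\<^sub>L L = L o\<^sub>L C" if "C o\<^sub>L T = T o\<^sub>L C" for C
    proof (rule LIMSEQ_unique)
      show "(\<lambda>n. C o\<^sub>L Y n) \<longlonglongrightarrow> (C o\<^sub>L L)" by (intro comp_lim L tendsto_const)
      show "(\<lambda>n. C o\<^sub>L Y n) \<longlonglongrightarrow> (L o\<^sub>L C)"
        unfolding nonneg_poly_commute[OF pos that] by (intro comp_lim L tendsto_const)
    qed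
  qed
qed

text \<open>A family of operators into \<open>V\<close> that leaves no closed complex subspace strictly between \<open>0\<close> and \<open>V\<close> invariant.
  The operators live on the whole space because a subspace is not a type; the retraction onto \<open>V\<close> that belongs to
  the family makes everything commuting with the family preserve \<open>V\<close>.\<close>

locale irreducible_operators =
  fixes V :: "'h::complex_hilbert_space set" and \<A> :: "('h \<Rightarrow>\<^sub>L 'h) set"
  assumes V_subspace: "complex_vector.subspace V"
    and into_V: "\<And>A x. A \<in> \<A> \<Longrightarrow> A x \<in> V"
    and V_retract: "\<exists>P\<in>\<A>. \<forall>x\<in>V. P x = x"
    and irreducible: "\<And>W. complex_vector.subspace W \<Longrightarrow> closed W \<Longrightarrow> W \<subseteq> V \<Longrightarrow>
      (\<And>A x. A \<in> \<A> \<Longrightarrow> x \<in> W \<Longrightarrow> A x \<in> W) \<Longrightarrow> W = {0} \<or> W = V"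
begin

text \<open>The operator \<open>R = (B\<^sup>2)\<^sup>1\<^sup>/\<^sup>2\<close> commutes with everything that commutes with \<open>B\<close>, so the kernel of
  \<open>R - B\<close> in \<open>V\<close> is an invariant subspace.  If it is all of \<open>V\<close> then \<open>B = R\<close> is nonnegative; if it
  is zero then \<open>(R - B)(R + B) = 0\<close> yields \<open>B = - R\<close>.\<close>

lemma symmetric_operator_semidefinite:
  fixes B :: "'h \<Rightarrow>\<^sub>L 'h"
  assumes sym: "\<And>x y. cinner (B x) y = cinner x (B y)"
    and comm: "\<And>A. A \<in> \<A> \<Longrightarrow> A o\<^sub>L B = B o\<^sub>L A"
    and clinear: "\<And>a x. B (scaleC a x) = scaleC a (B x)"
  shows "(\<forall>x\<in>V. 0 \<le> Re (cinner (B x) x)) \<or> (\<forall>x\<in>V. Re (cinner (B x) x) \<le> 0)"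
proof -
  \<comment> \<open>Rescaling makes the norm at most 1, so that \<open>1 - D\<^sup>2\<close> is a contraction and has a square root.\<close>
  define b where "b = norm B + 1"
  have b: "b > 0" by (simp add: b_def add_nonneg_pos)
  define D where "D = (1 / b) *\<^sub>R B"
  have B_eq: "blinfun_apply B x = b *\<^sub>R D x" for x using b by (simp add: D_def scaleR_blinfun.rep_eq)
  have D_norm: "norm (D x) \<le> norm x" for x
  proof -
    have "norm (D x) \<le> norm D * norm x" by (rule norm_blinfun)
    also have "\<dots> \<le> 1 * norm x" by (rule mult_right_mono) (use b in \<open>auto simp: D_def b_def field_simps\<close>)
    finally show ?thesis by simp
  qed
  have D_sym: "cinner (D x) y = cinner x (D y)" for x y
    by (simp add: D_def scaleR_blinfun.rep_eq cinner_scaleR_left cinner_scaleR_right sym)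
  define T where "T = id_blinfun - (D o\<^sub>L D)"
  have T: "norm T \<le> 1"
  proof (rule norm_blinfun_bound)
    fix x
    let ?u = "D x"
    have "cinner x (D ?u) = complex_of_real ((norm ?u)\<^sup>2)"
      by (simp add: D_sym[symmetric] cinner_self del: of_real_power)
    then have "Re (cinner x (D ?u)) = (norm ?u)\<^sup>2" by (metis Re_complex_of_real)
    then have "(norm (T x))\<^sup>2 = (norm x)\<^sup>2 - 2 * (norm ?u)\<^sup>2 + (norm (D ?u))\<^sup>2"
      by (simp add: T_def minus_blinfun.rep_eq norm_diff_squared)
    moreover have "(norm (D ?u))\<^sup>2 \<le> (norm ?u)\<^sup>2" using D_norm by (intro power_mono) auto
    ultimately have "(norm (T x))\<^sup>2 \<le> (norm x)\<^sup>2" by (smt (verit) zero_le_power2)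
    then have "norm (T x) \<le> norm x" by (rule power2_le_imp_le) simp
    then show "norm (T x) \<le> 1 * norm x" by simp
  qed simp
  obtain Y where Y: "norm Y \<le> 1" "(id_blinfun - Y) o\<^sub>L (id_blinfun - Y) = id_blinfun - T"
    "\<And>C. C o\<^sub>L T = T o\<^sub>L C \<Longrightarrow> C o\<^sub>L Y = Y o\<^sub>L C"
    by (rule blinfun_sqrt_exists[OF T]) blast
  define R where "R = id_blinfun - Y"
  have RR: "R (R x) = D (D x)" for x
    using arg_cong[OF Y(2), of "\<lambda>F. blinfun_apply F x"]
    by (simp add: R_def T_def)
  have R_comm: "C (R x) = R (C x)" if "\<And>x. C (D x) = D (C x)" for C :: "'h \<Rightarrow>\<^sub>L 'h" and x
  proof -
    have "C o\<^sub>L T = T o\<^sub>L C"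
      by (rule blinfun_eqI) (simp add: T_def minus_blinfun.rep_eq that blinfun.diff_right)
    from arg_cong[OF Y(3)[OF this], of "\<lambda>F. blinfun_apply F x"]
    show ?thesis by (simp add: R_def minus_blinfun.rep_eq blinfun.diff_right)
  qed
  have A_comm: "A (D x) = D (A x)" if "A \<in> \<A>" for A x
    using arg_cong[OF comm[OF that], of "\<lambda>F. blinfun_apply F x"]
    by (simp add: D_def scaleR_blinfun.rep_eq blinfun.scaleR_right)
  have scaleC_blinfun: "blinfun_apply (Blinfun (scaleC a)) = (scaleC a :: 'h \<Rightarrow> 'h)" for a
    by (rule bounded_linear_Blinfun_apply[OF bounded_linear_scaleC])
  have D_scaleC: "D (scaleC a x) = scaleC a (D x)" for a x
    by (simp add: D_def scaleR_blinfun.rep_eq clinear)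
      (metis scaleC_of_real scaleC_scaleC mult.commute)
  have R_scaleC: "R (scaleC a x) = scaleC a (R x)" for a x
    using R_comm[of "Blinfun (scaleC a)" x] by (simp add: scaleC_blinfun D_scaleC)
  obtain P where P: "P \<in> \<A>" "\<And>x. P x \<in> V" "\<And>x. x \<in> V \<Longrightarrow> P x = x"
    using V_retract into_V by blast
  have V_D: "D x \<in> V" and V_R: "R x \<in> V" if "x \<in> V" for x
    using P(2)[of "D x"] P(2)[of "R x"] P(3)[OF that] A_comm[OF P(1)] R_comm[OF A_comm[OF P(1)], of x]
    by auto
  have R_pos: "0 \<le> Re (cinner (R x) x)" for x
  proof -
    have "Re (cinner (Y x) x) \<le> norm (Y x) * norm x"
      using complex_Re_le_cmod cinner_Cauchy_Schwarz order_trans by blast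
    also have "\<dots> \<le> norm x * norm x"
    proof (rule mult_right_mono)
      have "norm (Y x) \<le> norm Y * norm x" by (rule norm_blinfun)
      also have "\<dots> \<le> 1 * norm x" by (rule mult_right_mono) (auto simp: Y)
      finally show "norm (Y x) \<le> norm x" by simp
    qed simp
    finally show ?thesis
      by (simp add: R_def minus_blinfun.rep_eq cinner_diff_left cinner_self power2_eq_square)
  qed
  define W where "W = {x \<in> V. R x = D x}"
  have "W = {0} \<or> W = V"
  proof (rule irreducible)
    show "complex_vector.subspace W"
      using V_subspace
      by (auto simp: W_def complex_vector.subspace_def blinfun.add_right R_scaleC D_scaleC)
    have "x \<in> V \<longleftrightarrow> P x = x" for x using P(2,3) by metis
    then have "W = {x. P x = x} \<inter> {x. R x = D x}" unfolding W_def by blast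
    moreover have "closed {x. P x = x}" "closed {x. R x = D x}"
      by (intro closed_Collect_eq continuous_intros)+
    ultimately show "closed W" by (simp add: closed_Int)
    show "W \<subseteq> V" by (auto simp: W_def)
    show "A x \<in> W" if "A \<in> \<A>" "x \<in> W" for A x
    proof -
      have "R (A x) = A (R x)" by (rule R_comm[symmetric]) (rule A_comm[OF that(1)])
      then show ?thesis using that into_V A_comm[OF that(1), of x] by (simp add: W_def)
    qed
  qed
  then show ?thesis
  proof
    assume W: "W = {0}"
    have "D x = - R x" if "x \<in> V" for x
    proof -
      have "R (R x + D x) = D (R x + D x)"
        using R_comm[of D x] by (simp add: RR blinfun.add_right)
      then have "R x + D x \<in> W"
        using V_subspace V_D[OF that] V_R[OF that] by (simp add: W_def complex_vector.subspace_add)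
      then show ?thesis using W by (simp add: eq_neg_iff_add_eq_0 add.commute)
    qed
    then have "Re (cinner (B x) x) = - b * Re (cinner (R x) x)" if "x \<in> V" for x
      using that cinner_diff_left[of 0 "b *\<^sub>R R x" x] by (simp add: B_eq cinner_scaleR_left)
    then show ?thesis using R_pos b by (simp add: mult_nonneg_nonneg)
  next
    assume W: "W = V"
    then have "Re (cinner (B x) x) = b * Re (cinner (R x) x)" if "x \<in> V" for x
    proof -
      have "D x = R x" using that W unfolding W_def by force
      then show ?thesis by (simp add: B_eq cinner_scaleR_left)
    qed
    then show ?thesis using R_pos b by simp
  qed
qed

text \<open>The preceding lemma applies to every \<open>B - c\<close>.  If the Rayleigh quotient took two values on \<open>V\<close>, then \<open>B - c\<close>
  with \<open>c\<close> midway between them would take both signs.  A symmetric operator with constant Rayleigh quotient is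
  a scalar, by polarization.\<close>

theorem symmetric_operator_scalar:
  fixes B :: "'h \<Rightarrow>\<^sub>L 'h"
  assumes sym: "\<And>x y. cinner (B x) y = cinner x (B y)"
    and comm: "\<And>A. A \<in> \<A> \<Longrightarrow> A o\<^sub>L B = B o\<^sub>L A"
    and clinear: "\<And>a x. B (scaleC a x) = scaleC a (B x)"
  obtains c :: real where "\<And>x. x \<in> V \<Longrightarrow> B x = c *\<^sub>R x"
proof -
  obtain P where P: "P \<in> \<A>" "\<And>x. x \<in> V \<Longrightarrow> P x = x" using V_retract by blast
  have V_B: "B x \<in> V" if "x \<in> V" for x
    using arg_cong[OF comm[OF P(1)], of "\<lambda>F. blinfun_apply F x"] P(2)[OF that] into_V[OF P(1), of "B x"]
    by simp
  define f where "f x = Re (cinner (B x) x) / (norm x)\<^sup>2" for x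
  have f_eq: "f x = f y" if x: "x \<in> V" "x \<noteq> 0" and y: "y \<in> V" "y \<noteq> 0" for x y
  proof (rule ccontr)
    assume "f x \<noteq> f y"
    define c where "c = (f x + f y) / 2"
    define B' where "B' = B - c *\<^sub>R id_blinfun"
    have B': "blinfun_apply B' z = B z - c *\<^sub>R z" for z
      by (simp add: B'_def minus_blinfun.rep_eq scaleR_blinfun.rep_eq)
    have Re_B': "Re (cinner (B' z) z) = (f z - c) * (norm z)\<^sup>2" if "z \<noteq> 0" for z
      using that by (simp add: B' f_def cinner_diff_left cinner_scaleR_left cinner_self algebra_simps
          del: of_real_power)
    have "(\<forall>x\<in>V. 0 \<le> Re (cinner (B' x) x)) \<or> (\<forall>x\<in>V. Re (cinner (B' x) x) \<le> 0)"
    proof (rule symmetric_operator_semidefinite)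
      show "cinner (B' x) y = cinner x (B' y)" for x y
        by (simp add: B' cinner_diff_left cinner_diff_right cinner_scaleR_left cinner_scaleR_right sym)
      show "A o\<^sub>L B' = B' o\<^sub>L A" if "A \<in> \<A>" for A
        by (simp add: B'_def blinfun_compose_simps comm[OF that])
      show "B' (scaleC a x) = scaleC a (B' x)" for a x
        by (simp add: B' clinear complex_vector.scale_right_diff_distrib)
          (metis mult.commute scaleC_of_real scaleC_scaleC)
    qed
    then have "0 \<le> f x - c \<and> 0 \<le> f y - c \<or> f x - c \<le> 0 \<and> f y - c \<le> 0"
      using x y by (metis Re_B' zero_le_mult_iff mult_le_0_iff zero_less_norm_iff zero_less_power not_less)
    then show False using \<open>f x \<noteq> f y\<close> by (auto simp: c_def)
  qed
  obtain c where c: "\<And>x. x \<in> V \<Longrightarrow> x \<noteq> 0 \<Longrightarrow> f x = c" using f_eq by metis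
  have form: "Re (cinner (B x) x) = c * (norm x)\<^sup>2" if "x \<in> V" for x
    using c[OF that] by (cases "x = 0") (auto simp: f_def field_simps)
  have "B x = c *\<^sub>R x" if x: "x \<in> V" for x
  proof -
    define y where "y = B x - c *\<^sub>R x"
    have y: "y \<in> V"
      using V_subspace V_B x unfolding y_def
      by (intro complex_vector.subspace_diff subspace_real)
    have "Re (cinner (B (x + y)) (x + y)) = c * (norm (x + y))\<^sup>2"
      using V_subspace x y by (intro form complex_vector.subspace_add)
    moreover have "cinner (B y) x = cnj (cinner (B x) y)"
      by (metis sym cinner_commute)
    ultimately have "Re (cinner (B x) y) = c * Re (cinner x y)"
      using form[OF x] form[OF y]
      by (simp add: blinfun.add_right cinner_add_left cinner_add_right norm_add_squared algebra_simps)
    then have "Re (cinner y y) = 0"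
      unfolding y_def[of] cinner_diff_left[of "B x"] by (simp add: cinner_scaleR_left y_def[symmetric])
    then show ?thesis by (simp add: cinner_self y_def del: of_real_power)
  qed
  then show ?thesis by (rule that)
qed

end


section \<open>Unitary representations with commuting compressions\<close>

lemma orthogonal_projectionD:
  fixes P :: "'h::complex_hilbert_space \<Rightarrow> 'h"
  assumes V: "complex_vector.subspace V" and P: "orthogonal_projection_onto V P"
  shows "P x \<in> V" "x \<in> V \<Longrightarrow> P x = x" "cinner (P x) y = cinner x (P y)"
    "y \<in> V \<Longrightarrow> cinner (P x) y = cinner x y"
    "P (scaleC a x) = scaleC a (P x)" "bounded_linear P"
proof -
  have in_V: "P x \<in> V" and perp: "y \<in> V \<Longrightarrow> cinner (x - P x) y = 0" for x y
    using P by (auto simp: orthogonal_projection_onto_def)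
  note uniq = orthogonal_projection_unique[OF V P]
  show "P x \<in> V" by (rule in_V)
  show "P x = x" if "x \<in> V" using that by (intro uniq) auto
  show left: "cinner (P x) y = cinner x y" if "y \<in> V" for x y
    using perp[OF that, of x] by (simp add: cinner_diff_left)
  have right: "cinner y (P x) = cinner y x" if "y \<in> V" for x y
    using left[OF that, of x] by (metis cinner_commute)
  show "cinner (P x) y = cinner x (P y)"
    using left[OF in_V, of x y] right[OF in_V, of x y] by simp
  have add: "P (x + y) = P x + P y" for x y
  proof (rule uniq)
    show "cinner (x + y - (P x + P y)) z = 0" if "z \<in> V" for z
      using that by (simp add: cinner_diff_left cinner_add_left left)
  qed (intro complex_vector.subspace_add V in_V)
  show scale: "P (scaleC a x) = scaleC a (P x)" for a x
  proof (rule uniq)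
    show "cinner (scaleC a x - scaleC a (P x)) z = 0" if "z \<in> V" for z
      using that by (simp add: cinner_diff_left cinner_scaleC_left left)
  qed (intro complex_vector.subspace_scale V in_V)
  show "bounded_linear P"
  proof (rule bounded_linear_intro[where K = 1])
    show "P (x + y) = P x + P y" for x y by (rule add)
    show "P (r *\<^sub>R x) = r *\<^sub>R P x" for r x by (metis scale scaleC_of_real)
    show "norm (P x) \<le> norm x * 1" for x
    proof -
      have "cinner (x - P x) (P x) = 0" by (rule perp[OF in_V])
      then have "(norm x)\<^sup>2 = (norm (x - P x))\<^sup>2 + (norm (P x))\<^sup>2"
        using norm_add_squared[of "x - P x" "P x"] by simp
      then have "(norm (P x))\<^sup>2 \<le> (norm x)\<^sup>2" by simp
      then have "norm (P x) \<le> norm x" by (rule power2_le_imp_le) simp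
      then show ?thesis by simp
    qed
  qed
qed

lemma unitary_repD:
  assumes G: "group G" and \<rho>: "unitary_rep G T \<rho>"
  shows "g \<in> carrier G \<Longrightarrow> unitary_operator (\<rho> g)"
    "g \<in> carrier G \<Longrightarrow> h \<in> carrier G \<Longrightarrow> \<rho> (g \<otimes>\<^bsub>G\<^esub> h) x = \<rho> g (\<rho> h x)"
    "\<rho> \<one>\<^bsub>G\<^esub> x = x"
    "g \<in> carrier G \<Longrightarrow> \<rho> (inv\<^bsub>G\<^esub> g) (\<rho> g x) = x"
    "g \<in> carrier G \<Longrightarrow> \<rho> g (\<rho> (inv\<^bsub>G\<^esub> g) x) = x"
    "g \<in> carrier G \<Longrightarrow> cinner (\<rho> g x) y = cinner x (\<rho> (inv\<^bsub>G\<^esub> g) y)"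
    "g \<in> carrier G \<Longrightarrow> \<rho> (g [^]\<^bsub>G\<^esub> (n::nat)) x = (\<rho> g ^^ n) x"
proof -
  interpret group G by (rule G)
  show U: "unitary_operator (\<rho> g)" if "g \<in> carrier G" for g
    using \<rho> that by (simp add: unitary_rep_def)
  show mult: "\<rho> (g \<otimes>\<^bsub>G\<^esub> h) x = \<rho> g (\<rho> h x)" if "g \<in> carrier G" "h \<in> carrier G" for g h x
    using \<rho> that by (auto simp: unitary_rep_def)
  have "\<rho> \<one>\<^bsub>G\<^esub> (\<rho> \<one>\<^bsub>G\<^esub> x) = \<rho> \<one>\<^bsub>G\<^esub> x" for x
    using mult[of "\<one>\<^bsub>G\<^esub>" "\<one>\<^bsub>G\<^esub>" x] by simp
  then show one: "\<rho> \<one>\<^bsub>G\<^esub> x = x" for x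
    using unitary_operatorD(7)[OF U[OF one_closed]] by (simp add: inj_eq)
  show "\<rho> (inv\<^bsub>G\<^esub> g) (\<rho> g x) = x" if "g \<in> carrier G" for g x
    using mult[of "inv\<^bsub>G\<^esub> g" g x] that by (simp add: one)
  show inv: "\<rho> g (\<rho> (inv\<^bsub>G\<^esub> g) x) = x" if "g \<in> carrier G" for g x
    using mult[of g "inv\<^bsub>G\<^esub> g" x] that by (simp add: one)
  show "cinner (\<rho> g x) y = cinner x (\<rho> (inv\<^bsub>G\<^esub> g) y)" if "g \<in> carrier G"
    using unitary_operatorD(4)[OF U[OF that], of x "\<rho> (inv\<^bsub>G\<^esub> g) y"] inv[OF that] by simp
  show "\<rho> (g [^]\<^bsub>G\<^esub> (n::nat)) x = (\<rho> g ^^ n) x" if g: "g \<in> carrier G"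
    by (induction n arbitrary: x) (simp_all add: one mult g funpow_swap1)
qed

lemma subspace_invariant_vectors:
  assumes "group G" "unitary_rep G T \<rho>" "K \<subseteq> carrier G"
  shows "complex_vector.subspace (invariant_vectors \<rho> K)"
proof -
  have "\<rho> k (x + y) = \<rho> k x + \<rho> k y" "\<rho> k (scaleC a x) = scaleC a (\<rho> k x)" "\<rho> k 0 = 0"
    if "k \<in> K" for k x y a
  proof -
    have U: "unitary_operator (\<rho> k)"
      by (rule unitary_repD(1)[OF assms(1,2)]) (use that assms(3) in blast)
    show "\<rho> k (x + y) = \<rho> k x + \<rho> k y" "\<rho> k (scaleC a x) = scaleC a (\<rho> k x)"
      by (rule unitary_operatorD[OF U])+
    show "\<rho> k 0 = 0" using unitary_operatorD(2)[OF U, of 0 0] by simp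
  qed
  then show ?thesis by (simp add: complex_vector.subspace_def invariant_vectors_def)
qed

lemma invariant_subspace_top:
  assumes "irreducible_unitary_rep G T \<rho>" and S: "complex_vector.subspace S" "closed S"
    and inv: "\<And>g x. g \<in> carrier G \<Longrightarrow> x \<in> S \<Longrightarrow> \<rho> g x \<in> S" and "x \<in> S" "x \<noteq> 0"
  shows "S = UNIV"
proof -
  have "S = {0} \<or> S = UNIV"
    using assms(1) S inv unfolding irreducible_unitary_rep_def by blast
  then show ?thesis using assms(5,6) by auto
qed

text \<open>The compressions \<open>P \<rho>(g) P\<close> act irreducibly on the range \<open>V\<close> of \<open>P\<close>.  If they commute, the
  symmetric operators \<open>P (\<rho>(g) + \<rho>(g\<^sup>-\<^sup>1)) P\<close> and \<open>i P (\<rho>(g) - \<rho>(g\<^sup>-\<^sup>1)) P\<close> are scalars on \<open>V\<close>, hence so are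
  the compressions, and an irreducible family of scalars lives on a space of dimension at most one.\<close>

theorem commuting_compressions_dim_le_1:
  fixes \<rho> :: "'g \<Rightarrow> 'h::complex_hilbert_space \<Rightarrow> 'h"
  assumes G: "group G" and irr: "irreducible_unitary_rep G T \<rho>"
    and V: "complex_vector.subspace V" and P: "orthogonal_projection_onto V P"
    and comm: "\<And>g h v. g \<in> carrier G \<Longrightarrow> h \<in> carrier G \<Longrightarrow> v \<in> V \<Longrightarrow>
      P (\<rho> g (P (\<rho> h v))) = P (\<rho> h (P (\<rho> g v)))"
  shows "\<exists>B. complex_vector.independent B \<and> complex_vector.span B = V \<and> finite B \<and> card B \<le> 1"
proof -
  interpret group G by (rule G)
  have \<rho>: "unitary_rep G T \<rho>" using irr by (simp add: irreducible_unitary_rep_def)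
  note R = unitary_repD[OF G \<rho>] and PD = orthogonal_projectionD[OF V P]
  note U = unitary_operatorD[OF R(1)]
  define A where "A g = Blinfun (\<lambda>x. P (\<rho> g (P x)))" for g
  have A: "blinfun_apply (A g) x = P (\<rho> g (P x))" if "g \<in> carrier G" for g x
    unfolding A_def
    by (subst bounded_linear_Blinfun_apply)
       (intro bounded_linear_compose[OF PD(6)] bounded_linear_compose[OF U(8)] PD(6) that, simp)
  have A_V: "blinfun_apply (A g) x = P (\<rho> g x)" if "g \<in> carrier G" "x \<in> V" for g x
    using that by (simp add: A PD(2))
  have A_adj: "cinner (A g x) y = cinner x (A (inv\<^bsub>G\<^esub> g) y)" if "g \<in> carrier G" for g x y
    using that by (simp add: A PD(3) R(6))
  have A_scaleC: "A g (scaleC a x) = scaleC a (A g x)" if "g \<in> carrier G" for g a x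
    using that by (simp add: A PD(5) U(3))
  have A_comm: "A g o\<^sub>L A h = A h o\<^sub>L A g" if "g \<in> carrier G" "h \<in> carrier G" for g h
    by (rule blinfun_eqI) (simp add: A that PD(1,2) comm)
  interpret irreducible_operators V "A ` carrier G"
  proof
    show "complex_vector.subspace V" by (rule V)
    show "F x \<in> V" if "F \<in> A ` carrier G" for F x using that by (auto simp: A PD(1))
    show "\<exists>F\<in>A ` carrier G. \<forall>x\<in>V. blinfun_apply F x = x"
      by (intro bexI[of _ "A \<one>\<^bsub>G\<^esub>"]) (auto simp: A_V R(3) PD(2))
    fix W assume W: "complex_vector.subspace W" "closed W" "W \<subseteq> V"
      and inv: "\<And>F x. F \<in> A ` carrier G \<Longrightarrow> x \<in> W \<Longrightarrow> blinfun_apply F x \<in> W"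
    show "W = {0} \<or> W = V"
    proof (cases "W = {0}")
      case False
      then obtain w where w: "w \<in> W" "w \<noteq> 0"
        using complex_vector.subspace_0[OF W(1)] by blast
      define S where "S = {x. \<forall>g\<in>carrier G. P (\<rho> g x) \<in> W}"
      have "S = UNIV"
      proof (rule invariant_subspace_top[OF irr])
        show "complex_vector.subspace S"
          using W(1) linear_0[OF bounded_linear.linear[OF PD(6)]] linear_0[OF bounded_linear.linear[OF U(8)]]
          by (auto simp: S_def complex_vector.subspace_def U(1,3) PD(5) linear_add[OF bounded_linear.linear[OF PD(6)]])
        have "S = (\<Inter>g\<in>carrier G. (\<lambda>x. P (\<rho> g x)) -` W)" by (auto simp: S_def)
        moreover have "closed ((\<lambda>x. P (\<rho> g x)) -` W)" if "g \<in> carrier G" for g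
          by (intro continuous_closed_vimage W(2) bounded_linear.continuous_on
              linear_continuous_at bounded_linear_compose[OF PD(6)] U(8) that)
        ultimately show "closed S" by (simp add: closed_INT)
        show "\<rho> g x \<in> S" if "g \<in> carrier G" "x \<in> S" for g x
          using that by (auto simp: S_def R(2)[symmetric])
        have "P (\<rho> g w) \<in> W" if "g \<in> carrier G" for g
          using inv[of "A g" w] A_V[OF that, of w] that w(1) W(3) by auto
        then show "w \<in> S" by (simp add: S_def)
      qed (rule w(2))
      then have "P (\<rho> \<one>\<^bsub>G\<^esub> x) \<in> W" for x by (auto simp: S_def)
      then have "V \<subseteq> W" by (metis R(3) PD(2) subsetI)
      then show ?thesis using W(3) by blast
    qed simp
  qed
  have scalar: "\<exists>z. \<forall>x\<in>V. A g x = scaleC z x" if g: "g \<in> carrier G" for g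
  proof -
    define g' where "g' = inv\<^bsub>G\<^esub> g"
    have g': "g' \<in> carrier G" "inv\<^bsub>G\<^esub> g' = g" using g by (simp_all add: g'_def)
    define J where "J = Blinfun (scaleC \<i> :: 'h \<Rightarrow> 'h)"
    have J: "blinfun_apply J x = scaleC \<i> x" for x
      by (simp add: J_def bounded_linear_Blinfun_apply[OF bounded_linear_scaleC])
    obtain c where c: "\<And>x. x \<in> V \<Longrightarrow> (A g + A g') x = c *\<^sub>R x"
    proof (rule symmetric_operator_scalar)
      show "cinner ((A g + A g') x) y = cinner x ((A g + A g') y)" for x y
        using A_adj[OF g, of x y] A_adj[OF g'(1), of x y]
        by (simp add: plus_blinfun.rep_eq cinner_add_left cinner_add_right g'(2) g'_def[symmetric])
      show "F o\<^sub>L (A g + A g') = (A g + A g') o\<^sub>L F" if "F \<in> A ` carrier G" for F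
        using that g g' by (auto simp: blinfun_compose_simps A_comm)
      show "(A g + A g') (scaleC a x) = scaleC a ((A g + A g') x)" for a x
        by (simp add: plus_blinfun.rep_eq A_scaleC g g' scaleC_add_right)
    qed (rule that)
    obtain d where d: "\<And>x. x \<in> V \<Longrightarrow> (J o\<^sub>L (A g - A g')) x = d *\<^sub>R x"
    proof (rule symmetric_operator_scalar)
      show "cinner ((J o\<^sub>L (A g - A g')) x) y = cinner x ((J o\<^sub>L (A g - A g')) y)" for x y
        using A_adj[OF g, of x y] A_adj[OF g'(1), of x y]
        by (simp add: minus_blinfun.rep_eq cinner_diff_left cinner_diff_right J cinner_scaleC_left
            cinner_scaleC_right g'(2) g'_def[symmetric] algebra_simps)
      show "F o\<^sub>L (J o\<^sub>L (A g - A g')) = (J o\<^sub>L (A g - A g')) o\<^sub>L F" if F: "F \<in> A ` carrier G" for F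
      proof -
        have "F o\<^sub>L J = J o\<^sub>L F" using F by (auto intro!: blinfun_eqI simp: J A_scaleC)
        moreover have "F o\<^sub>L (A g - A g') = (A g - A g') o\<^sub>L F"
          using F g g' by (auto simp: blinfun_compose_simps A_comm)
        ultimately show ?thesis by (metis blinfun_compose_assoc)
      qed
      show "(J o\<^sub>L (A g - A g')) (scaleC a x) = scaleC a ((J o\<^sub>L (A g - A g')) x)" for a x
        by (simp add: minus_blinfun.rep_eq A_scaleC g g' J complex_vector.scale_right_diff_distrib[symmetric]
            scaleC_scaleC mult.commute)
    qed (rule that)
    have "A g x = scaleC ((complex_of_real c - \<i> * complex_of_real d) / 2) x" if x: "x \<in> V" for x
    proof -
      have 1: "A g x + A g' x = scaleC (complex_of_real c) x"
        using c[OF x] by (simp add: plus_blinfun.rep_eq scaleC_of_real)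
      have "scaleC \<i> (A g x - A g' x) = scaleC (complex_of_real d) x"
        using d[OF x] by (simp add: minus_blinfun.rep_eq scaleC_of_real J)
      then have "scaleC (- \<i>) (scaleC \<i> (A g x - A g' x)) = scaleC (- \<i> * complex_of_real d) x"
        by (simp add: scaleC_scaleC)
      then have 2: "A g x - A g' x = scaleC (- \<i> * complex_of_real d) x"
        by (simp add: scaleC_scaleC scaleC_one)
      have "scaleC 2 (A g x) = (A g x + A g' x) + (A g x - A g' x)"
        using scaleC_add_left[of 1 1 "A g x"] by (simp add: scaleC_one)
      also have "\<dots> = scaleC (complex_of_real c - \<i> * complex_of_real d) x"
        unfolding 1 2 by (simp only: scaleC_add_left[symmetric]) simp
      finally have "scaleC (1/2) (scaleC 2 (A g x))
          = scaleC (1/2) (scaleC (complex_of_real c - \<i> * complex_of_real d) x)" by simp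
      then show ?thesis by (simp add: scaleC_scaleC scaleC_one)
    qed
    then show ?thesis by blast
  qed
  show ?thesis
  proof (cases "V = {0}")
    case True
    then show ?thesis
      by (intro exI[of _ "{}"]) (simp add: complex_vector.independent_empty)
  next
    case False
    then obtain v where v: "v \<in> V" "v \<noteq> 0" using complex_vector.subspace_0[OF V] by blast
    have "w \<in> complex_vector.span {v}" if w: "w \<in> V" for w
    proof -
      define c where "c = cinner w v / cinner v v"
      define w' where "w' = w - scaleC c v"
      have w': "w' \<in> V"
        unfolding w'_def using V v w by (intro complex_vector.subspace_diff complex_vector.subspace_scale)
      have "cinner w' v = 0"
        using v(2) by (simp add: w'_def c_def cinner_diff_left cinner_scaleC_left cinner_eq_zero_iff)
      then have vw': "cinner v w' = 0" by (metis cinner_commute complex_cnj_zero)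
      define S where "S = {x. \<forall>g\<in>carrier G. cinner (\<rho> g x) w' = 0}"
      have "S = UNIV"
      proof (rule invariant_subspace_top[OF irr])
        show "complex_vector.subspace S"
          using linear_0[OF bounded_linear.linear[OF U(8)]]
          by (auto simp: S_def complex_vector.subspace_def U(1,3) cinner_add_left cinner_scaleC_left)
        have "S = (\<Inter>g\<in>carrier G. {x. cinner (\<rho> g x) w' = 0})" by (auto simp: S_def)
        moreover have "closed {x. cinner (\<rho> g x) w' = 0}" if "g \<in> carrier G" for g
          by (intro closed_Collect_eq continuous_on_cinner continuous_on_const
              linear_continuous_on U(8) that)
        ultimately show "closed S" by (simp add: closed_INT)
        show "\<rho> g x \<in> S" if "g \<in> carrier G" "x \<in> S" for g x
          using that by (auto simp: S_def R(2)[symmetric])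
        show "v \<in> S"
        proof -
          have "cinner (\<rho> g v) w' = 0" if g: "g \<in> carrier G" for g
          proof -
            obtain z where "A g v = scaleC z v" using scalar[OF g] v(1) by blast
            then have "cinner (P (\<rho> g v)) w' = 0"
              using A_V[OF g v(1)] vw' by (simp add: cinner_scaleC_left)
            then show ?thesis by (simp add: PD(4)[OF w'])
          qed
          then show ?thesis by (simp add: S_def)
        qed
      qed (rule v(2))
      then have "cinner (\<rho> \<one>\<^bsub>G\<^esub> w') w' = 0" by (auto simp: S_def)
      then have "w = scaleC c v" by (simp add: R(3) cinner_eq_zero_iff w'_def)
      then show ?thesis
        by (simp add: complex_vector.span_base complex_vector.span_scale)
    qed
    moreover have "complex_vector.span {v} \<subseteq> V"
      using v V by (intro complex_vector.span_minimal) auto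
    ultimately show ?thesis
      using v(2) by (intro exI[of _ "{v}"]) auto
  qed
qed

lemma limitin_orbit:
  assumes "unitary_rep G T \<rho>" "limitin T f g F"
  shows "((\<lambda>n. \<rho> (f n) v) \<longlongrightarrow> \<rho> g v) F"
proof -
  have "continuous_map T euclidean (\<lambda>g. \<rho> g v)" using assms(1) by (simp add: unitary_rep_def)
  then have "limitin euclidean ((\<lambda>g. \<rho> g v) \<circ> f) (\<rho> g v) F"
    by (rule continuous_map_limit[OF _ assms(2)])
  then show ?thesis by (simp add: o_def)
qed

text \<open>If \<open>v\<close> is fixed by \<open>a\<close>, then \<open>\<rho>(u)v - v\<close> and \<open>\<rho>(a\<^sup>-\<^sup>n u a\<^sup>n)v - v\<close> have the same norm for every \<open>n\<close>.\<close>

theorem Mautner_phenomenon: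
  fixes \<rho> :: "'g \<Rightarrow> 'h::complex_hilbert_space \<Rightarrow> 'h"
  assumes G: "group G" and \<rho>: "unitary_rep G T \<rho>"
    and a: "a \<in> carrier G" and v: "\<rho> a v = v" and u: "u \<in> carrier G"
    and lim: "limitin T (\<lambda>n::nat. inv\<^bsub>G\<^esub> (a [^]\<^bsub>G\<^esub> n) \<otimes>\<^bsub>G\<^esub> u \<otimes>\<^bsub>G\<^esub> a [^]\<^bsub>G\<^esub> n) \<one>\<^bsub>G\<^esub> sequentially"
  shows "\<rho> u v = v"
proof -
  interpret group G by (rule G)
  note R = unitary_repD[OF G \<rho>]
  have an: "\<rho> (a [^]\<^bsub>G\<^esub> n) v = v" for n :: nat
    unfolding R(7)[OF a] by (induction n) (simp_all add: v)
  have "norm (\<rho> (inv\<^bsub>G\<^esub> (a [^]\<^bsub>G\<^esub> n) \<otimes>\<^bsub>G\<^esub> u \<otimes>\<^bsub>G\<^esub> a [^]\<^bsub>G\<^esub> n) v - v) = norm (\<rho> u v - v)" for n :: nat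
  proof -
    let ?b = "a [^]\<^bsub>G\<^esub> n"
    have b: "?b \<in> carrier G" using a by simp
    note U = unitary_operatorD[OF R(1)[OF inv_closed[OF b]]]
    have "v = \<rho> (inv\<^bsub>G\<^esub> ?b) v" using R(4)[OF b, of v] an by simp
    then have "\<rho> (inv\<^bsub>G\<^esub> ?b \<otimes>\<^bsub>G\<^esub> u \<otimes>\<^bsub>G\<^esub> ?b) v - v = \<rho> (inv\<^bsub>G\<^esub> ?b) (\<rho> u v - v)"
      using a u an by (simp add: R(2) U(2))
    then show ?thesis by (simp add: U(5))
  qed
  moreover have "(\<lambda>n. norm (\<rho> (inv\<^bsub>G\<^esub> (a [^]\<^bsub>G\<^esub> n) \<otimes>\<^bsub>G\<^esub> u \<otimes>\<^bsub>G\<^esub> a [^]\<^bsub>G\<^esub> n) v - v)) \<longlonglongrightarrow> norm (\<rho> \<one>\<^bsub>G\<^esub> v - v)"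
    by (intro tendsto_intros limitin_orbit[OF \<rho> lim])
  ultimately have "norm (\<rho> u v - v) = 0" by (simp add: LIMSEQ_const_iff R(3))
  then show ?thesis by simp
qed

text \<open>The limit of the means does not see finitely many terms, so an equation that holds for all large powers
  of \<open>U\<close> and \<open>W\<close> survives when the powers are replaced by the projection onto their common fixed space.\<close>

lemma mean_ergodic_eq:
  fixes U W :: "'h::complex_hilbert_space \<Rightarrow> 'h" and L M :: "'h \<Rightarrow> 'b::real_normed_vector"
  assumes U: "unitary_operator U" "orthogonal_projection_onto {x. U x = x} P"
    and W: "unitary_operator W" "orthogonal_projection_onto {x. W x = x} P"
    and L: "bounded_linear L" and M: "bounded_linear M"
    and eq: "\<And>n. n \<ge> N0 \<Longrightarrow> L ((U ^^ n) x) = M ((W ^^ n) y)"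
  shows "L (P x) = M (P y)"
proof -
  define D where "D n = L ((U ^^ n) x) - M ((W ^^ n) y)" for n
  have "(\<lambda>N. (1 / real N) *\<^sub>R (\<Sum>n<N. D n)) \<longlonglongrightarrow> L (P x) - M (P y)"
  proof -
    have "(1 / real N) *\<^sub>R (\<Sum>n<N. D n) = L ((1 / real N) *\<^sub>R (\<Sum>n<N. (U ^^ n) x))
        - M ((1 / real N) *\<^sub>R (\<Sum>n<N. (W ^^ n) y))" for N
      by (simp add: D_def linear_scale[OF bounded_linear.linear[OF L]] linear_scale[OF bounded_linear.linear[OF M]]
          linear_sum[OF bounded_linear.linear[OF L]] linear_sum[OF bounded_linear.linear[OF M]]
          scaleR_diff_right sum_subtractf)
    then show ?thesis
      by (simp only:) (intro tendsto_diff bounded_linear.tendsto[OF L] bounded_linear.tendsto[OF M]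
          mean_ergodic U W)
  qed
  moreover have "(\<lambda>N. (1 / real N) *\<^sub>R (\<Sum>n<N. D n)) \<longlonglongrightarrow> 0"
  proof -
    have tail: "(\<Sum>n<N. D n) = (\<Sum>n<N0. D n)" if "N \<ge> N0" for N
      using that by (intro sum.mono_neutral_right) (auto simp: D_def eq)
    have "\<forall>\<^sub>F N in sequentially. (1 / real N) *\<^sub>R (\<Sum>n<N0. D n) = (1 / real N) *\<^sub>R (\<Sum>n<N. D n)"
      by (rule eventually_sequentiallyI[of N0], subst tail) simp_all
    moreover have "(\<lambda>N. (1 / real N) *\<^sub>R (\<Sum>n<N0. D n)) \<longlonglongrightarrow> 0 *\<^sub>R (\<Sum>n<N0. D n)"
      by (intro tendsto_scaleR tendsto_const lim_1_over_n)
    ultimately show ?thesis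
      by (simp only: scaleR_zero_left) (rule Lim_transform_eventually)
  qed
  ultimately have "L (P x) - M (P y) = 0" by (rule LIMSEQ_unique)
  then show ?thesis by simp
qed

section \<open>Three times differentiable functions and their jets\<close>

abbreviation D2 :: "(real \<Rightarrow> real) \<Rightarrow> real \<Rightarrow> real" where "D2 f \<equiv> deriv (deriv f)"
abbreviation D3 :: "(real \<Rightarrow> real) \<Rightarrow> real \<Rightarrow> real" where "D3 f \<equiv> deriv (deriv (deriv f))"

definition C3_jet :: "(real \<Rightarrow> real) \<Rightarrow> (real \<Rightarrow> real) \<Rightarrow> (real \<Rightarrow> real) \<Rightarrow> (real \<Rightarrow> real) \<Rightarrow> bool"
  where "C3_jet f f1 f2 f3 \<longleftrightarrow>
    (\<forall>x. (f has_real_derivative f1 x) (at x)) \<and> (\<forall>x. (f1 has_real_derivative f2 x) (at x)) \<and>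
    (\<forall>x. (f2 has_real_derivative f3 x) (at x)) \<and> continuous_on UNIV f3"

lemma C3_jetD:
  assumes "C3_jet f f1 f2 f3"
  shows "(f has_real_derivative f1 x) (at x)" "(f1 has_real_derivative f2 x) (at x)"
    "(f2 has_real_derivative f3 x) (at x)" "continuous_on UNIV f3"
    "deriv f = f1" "deriv f1 = f2" "deriv f2 = f3"
    "continuous_on UNIV f" "continuous_on UNIV f1" "continuous_on UNIV f2"
  using assms unfolding C3_jet_def
  by (auto intro!: ext DERIV_imp_deriv DERIV_continuous_on intro: has_field_derivative_at_within)

lemma less3_cases: "(\<forall>k<3. P k) \<longleftrightarrow> P 0 \<and> P 1 \<and> P (2::nat)"
  by (auto simp: less_Suc_eq eval_nat_numeral)

lemma le3_cases: "(\<forall>k\<le>3. P k) \<longleftrightarrow> P 0 \<and> P 1 \<and> P 2 \<and> P (3::nat)"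
  by (auto simp: le_Suc_eq eval_nat_numeral)

lemma deriv_iterates: "(deriv ^^ 2) f = D2 f" "(deriv ^^ 3) f = D3 f"
  by (simp_all add: eval_nat_numeral)

lemma C3_function_jet: "C3_function f \<Longrightarrow> C3_jet f (deriv f) (D2 f) (D3 f)"
  unfolding C3_function_def C3_jet_def less3_cases
  by (auto simp: deriv_iterates field_differentiable_derivI)

lemma C3_jet_function: "C3_jet f f1 f2 f3 \<Longrightarrow> C3_function f"
  unfolding C3_function_def less3_cases
  by (auto simp: deriv_iterates C3_jetD(5-7) C3_jetD(4) field_differentiable_def intro: C3_jetD(1-3))

lemma C3_jet_compose:
  assumes f: "C3_jet f f1 f2 f3" and g: "C3_jet g g1 g2 g3"
  shows "C3_jet (\<lambda>x. f (g x)) (\<lambda>x. f1 (g x) * g1 x)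
    (\<lambda>x. f2 (g x) * (g1 x)\<^sup>2 + f1 (g x) * g2 x)
    (\<lambda>x. f3 (g x) * g1 x ^ 3 + 3 * f2 (g x) * g1 x * g2 x + f1 (g x) * g3 x)"
proof -
  note [derivative_intros] = DERIV_chain2[OF C3_jetD(1)[OF f]] DERIV_chain2[OF C3_jetD(2)[OF f]]
    DERIV_chain2[OF C3_jetD(3)[OF f]] C3_jetD(1-3)[OF g]
  note [continuous_intros] = continuous_on_compose2[OF C3_jetD(4)[OF f] _ subset_UNIV]
     continuous_on_compose2[OF C3_jetD(8)[OF f] _ subset_UNIV] continuous_on_compose2[OF C3_jetD(9)[OF f] _ subset_UNIV]
     continuous_on_compose2[OF C3_jetD(10)[OF f] _ subset_UNIV] C3_jetD(4,8-10)[OF g]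
  show ?thesis
    unfolding C3_jet_def
    by (intro conjI allI continuous_intros)
       (auto intro!: derivative_eq_intros simp: power2_eq_square power3_eq_cube algebra_simps)
qed

lemma C3_jet_mult:
  assumes f: "C3_jet f f1 f2 f3" and g: "C3_jet g g1 g2 g3"
  shows "C3_jet (\<lambda>x. f x * g x) (\<lambda>x. f1 x * g x + f x * g1 x)
    (\<lambda>x. f2 x * g x + 2 * f1 x * g1 x + f x * g2 x)
    (\<lambda>x. f3 x * g x + 3 * f2 x * g1 x + 3 * f1 x * g2 x + f x * g3 x)"
proof -
  note [derivative_intros] = C3_jetD(1-3)[OF f] C3_jetD(1-3)[OF g]
  note [continuous_intros] = C3_jetD(4,8-10)[OF f] C3_jetD(4,8-10)[OF g]
  show ?thesis
    unfolding C3_jet_def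
    by (intro conjI allI continuous_intros)
       (auto intro!: derivative_eq_intros simp: algebra_simps)
qed

lemma C3_jet_add:
  assumes f: "C3_jet f f1 f2 f3" and g: "C3_jet g g1 g2 g3"
  shows "C3_jet (\<lambda>x. f x + g x) (\<lambda>x. f1 x + g1 x) (\<lambda>x. f2 x + g2 x) (\<lambda>x. f3 x + g3 x)"
  using assms unfolding C3_jet_def by (auto intro!: derivative_intros continuous_intros)

lemma C3_jet_translation: "C3_jet (\<lambda>x. x + c) (\<lambda>_. 1) (\<lambda>_. 0) (\<lambda>_. 0)"
  unfolding C3_jet_def by (auto intro!: derivative_eq_intros)

lemma C3_jet_inverse:
  assumes q: "C3_jet q q1 q2 q3" and pos: "\<And>x. q1 x > 0"
    and left: "\<And>x. r (q x) = x" and right: "\<And>y. q (r y) = y"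
  shows "C3_jet r (\<lambda>y. 1 / q1 (r y)) (\<lambda>y. - q2 (r y) / q1 (r y) ^ 3)
    (\<lambda>y. (3 * (q2 (r y))\<^sup>2 - q1 (r y) * q3 (r y)) / q1 (r y) ^ 5)"
proof -
  have cont_q: "isCont q z" for z
    using C3_jetD(1)[OF q] DERIV_isCont by blast
  have cont_r: "isCont r y" for y
    using isCont_inverse_function[of 1 "r y" r q] left cont_q right by simp
  have r: "(r has_real_derivative 1 / q1 (r y)) (at y)" for y
    using DERIV_inverse_function[OF C3_jetD(1)[OF q], of r y "y - 1" "y + 1"] right cont_r pos[of "r y"]
    by (simp add: divide_inverse)
  have ne: "q1 x \<noteq> 0" for x using pos[of x] by simp
  note [derivative_intros] = DERIV_chain2[OF C3_jetD(1)[OF q]] DERIV_chain2[OF C3_jetD(2)[OF q]]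
    DERIV_chain2[OF C3_jetD(3)[OF q]] r
  have cont: "continuous_on UNIV r" using cont_r continuous_at_imp_continuous_on by blast
  note [continuous_intros] = continuous_on_compose2[OF C3_jetD(4)[OF q] cont subset_UNIV]
     continuous_on_compose2[OF C3_jetD(9)[OF q] cont subset_UNIV]
     continuous_on_compose2[OF C3_jetD(10)[OF q] cont subset_UNIV]
  have 2: "((\<lambda>y. 1 / q1 (r y)) has_real_derivative - q2 (r y) / q1 (r y) ^ 3) (at y)" for y
    by (auto intro!: derivative_eq_intros simp: ne power3_eq_cube)
  have 3: "((\<lambda>y. - q2 (r y) / q1 (r y) ^ 3) has_real_derivative
      (3 * (q2 (r y))\<^sup>2 - q1 (r y) * q3 (r y)) / q1 (r y) ^ 5) (at y)" for y
    by (rule derivative_eq_intros refl | (simp add: ne; fail))+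
       (use ne[of "r y"] in \<open>simp add: divide_simps power2_eq_square, simp add: algebra_simps eval_nat_numeral\<close>)
  show ?thesis
    unfolding C3_jet_def
    by (intro conjI allI r 2 3 continuous_intros) (simp_all add: ne)
qed

section \<open>Continuous periodic functions\<close>

definition periodic :: "(real \<Rightarrow> real) \<Rightarrow> bool" where "periodic f \<longleftrightarrow> (\<forall>x. f (x + 2 * pi) = f x)"

lemma quasiperiodic_shift_int:
  assumes "\<And>x. f (x + 2 * pi) = f x + (c :: real)"
  shows "f (x + 2 * pi * of_int k) = f x + c * of_int k"
proof (induction k rule: int_induct[where k = 0])
  case (step1 i)
  then show ?case using assms[of "x + 2 * pi * of_int i"] by (simp add: algebra_simps)
next
  case (step2 i)
  then show ?case using assms[of "x + 2 * pi * of_int (i - 1)"] by (simp add: algebra_simps)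
qed simp

lemma periodic_shift_int: "periodic f \<Longrightarrow> f (x + 2 * pi * of_int k) = f x"
  using quasiperiodic_shift_int[of f 0 x k] by (simp add: periodic_def)

lemma real_mod_period:
  obtains k :: int where "a \<le> x + 2 * pi * of_int k" "x + 2 * pi * of_int k < a + 2 * pi"
proof
  let ?k = "- \<lfloor>(x - a) / (2 * pi)\<rfloor>"
  define z where "z = (x - a) / (2 * pi)"
  have x: "x - a = 2 * pi * z" by (simp add: z_def)
  have "2 * pi * of_int \<lfloor>z\<rfloor> \<le> 2 * pi * z" "2 * pi * z < 2 * pi * (of_int \<lfloor>z\<rfloor> + 1)"
    by (simp_all add: floor_correct)
  then have "2 * pi * of_int \<lfloor>(x - a) / (2 * pi)\<rfloor> \<le> x - a"
    "x - a < 2 * pi * of_int \<lfloor>(x - a) / (2 * pi)\<rfloor> + 2 * pi"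
    unfolding x z_def[symmetric] by (simp_all add: distrib_left)
  then show "a \<le> x + 2 * pi * of_int ?k" "x + 2 * pi * of_int ?k < a + 2 * pi"
    by simp_all
qed

lemma periodic_bounded:
  assumes f: "continuous_on UNIV f" "periodic f" shows "bounded (range f)"
proof -
  have "range f \<subseteq> f ` {0..2 * pi}"
  proof
    fix y assume "y \<in> range f"
    then obtain x where x: "y = f x" by blast
    obtain k where "0 \<le> x + 2 * pi * of_int k" "x + 2 * pi * of_int k < 0 + 2 * pi"
      by (rule real_mod_period)
    then have "f (x + 2 * pi * of_int k) \<in> f ` {0..2 * pi}" by auto
    then show "y \<in> f ` {0..2 * pi}" by (simp add: x periodic_shift_int[OF f(2)])
  qed
  moreover have "bounded (f ` {0..2 * pi})"
    by (intro compact_imp_bounded compact_continuous_image continuous_on_subset[OF f(1)]) auto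
  ultimately show ?thesis by (rule bounded_subset[rotated])
qed

lemma periodic_uniformly_continuous:
  assumes f: "continuous_on UNIV f" "periodic f" shows "uniformly_continuous_on UNIV f"
  unfolding uniformly_continuous_on_def
proof (intro allI impI)
  fix e :: real assume "e > 0"
  have "uniformly_continuous_on {-1..2 * pi + 1} f"
    by (intro compact_uniformly_continuous continuous_on_subset[OF f(1)]) auto
  then obtain d where d: "d > 0"
    "\<And>x y. x \<in> {-1..2 * pi + 1} \<Longrightarrow> y \<in> {-1..2 * pi + 1} \<Longrightarrow> dist y x < d \<Longrightarrow> dist (f y) (f x) < e"
    unfolding uniformly_continuous_on_def using \<open>e > 0\<close> by metis
  have "dist (f y) (f x) < e" if xy: "dist y x < min d 1" for x y
  proof -
    obtain k where k: "0 \<le> x + 2 * pi * of_int k" "x + 2 * pi * of_int k < 0 + 2 * pi"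
      by (rule real_mod_period)
    have "dist (f (y + 2 * pi * of_int k)) (f (x + 2 * pi * of_int k)) < e"
      using k xy by (intro d(2)) (auto simp: dist_real_def)
    then show ?thesis by (simp add: periodic_shift_int[OF f(2)])
  qed
  then show "\<exists>d>0. \<forall>x\<in>UNIV. \<forall>y\<in>UNIV. dist y x < d \<longrightarrow> dist (f y) (f x) < e"
    using d(1) by (intro exI[of _ "min d 1"]) auto
qed

lemma periodic_bounded_below:
  assumes f: "continuous_on UNIV f" "periodic f" and pos: "\<And>x. f x > 0"
  obtains b where "b > 0" "\<And>x. b \<le> f x"
proof -
  obtain z where z: "z \<in> {0..2 * pi}" "\<And>x. x \<in> {0..2 * pi} \<Longrightarrow> f z \<le> f x"
    using continuous_attains_inf[of "{0..2 * pi}" f] continuous_on_subset[OF f(1)] by auto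
  have "f z \<le> f x" for x
  proof -
    obtain k where "0 \<le> x + 2 * pi * of_int k" "x + 2 * pi * of_int k < 0 + 2 * pi"
      by (rule real_mod_period)
    then show ?thesis using z(2)[of "x + 2 * pi * of_int k"] by (simp add: periodic_shift_int[OF f(2)])
  qed
  then show ?thesis using that pos by blast
qed

lemma periodic_deriv:
  assumes "\<And>x. (f has_real_derivative f' x) (at x)" "\<And>x. f (x + 2 * pi) = f x + c"
  shows "periodic f'"
  unfolding periodic_def
proof
  fix x
  have "((\<lambda>x. f (x + 2 * pi)) has_real_derivative f' (x + 2 * pi)) (at x)"
    using DERIV_shift assms(1) by blast
  moreover have "((\<lambda>x. f (x + 2 * pi)) has_real_derivative f' x) (at x)"
    unfolding assms(2) by (auto intro!: derivative_eq_intros assms(1))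
  ultimately show "f' (x + 2 * pi) = f' x" by (rule DERIV_unique)
qed

section \<open>The covering group of the circle diffeomorphisms\<close>

lemma Diff3_coverD:
  assumes q: "q \<in> Diff3_cover"
  shows "C3_jet q (deriv q) (D2 q) (D3 q)" "deriv q x > 0"
    "q (x + 2 * pi) = q x + 2 * pi" "strict_mono q" "bij q"
    "periodic (deriv q)" "periodic (D2 q)" "periodic (D3 q)" "inj q" "surj q"
proof -
  show jet: "C3_jet q (deriv q) (D2 q) (D3 q)" using q by (simp add: Diff3_cover_def C3_function_jet)
  show shift: "q (x + 2 * pi) = q x + 2 * pi" for x using q by (simp add: Diff3_cover_def)
  show mono: "strict_mono q" and bij: "bij q" using q by (simp_all add: Diff3_cover_def)
  show "inj q" "surj q" using bij by (auto simp: bij_def)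
  let ?r = "inv_into UNIV q"
  have r: "C3_jet ?r (deriv ?r) (D2 ?r) (D3 ?r)" using q by (simp add: Diff3_cover_def C3_function_jet)
  have "((\<lambda>x. ?r (q x)) has_real_derivative deriv ?r (q x) * deriv q x) (at x)" for x
    using DERIV_chain2[OF C3_jetD(1)[OF r] C3_jetD(1)[OF jet]] .
  moreover have "(\<lambda>x. ?r (q x)) = (\<lambda>x. x)" using bij by (simp add: bij_is_inj fun_eq_iff)
  ultimately have "deriv ?r (q x) * deriv q x = 1" for x
    using DERIV_unique[OF _ DERIV_ident] by fastforce
  then have "deriv q x \<noteq> 0" for x by (metis mult_zero_right zero_neq_one)
  moreover have "deriv q x \<ge> 0" for x
  proof (rule mono_on_imp_deriv_nonneg[of UNIV q])
    show "mono_on UNIV q" using mono by (simp add: strict_mono_mono mono_imp_mono_on)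
  qed (use C3_jetD(1)[OF jet] in auto)
  ultimately show "deriv q x > 0" for x by (metis less_eq_real_def)
  show "periodic (deriv q)" by (rule periodic_deriv[OF C3_jetD(1)[OF jet] shift])
  then show "periodic (D2 q)"
    by (intro periodic_deriv[OF C3_jetD(2)[OF jet], of 0]) (simp add: periodic_def)
  then show "periodic (D3 q)"
    by (intro periodic_deriv[OF C3_jetD(3)[OF jet], of 0]) (simp add: periodic_def)
qed

lemma Diff3_coverI:
  assumes q: "C3_jet q q1 q2 q3" and pos: "\<And>x. q1 x > 0"
    and shift: "\<And>x. q (x + 2 * pi) = q x + 2 * pi"
  shows "q \<in> Diff3_cover"
proof -
  have mono: "strict_mono q"
    unfolding strict_mono_def using C3_jetD(1)[OF q] pos DERIV_pos_imp_increasing by metis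
  then have inj: "inj q" by (rule strict_mono_imp_inj_on)
  have "\<exists>x. q x = y" for y
  proof -
    obtain k :: int where k: "q 0 \<le> y + 2 * pi * of_int k" "y + 2 * pi * of_int k < q 0 + 2 * pi"
      by (rule real_mod_period)
    have "\<exists>x\<ge>0. x \<le> 2 * pi \<and> q x = y + 2 * pi * of_int k"
      using k shift[of 0] C3_jetD(8)[OF q] by (intro IVT') (auto intro: continuous_on_subset)
    then obtain x where "q x = y + 2 * pi * of_int k" by blast
    then have "q (x + 2 * pi * of_int (- k)) = y"
      using quasiperiodic_shift_int[of q "2 * pi" x "- k"] shift by simp
    then show ?thesis by blast
  qed
  then have "surj q" by (metis surjI)
  with inj have "bij q" by (simp add: bij_def)
  moreover have "C3_function (inv_into UNIV q)"
    by (rule C3_jet_function, rule C3_jet_inverse[OF q pos]) (simp_all add: inj \<open>surj q\<close> surj_f_inv_f)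
  ultimately show ?thesis
    using mono C3_jet_function[OF q] shift by (simp add: Diff3_cover_def)
qed

lemma Diff3_cover_compose_jet:
  assumes "p \<in> Diff3_cover" "q \<in> Diff3_cover"
  shows "C3_jet (p \<circ> q) (\<lambda>x. deriv p (q x) * deriv q x)
    (\<lambda>x. D2 p (q x) * (deriv q x)\<^sup>2 + deriv p (q x) * D2 q x)
    (\<lambda>x. D3 p (q x) * deriv q x ^ 3 + 3 * D2 p (q x) * deriv q x * D2 q x + deriv p (q x) * D3 q x)"
  using C3_jet_compose[OF Diff3_coverD(1)[OF assms(1)] Diff3_coverD(1)[OF assms(2)]] by (simp add: o_def)

lemma Diff3_cover_compose: "p \<in> Diff3_cover \<Longrightarrow> q \<in> Diff3_cover \<Longrightarrow> p \<circ> q \<in> Diff3_cover"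
  by (rule Diff3_coverI[OF Diff3_cover_compose_jet])
     (auto simp: Diff3_coverD(2,3))

lemma Diff3_cover_translation: "(\<lambda>x. x + c) \<in> Diff3_cover"
  by (rule Diff3_coverI[OF C3_jet_translation]) auto

lemma Diff3_cover_id: "id \<in> Diff3_cover"
  using Diff3_cover_translation[of 0] by (simp add: id_def)

lemma Diff3_cover_inverse_jet:
  assumes q: "q \<in> Diff3_cover"
  defines "r \<equiv> inv_into UNIV q"
  shows "C3_jet r (\<lambda>y. 1 / deriv q (r y)) (\<lambda>y. - D2 q (r y) / deriv q (r y) ^ 3)
    (\<lambda>y. (3 * (D2 q (r y))\<^sup>2 - deriv q (r y) * D3 q (r y)) / deriv q (r y) ^ 5)"
  unfolding r_def using Diff3_coverD[OF q]
  by (intro C3_jet_inverse) (auto simp: surj_f_inv_f)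

lemma Diff3_cover_inverse:
  assumes q: "q \<in> Diff3_cover" shows "inv_into UNIV q \<in> Diff3_cover"
proof (rule Diff3_coverI[OF Diff3_cover_inverse_jet[OF q]])
  note Q = Diff3_coverD[OF q]
  show "0 < 1 / deriv q (inv_into UNIV q x)" for x by (simp add: Q)
  show "inv_into UNIV q (x + 2 * pi) = inv_into UNIV q x + 2 * pi" for x
    by (rule inv_f_eq[OF Q(9)]) (simp add: Q(3) surj_f_inv_f[OF Q(10)])
qed

section \<open>Convergence in the topology of uniform convergence of jets\<close>

lemma limitin_C3_topology:
  "limitin C3_topology f l F \<longleftrightarrow>
    l \<in> Diff3_cover \<and> (\<forall>\<^sub>F x in F. f x \<in> Diff3_cover) \<and>
    uniform_limit UNIV f l F \<and> uniform_limit UNIV (\<lambda>x. deriv (f x)) (deriv l) F \<and>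
    uniform_limit UNIV (\<lambda>x. D2 (f x)) (D2 l) F \<and> uniform_limit UNIV (\<lambda>x. D3 (f x)) (D3 l) F"
  (is "_ \<longleftrightarrow> ?R")
proof -
  \<comment> \<open>The strict pointwise inequalities of \<^const>\<open>C3_near\<close> are not uniformly strict; a uniform \<open>d < e\<close> makes
    the neighbourhoods open.\<close>
  define near where "near e = {q \<in> Diff3_cover. \<exists>d<e. \<forall>k\<le>3. \<forall>\<phi>. \<bar>(deriv ^^ k) l \<phi> - (deriv ^^ k) q \<phi>\<bar> \<le> d}"
    for e :: real
  have open_near: "openin C3_topology (near e)" for e
    unfolding openin_C3_topology
  proof (intro conjI ballI)
    fix p assume "p \<in> near e"
    then obtain d where d: "d < e" "\<And>k \<phi>. k \<le> 3 \<Longrightarrow> \<bar>(deriv ^^ k) l \<phi> - (deriv ^^ k) p \<phi>\<bar> \<le> d"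
      by (auto simp: near_def)
    have "q \<in> near e" if q: "q \<in> Diff3_cover" "C3_near ((e - d) / 2) p q" for q
    proof -
      have "\<bar>(deriv ^^ k) l \<phi> - (deriv ^^ k) q \<phi>\<bar> \<le> d + (e - d) / 2" if "k \<le> 3" for k \<phi>
      proof -
        have "\<bar>(deriv ^^ k) p \<phi> - (deriv ^^ k) q \<phi>\<bar> < (e - d) / 2"
          using q(2) that by (simp add: C3_near_def)
        then show ?thesis using d(2)[OF that, of \<phi>] by linarith
      qed
      moreover have "d + (e - d) / 2 < e" using d(1) by (simp add: field_simps)
      ultimately show ?thesis using q(1) by (auto simp: near_def)
    qed
    then show "\<exists>\<epsilon>>0. \<forall>q\<in>Diff3_cover. C3_near \<epsilon> p q \<longrightarrow> q \<in> near e"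
      using d(1) by (intro exI[of _ "(e - d) / 2"]) auto
  qed (auto simp: near_def)
  show ?thesis
  proof
    assume lim: "limitin C3_topology f l F"
    then have l: "l \<in> Diff3_cover" by (auto simp: limitin_def topspace_C3_topology)
    have ev: "\<forall>\<^sub>F x in F. f x \<in> near e" if "e > 0" for e
    proof -
      have "l \<in> near e" using that l by (auto simp: near_def intro!: exI[of _ 0])
      then show ?thesis using lim open_near by (auto simp: limitin_def)
    qed
    have "uniform_limit UNIV (\<lambda>x. (deriv ^^ k) (f x)) ((deriv ^^ k) l) F" if k: "k \<le> 3" for k
    proof (rule uniform_limitI)
      fix e :: real assume "e > 0"
      from ev[OF this] show "\<forall>\<^sub>F x in F. \<forall>\<phi>\<in>UNIV. dist ((deriv ^^ k) (f x) \<phi>) ((deriv ^^ k) l \<phi>) < e"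
      proof eventually_elim
        case (elim x)
        then obtain d where d: "d < e" "\<And>\<phi>. \<bar>(deriv ^^ k) l \<phi> - (deriv ^^ k) (f x) \<phi>\<bar> \<le> d"
          using k unfolding near_def by blast
        show ?case
        proof
          fix \<phi>
          show "dist ((deriv ^^ k) (f x) \<phi>) ((deriv ^^ k) l \<phi>) < e"
            using d(1) d(2)[of \<phi>] by (simp add: dist_real_def abs_minus_commute)
        qed
      qed
    qed
    from this[of 0] this[of 1] this[of 2] this[of 3]
    show ?R using l eventually_mono[OF ev[OF zero_less_one]] by (auto simp: deriv_iterates near_def)
  next
    assume R: ?R
    show "limitin C3_topology f l F"
      unfolding limitin_def topspace_C3_topology
    proof (intro conjI allI impI)
      fix U assume U: "openin C3_topology U \<and> l \<in> U"
      then obtain e where e: "e > 0" "\<And>q. q \<in> Diff3_cover \<Longrightarrow> C3_near e l q \<Longrightarrow> q \<in> U"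
        unfolding openin_C3_topology by blast
      have "\<forall>\<^sub>F x in F. f x \<in> Diff3_cover \<and> (\<forall>\<phi>. dist (f x \<phi>) (l \<phi>) < e) \<and>
          (\<forall>\<phi>. dist (deriv (f x) \<phi>) (deriv l \<phi>) < e) \<and> (\<forall>\<phi>. dist (D2 (f x) \<phi>) (D2 l \<phi>) < e) \<and>
          (\<forall>\<phi>. dist (D3 (f x) \<phi>) (D3 l \<phi>) < e)"
        using R e(1) by (intro eventually_conj) (auto dest: uniform_limitD)
      then show "\<forall>\<^sub>F x in F. f x \<in> U"
      proof eventually_elim
        case (elim x)
        then have "C3_near e l (f x)"
          unfolding C3_near_def le3_cases
          by (simp add: deriv_iterates dist_real_def abs_minus_commute)
        with elim e(2) show ?case by blast
      qed
    qed (use R in simp)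
  qed
qed

lemma uniform_limit_compose_varying:
  fixes p q :: "real \<Rightarrow> real"
  assumes P: "uniform_limit UNIV P p F" and Q: "uniform_limit UNIV Q q F"
    and p: "uniformly_continuous_on UNIV p"
  shows "uniform_limit UNIV (\<lambda>x \<phi>. P x (Q x \<phi>)) (\<lambda>\<phi>. p (q \<phi>)) F"
proof (rule uniform_limitI)
  fix e :: real assume e: "e > 0"
  have "uniform_limit UNIV (\<lambda>x \<phi>. p (Q x \<phi>)) (\<lambda>\<phi>. p (q \<phi>)) F"
    using uniform_limit_compose[OF Q p] by (simp add: o_def)
  from uniform_limitD[OF this, of "e / 2"] uniform_limitD[OF P, of "e / 2"] e
  have "\<forall>\<^sub>F x in F. \<forall>\<phi>\<in>UNIV. dist (p (Q x \<phi>)) (p (q \<phi>)) < e / 2"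
    "\<forall>\<^sub>F x in F. \<forall>\<phi>\<in>UNIV. dist (P x \<phi>) (p \<phi>) < e / 2" by simp_all
  then show "\<forall>\<^sub>F x in F. \<forall>\<phi>\<in>UNIV. dist (P x (Q x \<phi>)) (p (q \<phi>)) < e"
  proof eventually_elim
    case (elim x)
    show ?case
    proof
      fix \<phi>
      have "dist (P x (Q x \<phi>)) (p (Q x \<phi>)) < e / 2" "dist (p (Q x \<phi>)) (p (q \<phi>)) < e / 2"
        using elim by auto
      then show "dist (P x (Q x \<phi>)) (p (q \<phi>)) < e" by (rule dist_triangle_half_r[OF dist_commute_lessI]) 
    qed
  qed
qed


lemma bounded_range_mult:
  fixes f g :: "real \<Rightarrow> real"
  assumes "bounded (range f)" "bounded (range g)" shows "bounded (range (\<lambda>x. f x * g x))"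
proof -
  obtain a b where "\<And>x. \<bar>f x\<bar> \<le> a" "\<And>x. \<bar>g x\<bar> \<le> b" using assms by (auto simp: bounded_iff)
  then have "\<bar>f x * g x\<bar> \<le> a * b" for x
    unfolding abs_mult by (intro mult_mono) (auto intro: order_trans[OF abs_ge_zero])
  then show ?thesis by (auto simp: bounded_iff)
qed

text \<open>Uniform limits may be multiplied and divided only if the limits are bounded, so boundedness of
  the limit is carried along.\<close>

definition bounded_uniform_limit :: "('x \<Rightarrow> real \<Rightarrow> real) \<Rightarrow> (real \<Rightarrow> real) \<Rightarrow> 'x filter \<Rightarrow> bool"
  where "bounded_uniform_limit P p F \<longleftrightarrow> uniform_limit UNIV P p F \<and> bounded (range p)"

lemma bounded_uniform_limit_const: "bounded_uniform_limit (\<lambda>_ _. c) (\<lambda>_. c) F"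
  by (auto simp: bounded_uniform_limit_def intro: uniform_limit_intros)

lemma bounded_uniform_limit_add:
  "bounded_uniform_limit P p F \<Longrightarrow> bounded_uniform_limit Q q F \<Longrightarrow>
    bounded_uniform_limit (\<lambda>x \<phi>. P x \<phi> + Q x \<phi>) (\<lambda>\<phi>. p \<phi> + q \<phi>) F"
  by (auto simp: bounded_uniform_limit_def intro!: uniform_limit_intros bounded_plus_comp)

lemma bounded_uniform_limit_diff:
  "bounded_uniform_limit P p F \<Longrightarrow> bounded_uniform_limit Q q F \<Longrightarrow>
    bounded_uniform_limit (\<lambda>x \<phi>. P x \<phi> - Q x \<phi>) (\<lambda>\<phi>. p \<phi> - q \<phi>) F"
  by (auto simp: bounded_uniform_limit_def intro!: uniform_limit_intros bounded_minus_comp)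

lemma bounded_uniform_limit_mult:
  "bounded_uniform_limit P p F \<Longrightarrow> bounded_uniform_limit Q q F \<Longrightarrow>
    bounded_uniform_limit (\<lambda>x \<phi>. P x \<phi> * Q x \<phi>) (\<lambda>\<phi>. p \<phi> * q \<phi>) F"
  by (auto simp: bounded_uniform_limit_def intro!: uniform_lim_mult bounded_range_mult)

lemma bounded_uniform_limit_power:
  "bounded_uniform_limit P p F \<Longrightarrow> bounded_uniform_limit (\<lambda>x \<phi>. P x \<phi> ^ n) (\<lambda>\<phi>. p \<phi> ^ n) F"
  by (induction n) (auto intro: bounded_uniform_limit_mult bounded_uniform_limit_const)

lemma bounded_uniform_limit_divide:
  assumes "bounded_uniform_limit P p F" and Q: "bounded_uniform_limit Q q F"
    and b: "b > 0" "\<And>\<phi>. b \<le> q \<phi>"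
  shows "bounded_uniform_limit (\<lambda>x \<phi>. P x \<phi> / Q x \<phi>) (\<lambda>\<phi>. p \<phi> / q \<phi>) F"
proof -
  have q: "b \<le> norm (q \<phi>)" for \<phi> using b(2)[of \<phi>] by simp
  have "bounded_uniform_limit (\<lambda>x \<phi>. inverse (Q x \<phi>)) (\<lambda>\<phi>. inverse (q \<phi>)) F"
    unfolding bounded_uniform_limit_def
  proof
    show "uniform_limit UNIV (\<lambda>x \<phi>. inverse (Q x \<phi>)) (\<lambda>\<phi>. inverse (q \<phi>)) F"
      using uniform_lim_inverse[where S = UNIV and f = Q and l = q and F = F and b = b] Q q b(1) by (simp add: bounded_uniform_limit_def o_def)
    have "\<bar>inverse (q \<phi>)\<bar> \<le> inverse b" for \<phi>
      using b(1) b(2)[of \<phi>] by (auto intro: le_imp_inverse_le)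
    then show "bounded (range (\<lambda>\<phi>. inverse (q \<phi>)))" by (auto simp: bounded_iff)
  qed
  from bounded_uniform_limit_mult[OF assms(1) this] show ?thesis by (simp add: divide_inverse)
qed

lemma bounded_uniform_limit_ln:
  assumes P: "bounded_uniform_limit P p F" and b: "b > 0" "\<And>\<phi>. b \<le> p \<phi>"
  shows "bounded_uniform_limit (\<lambda>x \<phi>. ln (P x \<phi>)) (\<lambda>\<phi>. ln (p \<phi>)) F"
proof -
  have "uniformly_continuous_on {b/2..} (ln :: real \<Rightarrow> real)"
    unfolding uniformly_continuous_on_def
  proof (intro allI impI)
    fix e :: real assume e: "e > 0"
    have "dist (ln y) (ln x) < e" if "x \<in> {b/2..}" "y \<in> {b/2..}" "dist y x < e * b / 2" for x y :: real
    proof -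
      have xy: "x \<ge> b / 2" "y \<ge> b / 2" using that by auto
      then have pos: "x > 0" "y > 0" using b(1) by linarith+
      have half: "z / t \<le> \<bar>z\<bar> / (b / 2)" if "t \<ge> b / 2" for z t :: real
        using that b(1) by (smt (verit) divide_right_mono frac_le half_gt_zero)
      have "ln x - ln y \<le> (x - y) / y" "ln y - ln x \<le> (y - x) / x"
        using ln_diff_le[of x y] ln_diff_le[of y x] pos by simp_all
      then have "\<bar>ln y - ln x\<bar> \<le> \<bar>y - x\<bar> / (b / 2)"
        using half[OF xy(1), of "y - x"] half[OF xy(2), of "x - y"] by (auto simp: abs_minus_commute)
      also have "\<dots> < e" using that(3) b(1) by (simp add: dist_real_def field_simps)
      finally show ?thesis by (simp add: dist_real_def)
    qed
    then show "\<exists>d>0. \<forall>x\<in>{b/2..}. \<forall>y\<in>{b/2..}. dist y x < d \<longrightarrow> dist (ln y) (ln x) < e"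
      using e b(1) by (intro exI[of _ "e * b / 2"]) auto
  qed
  moreover have "\<forall>\<^sub>F x in F. P x ` UNIV \<subseteq> {b/2..}"
  proof -
    have "\<forall>\<^sub>F x in F. \<forall>\<phi>\<in>UNIV. dist (P x \<phi>) (p \<phi>) < b / 2"
      using P b(1) by (intro uniform_limitD) (auto simp: bounded_uniform_limit_def)
    then show ?thesis
    proof eventually_elim
      case (elim x)
      have "P x \<phi> \<ge> b / 2" for \<phi>
      proof -
        have "dist (P x \<phi>) (p \<phi>) < b / 2" using elim by simp
        then show ?thesis using b(2)[of \<phi>] unfolding dist_real_def by linarith
      qed
      then show ?case by auto
    qed
  qed
  moreover have "p ` UNIV \<subseteq> {b/2..}" using b by (auto intro: order_trans[of _ b])
  ultimately have "uniform_limit UNIV (\<lambda>x \<phi>. ln (P x \<phi>)) (ln \<circ> p) F"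
    using P unfolding bounded_uniform_limit_def by (intro uniform_limit_compose[where U = "{b/2..}"]) auto
  moreover have "bounded (range (\<lambda>\<phi>. ln (p \<phi>)))"
  proof -
    obtain a where a: "\<And>\<phi>. \<bar>p \<phi>\<bar> \<le> a" using P by (auto simp: bounded_uniform_limit_def bounded_iff)
    have "ln b \<le> ln (p \<phi>) \<and> ln (p \<phi>) \<le> ln a" for \<phi>
      using a[of \<phi>] b(1) b(2)[of \<phi>] by (auto intro!: ln_mono)
    then have "\<bar>ln (p \<phi>)\<bar> \<le> max \<bar>ln b\<bar> \<bar>ln a\<bar>" for \<phi> by (smt (verit))
    then show ?thesis by (auto simp: bounded_iff)
  qed
  ultimately show ?thesis by (simp add: bounded_uniform_limit_def o_def)
qed

lemma bounded_uniform_limit_compose: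
  assumes "bounded_uniform_limit P p F" "uniform_limit UNIV Q q F" "uniformly_continuous_on UNIV p"
  shows "bounded_uniform_limit (\<lambda>x \<phi>. P x (Q x \<phi>)) (\<lambda>\<phi>. p (q \<phi>)) F"
  using assms bounded_subset[of "range p" "range (\<lambda>\<phi>. p (q \<phi>))"]
  by (auto simp: bounded_uniform_limit_def intro: uniform_limit_compose_varying)

lemmas bounded_uniform_limit_intros = bounded_uniform_limit_const bounded_uniform_limit_add
  bounded_uniform_limit_diff bounded_uniform_limit_mult bounded_uniform_limit_power

lemma Diff3_cover_uniformly_continuous:
  assumes q: "q \<in> Diff3_cover"
  shows "uniformly_continuous_on UNIV q" "uniformly_continuous_on UNIV (deriv q)"
    "uniformly_continuous_on UNIV (D2 q)" "uniformly_continuous_on UNIV (D3 q)"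
proof -
  note Q = Diff3_coverD[OF q]
  note C = C3_jetD[OF Q(1)]
  show "uniformly_continuous_on UNIV (deriv q)" "uniformly_continuous_on UNIV (D2 q)"
    "uniformly_continuous_on UNIV (D3 q)"
    using C Q by (auto intro: periodic_uniformly_continuous)
  have "uniformly_continuous_on UNIV (\<lambda>x. (q x - x) + x)"
    using C Q by (intro uniformly_continuous_on_add periodic_uniformly_continuous uniformly_continuous_on_id
      continuous_intros) (auto simp: periodic_def)
  then show "uniformly_continuous_on UNIV q" by simp
qed

lemma Diff3_cover_bounded:
  assumes q: "q \<in> Diff3_cover"
  shows "bounded (range (deriv q))" "bounded (range (D2 q))" "bounded (range (D3 q))"
    "\<exists>b>0. \<forall>x. b \<le> deriv q x"
proof -
  note Q = Diff3_coverD[OF q]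
  note C = C3_jetD[OF Q(1)]
  show "bounded (range (deriv q))" "bounded (range (D2 q))" "bounded (range (D3 q))"
    using C Q by (auto intro: periodic_bounded)
  show "\<exists>b>0. \<forall>x. b \<le> deriv q x"
    by (rule periodic_bounded_below[OF C(9) Q(6) Q(2)]) blast
qed

lemma limitin_C3_topologyD:
  assumes "limitin C3_topology f l F"
  shows "l \<in> Diff3_cover" "\<forall>\<^sub>F x in F. f x \<in> Diff3_cover" "uniform_limit UNIV f l F"
    "bounded_uniform_limit (\<lambda>x. deriv (f x)) (deriv l) F"
    "bounded_uniform_limit (\<lambda>x. D2 (f x)) (D2 l) F" "bounded_uniform_limit (\<lambda>x. D3 (f x)) (D3 l) F"
  using assms unfolding limitin_C3_topology bounded_uniform_limit_def
  by (simp_all add: Diff3_cover_bounded(1-3))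

lemma limitin_C3_topologyI:
  assumes "l \<in> Diff3_cover" "C3_jet l l1 l2 l3"
    and ev: "\<forall>\<^sub>F x in F. f x \<in> Diff3_cover \<and> C3_jet (f x) (f1 x) (f2 x) (f3 x)"
    and "uniform_limit UNIV f l F" "uniform_limit UNIV f1 l1 F" "uniform_limit UNIV f2 l2 F"
    "uniform_limit UNIV f3 l3 F"
  shows "limitin C3_topology f l F"
proof -
  have "\<forall>\<^sub>F x in F. \<forall>\<phi>\<in>UNIV. deriv (f x) \<phi> = f1 x \<phi>" "\<forall>\<^sub>F x in F. \<forall>\<phi>\<in>UNIV. D2 (f x) \<phi> = f2 x \<phi>"
    "\<forall>\<^sub>F x in F. \<forall>\<phi>\<in>UNIV. D3 (f x) \<phi> = f3 x \<phi>"
    by (rule eventually_mono[OF ev], use C3_jetD(5-7) in metis)+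
  from this[THEN uniform_limit_cong, OF refl] assms(5-7)
  have "uniform_limit UNIV (\<lambda>x. deriv (f x)) l1 F" "uniform_limit UNIV (\<lambda>x. D2 (f x)) l2 F"
    "uniform_limit UNIV (\<lambda>x. D3 (f x)) l3 F"
    by blast+
  moreover have "\<forall>\<^sub>F x in F. f x \<in> Diff3_cover" using ev by (rule eventually_mono) simp
  ultimately show ?thesis
    unfolding limitin_C3_topology using assms(1,4) by (simp add: C3_jetD(5-7)[OF assms(2)])
qed

lemma limitin_C3_compose:
  assumes f: "limitin C3_topology f p F" and g: "limitin C3_topology g q F"
  shows "limitin C3_topology (\<lambda>x. f x \<circ> g x) (p \<circ> q) F"
proof -
  note f = limitin_C3_topologyD[OF f] and g = limitin_C3_topologyD[OF g]
  note p = Diff3_cover_uniformly_continuous[OF f(1)]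
  note comp = bounded_uniform_limit_compose[OF f(4) g(3) p(2)]
    bounded_uniform_limit_compose[OF f(5) g(3) p(3)] bounded_uniform_limit_compose[OF f(6) g(3) p(4)]
  have bul: "bounded_uniform_limit P r F \<Longrightarrow> uniform_limit UNIV P r F" for P r
    by (simp add: bounded_uniform_limit_def)
  show ?thesis
  proof (rule limitin_C3_topologyI[OF Diff3_cover_compose[OF f(1) g(1)] Diff3_cover_compose_jet[OF f(1) g(1)]])
    show "\<forall>\<^sub>F x in F. f x \<circ> g x \<in> Diff3_cover \<and>
       C3_jet (f x \<circ> g x) (\<lambda>\<phi>. deriv (f x) (g x \<phi>) * deriv (g x) \<phi>)
    (\<lambda>\<phi>. D2 (f x) (g x \<phi>) * (deriv (g x) \<phi>)\<^sup>2 + deriv (f x) (g x \<phi>) * D2 (g x) \<phi>)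
    (\<lambda>\<phi>. D3 (f x) (g x \<phi>) * deriv (g x) \<phi> ^ 3 + 3 * D2 (f x) (g x \<phi>) * deriv (g x) \<phi> * D2 (g x) \<phi>
      + deriv (f x) (g x \<phi>) * D3 (g x) \<phi>)"
      using f(2) g(2) by eventually_elim (simp add: Diff3_cover_compose Diff3_cover_compose_jet)
    show "uniform_limit UNIV (\<lambda>x. f x \<circ> g x) (p \<circ> q) F"
      using uniform_limit_compose_varying[OF f(3) g(3) p(1)] by (simp add: o_def)
  qed (intro bul bounded_uniform_limit_intros comp g)+
qed

lemma limitin_C3_inverse:
  assumes f: "limitin C3_topology f q F"
  shows "limitin C3_topology (\<lambda>x. inv_into UNIV (f x)) (inv_into UNIV q) F"
proof -
  note f = limitin_C3_topologyD[OF f]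
  define r where "r = inv_into UNIV q"
  define R where "R x = inv_into UNIV (f x)" for x
  have r: "r \<in> Diff3_cover" unfolding r_def by (rule Diff3_cover_inverse[OF f(1)])
  have rq: "r (q \<phi>) = \<phi>" for \<phi>
    using Diff3_coverD(9)[OF f(1)] by (simp add: r_def)
  \<comment> \<open>The point \<open>y = f\<^sub>x (R\<^sub>x y)\<close> is uniformly close to \<open>q (R\<^sub>x y)\<close>, and \<open>r\<close> maps the latter to \<open>R\<^sub>x y\<close>.\<close>
  have R: "uniform_limit UNIV R r F"
  proof (rule uniform_limitI)
    fix e :: real assume "e > 0"
    then obtain d where d: "d > 0" "\<And>u v. dist u v < d \<Longrightarrow> dist (r u) (r v) < e"
      using Diff3_cover_uniformly_continuous(1)[OF r] unfolding uniformly_continuous_on_def by (metis UNIV_I)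
    have "\<forall>\<^sub>F x in F. \<forall>\<phi>\<in>UNIV. dist (f x \<phi>) (q \<phi>) < d" by (rule uniform_limitD[OF f(3) d(1)])
    with f(2) show "\<forall>\<^sub>F x in F. \<forall>y\<in>UNIV. dist (R x y) (r y) < e"
    proof eventually_elim
      case (elim x)
      show ?case
      proof
        fix y
        have "f x (R x y) = y" using Diff3_coverD(10)[OF elim(1)] by (simp add: R_def surj_f_inv_f)
        then have "dist (q (R x y)) y < d" using elim(2) by (metis UNIV_I dist_commute)
        from d(2)[OF this] show "dist (R x y) (r y) < e" by (simp add: rq)
      qed
    qed
  qed
  obtain b where b: "b > 0" "\<And>x. b \<le> deriv q x" using Diff3_cover_bounded(4)[OF f(1)] by blast
  have pow: "b ^ n > 0" "b ^ n \<le> deriv q x ^ n" for n x using b by (auto intro: power_mono)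
  note u = Diff3_cover_uniformly_continuous[OF f(1)]
  note comp = bounded_uniform_limit_compose[OF f(4) R u(2)]
    bounded_uniform_limit_compose[OF f(5) R u(3)] bounded_uniform_limit_compose[OF f(6) R u(4)]
  have bul: "bounded_uniform_limit P r F \<Longrightarrow> uniform_limit UNIV P r F" for P r
    by (simp add: bounded_uniform_limit_def)
  have minus: "bounded_uniform_limit (\<lambda>x \<phi>. - D2 (f x) (R x \<phi>)) (\<lambda>\<phi>. - D2 q (r \<phi>)) F"
    using bounded_uniform_limit_diff[OF bounded_uniform_limit_const[of 0] comp(2)] by simp
  show ?thesis
    unfolding r_def[symmetric] R_def[symmetric]
  proof (rule limitin_C3_topologyI[OF r Diff3_cover_inverse_jet[OF f(1), folded r_def]])
    show "\<forall>\<^sub>F x in F. R x \<in> Diff3_cover \<and>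
      C3_jet (R x) (\<lambda>y. 1 / deriv (f x) (R x y)) (\<lambda>y. - D2 (f x) (R x y) / deriv (f x) (R x y) ^ 3)
       (\<lambda>y. (3 * (D2 (f x) (R x y))\<^sup>2 - deriv (f x) (R x y) * D3 (f x) (R x y)) / deriv (f x) (R x y) ^ 5)"
      using f(2) by eventually_elim (unfold R_def, intro conjI Diff3_cover_inverse Diff3_cover_inverse_jet)
  qed (rule R, (intro bul bounded_uniform_limit_divide[where b = b] bounded_uniform_limit_divide[where b = "b ^ 3"]
     bounded_uniform_limit_divide[where b = "b ^ 5"] bounded_uniform_limit_intros comp minus b pow)+)
qed

section \<open>The Bott cocycle\<close>

lemma Diff3_cover_ln_deriv:
  assumes q: "q \<in> Diff3_cover"
  shows "((\<lambda>x. ln (deriv q x)) has_real_derivative D2 q x / deriv q x) (at x)"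
  using Diff3_coverD(2)[OF q, of x]
  by (auto intro!: derivative_eq_intros C3_jetD(2)[OF Diff3_coverD(1)[OF q]])

lemma bott_cocycle_eq:
  assumes "p \<in> Diff3_cover" "q \<in> Diff3_cover"
  shows "bott_cocycle p q = integral {0..2 * pi} (\<lambda>x. ln (deriv p (q x)) * (D2 q x / deriv q x))"
  unfolding bott_cocycle_def by (simp add: DERIV_imp_deriv[OF Diff3_cover_ln_deriv[OF assms(2)]])

lemma bott_integrand_continuous:
  assumes p: "p \<in> Diff3_cover" and q: "q \<in> Diff3_cover"
  shows "continuous_on UNIV (\<lambda>x. ln (deriv p (q x)) * (D2 q x / deriv q x))"
proof -
  note P = C3_jetD[OF Diff3_coverD(1)[OF p]] and Q = C3_jetD[OF Diff3_coverD(1)[OF q]]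
  have ne: "deriv p x \<noteq> 0" "deriv q x \<noteq> 0" for x
    using Diff3_coverD(2)[OF p, of x] Diff3_coverD(2)[OF q, of x] by simp_all
  show ?thesis
    by (intro continuous_intros continuous_on_compose2[OF P(9) Q(8)] Q(9,10)) (simp_all add: ne)
qed

text \<open>The change of variables moves the period \<open>{0..2\<pi>}\<close> to another one, over which a periodic function has
  the same integral.\<close>

lemma has_integral_periodic_substitution:
  assumes G: "continuous_on UNIV G" "periodic G" and q: "q \<in> Diff3_cover"
  shows "((\<lambda>x. G (q x) * deriv q x) has_integral integral {0..2 * pi} G) {0..2 * pi}"
proof -
  have "\<exists>F. \<forall>x :: real. -\<infinity> < ereal x \<longrightarrow> ereal x < \<infinity> \<longrightarrow> (F has_vector_derivative G x) (at x)"
    using G(1) by (intro einterval_antiderivative) (simp_all add: continuous_on_eq_continuous_at)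
  then obtain F where F: "\<And>x. (F has_real_derivative G x) (at x)"
    by (auto simp: has_real_derivative_iff_has_vector_derivative)
  have "((\<lambda>x. F (x + 2 * pi) - F x) has_real_derivative 0) (at x)" for x
  proof -
    have "((\<lambda>x. F (x + 2 * pi)) has_real_derivative G (x + 2 * pi)) (at x)"
      using DERIV_shift F by blast
    then have "((\<lambda>x. F (x + 2 * pi) - F x) has_real_derivative G (x + 2 * pi) - G x) (at x)"
      by (intro DERIV_diff F)
    then show ?thesis using G(2) by (simp add: periodic_def)
  qed
  then have "F (q 0 + 2 * pi) - F (q 0) = F (0 + 2 * pi) - F 0"
    using DERIV_isconst_all[of "\<lambda>x. F (x + 2 * pi) - F x"] by blast
  moreover have "(G has_integral F (2 * pi) - F 0) {0..2 * pi}"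
    using F by (intro fundamental_theorem_of_calculus)
      (auto simp: has_real_derivative_iff_has_vector_derivative[symmetric] intro: has_field_derivative_at_within)
  moreover have "((\<lambda>x. G (q x) * deriv q x) has_integral F (q (2 * pi)) - F (q 0)) {0..2 * pi}"
    using DERIV_chain2[OF F C3_jetD(1)[OF Diff3_coverD(1)[OF q]]]
    by (intro fundamental_theorem_of_calculus)
      (auto simp: has_real_derivative_iff_has_vector_derivative[symmetric] intro: has_field_derivative_at_within)
  moreover have "q (2 * pi) = q 0 + 2 * pi" using Diff3_coverD(3)[OF q, of 0] by simp
  ultimately show ?thesis by (simp add: integral_unique)
qed

text \<open>By the chain rule \<open>ln (p q)' = ln p' (q) + ln q'\<close>, so each side with a composition splits into two terms.  One term is the
  same on both sides, and the term \<open>\<integral> ln p' (q r) d ln q' (r)\<close> becomes \<open>c(p, q)\<close> by the substitution \<open>r\<close>.\<close>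

theorem bott_cocycle_identity:
  assumes p: "p \<in> Diff3_cover" and q: "q \<in> Diff3_cover" and r: "r \<in> Diff3_cover"
  shows "bott_cocycle p q + bott_cocycle (p \<circ> q) r = bott_cocycle p (q \<circ> r) + bott_cocycle q r"
proof -
  note P = Diff3_coverD[OF p] and Q = Diff3_coverD[OF q] and R = Diff3_coverD[OF r]
  have qr: "q \<circ> r \<in> Diff3_cover" and pq: "p \<circ> q \<in> Diff3_cover" by (simp_all add: Diff3_cover_compose p q r)
  define G where "G x = ln (deriv p (q x)) * (D2 q x / deriv q x)" for x
  define A where "A x = ln (deriv p (q (r x))) * (D2 r x / deriv r x)" for x
  define B where "B x = ln (deriv q (r x)) * (D2 r x / deriv r x)" for x
  have int: "f integrable_on {0..2 * pi}" if "continuous_on UNIV f" for f :: "real \<Rightarrow> real"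
    using integrable_continuous_interval continuous_on_subset[OF that] by blast
  have contA: "continuous_on UNIV A"
  proof -
    have "deriv p x \<noteq> 0" "deriv r x \<noteq> 0" for x using P(2)[of x] R(2)[of x] by simp_all
    then show ?thesis
      unfolding A_def
      by (intro continuous_intros continuous_on_compose2[OF C3_jetD(9)[OF P(1)]]
        continuous_on_compose2[OF C3_jetD(8)[OF Q(1)] C3_jetD(8)[OF R(1)]] C3_jetD(9,10)[OF R(1)]) auto
  qed
  have contB: "continuous_on UNIV B" unfolding B_def by (rule bott_integrand_continuous[OF q r])
  have B: "bott_cocycle q r = integral {0..2 * pi} B" by (simp only: B_def[abs_def] bott_cocycle_eq[OF q r])
  have "bott_cocycle (p \<circ> q) r = integral {0..2 * pi} (\<lambda>x. A x + B x)"
    unfolding bott_cocycle_eq[OF pq r]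
  proof (rule Henstock_Kurzweil_Integration.integral_cong)
    fix x
    have "ln (deriv (p \<circ> q) (r x)) = ln (deriv p (q (r x))) + ln (deriv q (r x))"
      using P(2)[of "q (r x)"] Q(2)[of "r x"]
      by (simp add: C3_jetD(5)[OF Diff3_cover_compose_jet[OF p q]] ln_mult)
    then show "ln (deriv (p \<circ> q) (r x)) * (D2 r x / deriv r x) = A x + B x"
      by (simp add: A_def B_def distrib_right add_divide_distrib)
  qed
  also have "\<dots> = integral {0..2 * pi} A + bott_cocycle q r"
    using Henstock_Kurzweil_Integration.integral_add[OF int[OF contA] int[OF contB]]
    by (simp only: B)
  finally have 1: "bott_cocycle (p \<circ> q) r = integral {0..2 * pi} A + bott_cocycle q r" .
  have "periodic G" unfolding periodic_def G_def
    using P(6) Q(3,6,7) by (simp add: periodic_def)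
  then have sub: "((\<lambda>x. G (r x) * deriv r x) has_integral bott_cocycle p q) {0..2 * pi}"
    unfolding bott_cocycle_eq[OF p q] G_def[symmetric]
    using bott_integrand_continuous[OF p q]
    by (intro has_integral_periodic_substitution r) (simp_all add: G_def[abs_def])
  have "bott_cocycle p (q \<circ> r) = integral {0..2 * pi} (\<lambda>x. A x + G (r x) * deriv r x)"
    unfolding bott_cocycle_eq[OF p qr]
  proof (rule Henstock_Kurzweil_Integration.integral_cong)
    fix x
    have "deriv (q \<circ> r) x = deriv q (r x) * deriv r x"
      "D2 (q \<circ> r) x = D2 q (r x) * (deriv r x)\<^sup>2 + deriv q (r x) * D2 r x"
      using C3_jetD(5,6)[OF Diff3_cover_compose_jet[OF q r]] by simp_all
    then have "D2 (q \<circ> r) x / deriv (q \<circ> r) x = D2 q (r x) / deriv q (r x) * deriv r x + D2 r x / deriv r x"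
      using Q(2)[of "r x"] R(2)[of x] by (simp add: field_simps power2_eq_square)
    then show "ln (deriv p ((q \<circ> r) x)) * (D2 (q \<circ> r) x / deriv (q \<circ> r) x) = A x + G (r x) * deriv r x"
      by (simp add: A_def G_def algebra_simps)
  qed
  also have "\<dots> = integral {0..2 * pi} A + bott_cocycle p q"
    using Henstock_Kurzweil_Integration.integral_add[OF int[OF contA] has_integral_integrable[OF sub]]
    by (simp add: integral_unique[OF sub])
  finally show ?thesis using 1 by simp
qed

lemma bott_cocycle_id: "bott_cocycle id q = 0" "bott_cocycle q id = 0"
proof -
  have "deriv (id :: real \<Rightarrow> real) = (\<lambda>_. 1)" by (rule ext) simp
  then show "bott_cocycle id q = 0" "bott_cocycle q id = 0" by (simp_all add: bott_cocycle_def)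
qed

lemma tendsto_bott_cocycle:
  assumes f: "limitin C3_topology f p F" and g: "limitin C3_topology g q F"
  shows "((\<lambda>x. bott_cocycle (f x) (g x)) \<longlongrightarrow> bott_cocycle p q) F"
proof (cases "F = bot")
  case False
  note f = limitin_C3_topologyD[OF f] and g = limitin_C3_topologyD[OF g]
  obtain a where a: "a > 0" "\<And>x. a \<le> deriv p x" using Diff3_cover_bounded(4)[OF f(1)] by blast
  obtain b where b: "b > 0" "\<And>x. b \<le> deriv q x" using Diff3_cover_bounded(4)[OF g(1)] by blast
  let ?I = "\<lambda>p q x. ln (deriv p (q x)) * (D2 q x / deriv q x)"
  have "bounded_uniform_limit (\<lambda>x. ?I (f x) (g x)) (?I p q) F"
    by (rule bounded_uniform_limit_mult[OF bounded_uniform_limit_ln[OF bounded_uniform_limit_compose[OF f(4) g(3)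
          Diff3_cover_uniformly_continuous(2)[OF f(1)]] a(1) a(2)] bounded_uniform_limit_divide[OF g(5) g(4) b]])
  then have lim: "uniform_limit ({0..2 * pi}) (\<lambda>x. ?I (f x) (g x)) (?I p q) F"
    unfolding bounded_uniform_limit_def by (auto intro: uniform_limit_on_subset)
  \<comment> \<open>The limit theorem for integrals wants a continuous integrand at every index, not just eventually.\<close>
  define h where "h x = (if f x \<in> Diff3_cover \<and> g x \<in> Diff3_cover then ?I (f x) (g x) else (\<lambda>_. 0))" for x
  have ev: "\<forall>\<^sub>F x in F. f x \<in> Diff3_cover \<and> g x \<in> Diff3_cover" using f(2) g(2) by eventually_elim simp
  have "\<forall>\<^sub>F x in F. \<forall>y\<in>{0..2 * pi}. ?I (f x) (g x) y = h x y"
    using ev by eventually_elim (simp add: h_def)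
  from uniform_limit_cong[OF this refl] lim have lim': "uniform_limit ({0..2 * pi}) h (?I p q) F" by blast
  have cont: "continuous_on ({0..2 * pi}) (h x)" for x
    using continuous_on_subset[OF bott_integrand_continuous[of "f x" "g x"] subset_UNIV] by (simp add: h_def)
  obtain I J where IJ: "\<And>x. (h x has_integral I x) ({0..2 * pi})"
    "(?I p q has_integral J) ({0..2 * pi})" "(I \<longlongrightarrow> J) F"
    using uniform_limit_integral[OF lim' cont False] by metis
  have "J = bott_cocycle p q" using integral_unique[OF IJ(2)] by (simp add: bott_cocycle_eq f(1) g(1))
  moreover have "\<forall>\<^sub>F x in F. I x = bott_cocycle (f x) (g x)"
    using ev
  proof eventually_elim
    case (elim x)
    then show ?case using integral_unique[OF IJ(1)[of x]] by (simp add: bott_cocycle_eq h_def)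
  qed
  ultimately show ?thesis using Lim_transform_eventually[OF IJ(3)] by simp
qed simp

section \<open>The central extension as a topological group\<close>

lemma bott_extension_simps:
  "carrier bott_extension = Diff3_cover \<times> UNIV"
  "(p, s) \<otimes>\<^bsub>bott_extension\<^esub> (q, t) = (p \<circ> q, s + t + bott_cocycle p q)"
  "\<one>\<^bsub>bott_extension\<^esub> = (id, 0)"
  by (simp_all add: bott_extension_def)

lemma inv_into_compose:
  assumes "q \<in> Diff3_cover"
  shows "inv_into UNIV q \<circ> q = id" "q \<circ> inv_into UNIV q = id"
  using Diff3_coverD(9,10)[OF assms] by (simp_all add: surj_iff inj_iff)

lemma group_bott_extension: "group bott_extension"
proof (rule groupI)
  fix x y z
  assume "x \<in> carrier bott_extension" "y \<in> carrier bott_extension" "z \<in> carrier bott_extension"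
  then show "x \<otimes>\<^bsub>bott_extension\<^esub> y \<otimes>\<^bsub>bott_extension\<^esub> z = x \<otimes>\<^bsub>bott_extension\<^esub> (y \<otimes>\<^bsub>bott_extension\<^esub> z)"
    using bott_cocycle_identity[of "fst x" "fst y" "fst z"]
    by (cases x; cases y; cases z) (auto simp: bott_extension_simps o_assoc)
next
  fix x assume "x \<in> carrier bott_extension"
  then obtain q t where x: "x = (q, t)" "q \<in> Diff3_cover" by (auto simp: bott_extension_simps)
  let ?y = "(inv_into UNIV q, - t - bott_cocycle (inv_into UNIV q) q)"
  have "?y \<in> carrier bott_extension" "?y \<otimes>\<^bsub>bott_extension\<^esub> x = \<one>\<^bsub>bott_extension\<^esub>"
    using x by (simp_all add: bott_extension_simps Diff3_cover_inverse inv_into_compose)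
  then show "\<exists>y\<in>carrier bott_extension. y \<otimes>\<^bsub>bott_extension\<^esub> x = \<one>\<^bsub>bott_extension\<^esub>" by blast
qed (auto simp: bott_extension_simps Diff3_cover_compose Diff3_cover_id bott_cocycle_id)

lemma inv_bott_extension:
  assumes "q \<in> Diff3_cover"
  shows "inv\<^bsub>bott_extension\<^esub> (q, t) = (inv_into UNIV q, - t - bott_cocycle (inv_into UNIV q) q)"
  using assms
  by (intro group.inv_equality[OF group_bott_extension])
     (simp_all add: bott_extension_simps Diff3_cover_inverse inv_into_compose)

lemma limitin_bott_extension:
  "limitin bott_extension_topology f l F \<longleftrightarrow>
    limitin C3_topology (\<lambda>x. fst (f x)) (fst l) F \<and> ((\<lambda>x. snd (f x)) \<longlongrightarrow> snd l) F"
  by (simp add: bott_extension_topology_def limitin_pairwise o_def)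

lemma limitin_bott_extension_mult:
  assumes f: "limitin bott_extension_topology f x F" and g: "limitin bott_extension_topology g y F"
  shows "limitin bott_extension_topology (\<lambda>z. f z \<otimes>\<^bsub>bott_extension\<^esub> g z) (x \<otimes>\<^bsub>bott_extension\<^esub> y) F"
proof -
  have "x \<otimes>\<^bsub>bott_extension\<^esub> y = (fst x \<circ> fst y, snd x + snd y + bott_cocycle (fst x) (fst y))" for x y
    by (cases x; cases y) (simp add: bott_extension_simps)
  then show ?thesis
    using f g by (auto simp: limitin_bott_extension intro!: limitin_C3_compose tendsto_intros tendsto_bott_cocycle)
qed

theorem topological_group_bott_extension: "topological_group bott_extension bott_extension_topology"
  unfolding topological_group_def
proof (intro conjI)
  let ?G = bott_extension and ?T = bott_extension_topology
  show "group ?G" by (rule group_bott_extension)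
  show top: "topspace ?T = carrier ?G"
    by (simp add: bott_extension_topology_def topspace_C3_topology bott_extension_simps)
  show "continuous_map (prod_topology ?T ?T) ?T (\<lambda>(x, y). x \<otimes>\<^bsub>?G\<^esub> y)"
    unfolding continuous_map_atin
  proof
    fix z assume z: "z \<in> topspace (prod_topology ?T ?T)"
    have "limitin ?T fst (fst z) (atin (prod_topology ?T ?T) z)" "limitin ?T snd (snd z) (atin (prod_topology ?T ?T) z)"
      using z by (auto intro!: limitin_continuous_map continuous_map_fst continuous_map_snd)
    from limitin_bott_extension_mult[OF this]
    show "limitin ?T (\<lambda>(x, y). x \<otimes>\<^bsub>?G\<^esub> y) (case z of (x, y) \<Rightarrow> x \<otimes>\<^bsub>?G\<^esub> y) (atin (prod_topology ?T ?T) z)"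
      by (simp add: case_prod_unfold)
  qed
  show "continuous_map ?T ?T (\<lambda>x. inv\<^bsub>?G\<^esub> x)"
  proof (rule continuous_map_eq)
    show "continuous_map ?T ?T (\<lambda>x. (inv_into UNIV (fst x), - snd x - bott_cocycle (inv_into UNIV (fst x)) (fst x)))"
      unfolding continuous_map_atin
    proof
      fix z assume z: "z \<in> topspace ?T"
      have "limitin ?T (\<lambda>x. x) z (atin ?T z)" using z by (intro limitin_continuous_map) auto
      then show "limitin ?T (\<lambda>x. (inv_into UNIV (fst x), - snd x - bott_cocycle (inv_into UNIV (fst x)) (fst x)))
          (inv_into UNIV (fst z), - snd z - bott_cocycle (inv_into UNIV (fst z)) (fst z)) (atin ?T z)"
        by (auto simp: limitin_bott_extension intro!: limitin_C3_inverse tendsto_intros tendsto_bott_cocycle)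
    qed
    show "(inv_into UNIV (fst x), - snd x - bott_cocycle (inv_into UNIV (fst x)) (fst x)) = inv\<^bsub>?G\<^esub> x"
      if "x \<in> topspace ?T" for x
      using that by (cases x) (simp add: top bott_extension_simps inv_bott_extension)
  qed
qed

section \<open>The universal covering of the projective linear group\<close>

text \<open>The point of the projective line at angle \<open>\<phi>\<close> is spanned by \<open>(sin (\<phi>/2), cos (\<phi>/2))\<close>.  In these
  homogeneous coordinates the point at infinity needs no separate treatment.\<close>

definition acts_as :: "(real \<Rightarrow> real) \<Rightarrow> real \<Rightarrow> real \<Rightarrow> real \<Rightarrow> real \<Rightarrow> bool"
  where "acts_as q a b c d \<longleftrightarrow> (\<forall>\<phi>. \<exists>r. r \<noteq> 0 \<and>
    sin (q \<phi> / 2) = r * (a * sin (\<phi> / 2) + b * cos (\<phi> / 2)) \<and>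
    cos (q \<phi> / 2) = r * (c * sin (\<phi> / 2) + d * cos (\<phi> / 2)))"

lemma parallel_unit_iff:
  fixes s k X Y :: real
  assumes "s\<^sup>2 + k\<^sup>2 = 1" "X \<noteq> 0 \<or> Y \<noteq> 0"
  shows "(\<exists>r. r \<noteq> 0 \<and> s = r * X \<and> k = r * Y) \<longleftrightarrow> s * Y = k * X"
proof
  assume eq: "s * Y = k * X"
  have sk: "s \<noteq> 0 \<or> k \<noteq> 0" using assms(1) by auto
  show "\<exists>r. r \<noteq> 0 \<and> s = r * X \<and> k = r * Y"
  proof (cases "X = 0")
    case True
    then have "Y \<noteq> 0" "s = 0" using assms(2) eq by auto
    then show ?thesis using True sk by (intro exI[of _ "k / Y"]) auto
  next
    case False
    then have "s \<noteq> 0" using eq sk by auto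
    then show ?thesis using False eq by (intro exI[of _ "s / X"]) (auto simp: field_simps)
  qed
qed (auto simp: algebra_simps)

lemma det_nonzero_image:
  fixes a b c d S C :: real
  assumes "a * d - b * c \<noteq> 0" "S \<noteq> 0 \<or> C \<noteq> 0"
  shows "a * S + b * C \<noteq> 0 \<or> c * S + d * C \<noteq> 0"
proof (rule ccontr)
  assume "\<not> ?thesis"
  then have "a * S + b * C = 0" "c * S + d * C = 0" by auto
  then have "(a * d - b * c) * S = 0" "(a * d - b * c) * C = 0" by algebra+
  then show False using assms by auto
qed

lemma sin_or_cos_nonzero: "sin x \<noteq> 0 \<or> cos x \<noteq> (0 :: real)"
  by (metis sin_cos_squared_add zero_power2 add_0 zero_neq_one)

lemma acts_as_iff_linear_fractional:
  assumes "a * d - b * c = 1"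
  shows "acts_as q a b c d \<longleftrightarrow>
    (\<forall>\<phi>. angle_to_RP1 (q \<phi>) = linear_fractional a b c d (angle_to_RP1 \<phi>))"
proof -
  have "(\<exists>r. r \<noteq> 0 \<and> sin (q \<phi> / 2) = r * (a * sin (\<phi> / 2) + b * cos (\<phi> / 2)) \<and>
      cos (q \<phi> / 2) = r * (c * sin (\<phi> / 2) + d * cos (\<phi> / 2))) \<longleftrightarrow>
    angle_to_RP1 (q \<phi>) = linear_fractional a b c d (angle_to_RP1 \<phi>)" for \<phi>
  proof -
    define S C X Y where defs: "S = sin (\<phi> / 2)" "C = cos (\<phi> / 2)" "X = a * S + b * C" "Y = c * S + d * C"
    have SC: "S \<noteq> 0 \<or> C \<noteq> 0" using sin_or_cos_nonzero by (simp add: defs)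
    then have XY: "X \<noteq> 0 \<or> Y \<noteq> 0" unfolding defs(3,4) using assms by (intro det_nonzero_image) auto
    have "linear_fractional a b c d (angle_to_RP1 \<phi>) = (if Y = 0 then None else Some (X / Y))"
    proof (cases "C = 0")
      case True
      then show ?thesis using SC by (auto simp: angle_to_RP1_def defs)
    next
      case False
      then have "c * (S / C) + d = Y / C" "a * (S / C) + b = X / C"
        by (simp_all add: defs(3,4) add_divide_distrib)
      then show ?thesis using False by (auto simp: angle_to_RP1_def tan_def defs(1,2))
    qed
    moreover have "angle_to_RP1 (q \<phi>) = (if Y = 0 then None else Some (X / Y)) \<longleftrightarrow>
        sin (q \<phi> / 2) * Y = cos (q \<phi> / 2) * X"
      using XY sin_or_cos_nonzero[of "q \<phi> / 2"]
      by (auto simp: angle_to_RP1_def tan_def field_simps)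
    ultimately show ?thesis
      using parallel_unit_iff[OF sin_cos_squared_add XY, of "q \<phi> / 2"] by (simp add: defs)
  qed
  then show ?thesis by (simp add: acts_as_def)
qed

lemma SL2_cover_iff:
  "q \<in> SL2_cover \<longleftrightarrow> q \<in> Diff3_cover \<and> (\<exists>a b c d. a * d - b * c = 1 \<and> acts_as q a b c d)"
  unfolding SL2_cover_def using acts_as_iff_linear_fractional by blast

lemma acts_as_scale:
  assumes "acts_as q a b c d" "k \<noteq> 0" shows "acts_as q (k * a) (k * b) (k * c) (k * d)"
  unfolding acts_as_def
proof
  fix \<phi>
  obtain r where "r \<noteq> 0" "sin (q \<phi> / 2) = r * (a * sin (\<phi> / 2) + b * cos (\<phi> / 2))"
      "cos (q \<phi> / 2) = r * (c * sin (\<phi> / 2) + d * cos (\<phi> / 2))"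
    using assms(1) unfolding acts_as_def by blast
  then show "\<exists>r. r \<noteq> 0 \<and> sin (q \<phi> / 2) = r * (k * a * sin (\<phi> / 2) + k * b * cos (\<phi> / 2)) \<and>
      cos (q \<phi> / 2) = r * (k * c * sin (\<phi> / 2) + k * d * cos (\<phi> / 2))"
    using assms(2) by (intro exI[of _ "r / k"]) (simp add: field_simps)
qed

lemma SL2_coverI:
  assumes "q \<in> Diff3_cover" "acts_as q a b c d" "a * d - b * c > 0"
  shows "q \<in> SL2_cover"
proof -
  define k where "k = 1 / sqrt (a * d - b * c)"
  have k: "k \<noteq> 0" "k * k * (a * d - b * c) = 1"
    using assms(3) by (auto simp: k_def)
  have "(k * a) * (k * d) - (k * b) * (k * c) = 1" using k(2) by (simp add: algebra_simps)
  with acts_as_scale[OF assms(2) k(1)] assms(1) show ?thesis unfolding SL2_cover_iff by blast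
qed

lemma acts_as_compose:
  assumes p: "acts_as p a b c d" and q: "acts_as q a' b' c' d'"
  shows "acts_as (p \<circ> q) (a * a' + b * c') (a * b' + b * d') (c * a' + d * c') (c * b' + d * d')"
  unfolding acts_as_def
proof
  fix \<phi>
  obtain r where r: "r \<noteq> 0" "sin (q \<phi> / 2) = r * (a' * sin (\<phi> / 2) + b' * cos (\<phi> / 2))"
      "cos (q \<phi> / 2) = r * (c' * sin (\<phi> / 2) + d' * cos (\<phi> / 2))"
    using q unfolding acts_as_def by blast
  obtain t where t: "t \<noteq> 0" "sin (p (q \<phi>) / 2) = t * (a * sin (q \<phi> / 2) + b * cos (q \<phi> / 2))"
      "cos (p (q \<phi>) / 2) = t * (c * sin (q \<phi> / 2) + d * cos (q \<phi> / 2))"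
    using p unfolding acts_as_def by blast
  show "\<exists>r. r \<noteq> 0 \<and>
      sin ((p \<circ> q) \<phi> / 2) = r * ((a * a' + b * c') * sin (\<phi> / 2) + (a * b' + b * d') * cos (\<phi> / 2)) \<and>
      cos ((p \<circ> q) \<phi> / 2) = r * ((c * a' + d * c') * sin (\<phi> / 2) + (c * b' + d * d') * cos (\<phi> / 2))"
    using r t by (intro exI[of _ "t * r"]) (simp add: algebra_simps)
qed

lemma acts_as_inverse:
  assumes q: "acts_as q a b c d" "q \<in> Diff3_cover" and det: "a * d - b * c \<noteq> 0"
  shows "acts_as (inv_into UNIV q) d (- b) (- c) a"
  unfolding acts_as_def
proof
  fix \<phi>
  define \<psi> where "\<psi> = inv_into UNIV q \<phi>"
  have "q \<psi> = \<phi>" using Diff3_coverD(10)[OF q(2)] by (simp add: \<psi>_def surj_f_inv_f)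
  then obtain r where r: "r \<noteq> 0" "sin (\<phi> / 2) = r * (a * sin (\<psi> / 2) + b * cos (\<psi> / 2))"
      "cos (\<phi> / 2) = r * (c * sin (\<psi> / 2) + d * cos (\<psi> / 2))"
    using q(1) unfolding acts_as_def by blast
  have "d * sin (\<phi> / 2) - b * cos (\<phi> / 2) = r * (a * d - b * c) * sin (\<psi> / 2)"
    "a * cos (\<phi> / 2) - c * sin (\<phi> / 2) = r * (a * d - b * c) * cos (\<psi> / 2)"
    unfolding r(2,3) by algebra+
  then show "\<exists>r. r \<noteq> 0 \<and>
      sin (inv_into UNIV q \<phi> / 2) = r * (d * sin (\<phi> / 2) + - b * cos (\<phi> / 2)) \<and>
      cos (inv_into UNIV q \<phi> / 2) = r * (- c * sin (\<phi> / 2) + a * cos (\<phi> / 2))"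
    unfolding \<psi>_def[symmetric] using r(1) det
    by (intro exI[of _ "1 / (r * (a * d - b * c))"]) auto
qed

lemma acts_as_translation:
  "acts_as (\<lambda>x. x + c) (cos (c / 2)) (sin (c / 2)) (- sin (c / 2)) (cos (c / 2))"
  unfolding acts_as_def
  by (intro allI exI[of _ 1]) (simp add: add_divide_distrib sin_add cos_add)

lemma SL2_cover_compose: 
  assumes "p \<in> SL2_cover" "q \<in> SL2_cover" shows "p \<circ> q \<in> SL2_cover"
proof -
  obtain a b c d where p: "p \<in> Diff3_cover" "a * d - b * c = 1" "acts_as p a b c d"
    using assms(1) unfolding SL2_cover_iff by blast
  obtain a' b' c' d' where q: "q \<in> Diff3_cover" "a' * d' - b' * c' = 1" "acts_as q a' b' c' d'"
    using assms(2) unfolding SL2_cover_iff by blast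
  have "(a * a' + b * c') * (c * b' + d * d') - (a * b' + b * d') * (c * a' + d * c')
      = (a * d - b * c) * (a' * d' - b' * c')" by algebra
  then show ?thesis
    using p q by (intro SL2_coverI[OF _ acts_as_compose[OF p(3) q(3)]] Diff3_cover_compose) simp_all
qed

lemma SL2_cover_inverse: 
  assumes "q \<in> SL2_cover" shows "inv_into UNIV q \<in> SL2_cover"
proof -
  obtain a b c d where q: "q \<in> Diff3_cover" "a * d - b * c = 1" "acts_as q a b c d"
    using assms unfolding SL2_cover_iff by blast
  show ?thesis
    using q by (intro SL2_coverI[OF _ acts_as_inverse[OF q(3,1)]] Diff3_cover_inverse) (simp_all add: algebra_simps)
qed

lemma SL2_cover_translation: "(\<lambda>x. x + c) \<in> SL2_cover"
  by (rule SL2_coverI[OF Diff3_cover_translation acts_as_translation])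
    (simp add: power2_eq_square[symmetric])

lemma SL2_cover_id: "id \<in> SL2_cover"
  using SL2_cover_translation[of 0] by (simp add: id_def)

lemma SL2_cover_Diff3: "q \<in> SL2_cover \<Longrightarrow> q \<in> Diff3_cover"
  by (simp add: SL2_cover_iff)

text \<open>The difference of two lifts of the same projective map is continuous with values in \<open>2\<pi>\<int>\<close>.\<close>

lemma acts_as_unique:
  assumes p: "p \<in> Diff3_cover" "acts_as p a b c d" and q: "q \<in> Diff3_cover" "acts_as q a b c d"
  obtains k :: int where "\<And>x. p x = q x + 2 * pi * of_int k"
proof -
  have s0: "sin ((p x - q x) / 2) = 0" for x
  proof -
    obtain r where r: "sin (p x / 2) = r * (a * sin (x / 2) + b * cos (x / 2))"
        "cos (p x / 2) = r * (c * sin (x / 2) + d * cos (x / 2))"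
      using p(2) unfolding acts_as_def by blast
    obtain t where t: "sin (q x / 2) = t * (a * sin (x / 2) + b * cos (x / 2))"
        "cos (q x / 2) = t * (c * sin (x / 2) + d * cos (x / 2))"
      using q(2) unfolding acts_as_def by blast
    show ?thesis by (simp add: diff_divide_distrib sin_diff r t)
  qed
  then obtain k :: int where "(p 0 - q 0) / 2 = of_int k * pi" using sin_zero_iff_int2 by blast
  then have k: "p 0 = q 0 + 2 * pi * of_int k" by (simp add: field_simps)
  define f where "f x = p x - q x - 2 * pi * of_int k" for x
  have sf: "sin (f x / 2) = 0" for x
  proof -
    have half: "f x / 2 = (p x - q x) / 2 - of_int k * pi" by (simp add: f_def field_simps)
    have "sin (of_int k * pi) = 0" using sin_zero_iff_int2 by blast
    then show ?thesis unfolding half sin_diff by (simp add: s0)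
  qed
  have "continuous_on UNIV f"
    unfolding f_def[abs_def]
    by (intro continuous_intros C3_jetD(8)[OF Diff3_coverD(1)[OF p(1)]] C3_jetD(8)[OF Diff3_coverD(1)[OF q(1)]])
  then have conn: "connected (range f)" by (intro connected_continuous_image) auto
  have f0: "0 \<in> range f" using k by (auto simp: f_def image_iff intro!: exI[of _ 0])
  have "f x = 0" for x
  proof (rule ccontr)
    assume ne: "f x \<noteq> 0"
    obtain j :: int where "f x / 2 = of_int j * pi" using sf sin_zero_iff_int2 by blast
    then have j: "f x = of_int (2 * j) * pi" by (simp add: field_simps)
    then have "j \<noteq> 0" using ne by auto
    then consider "j \<ge> 1" | "j \<le> -1" by linarith
    then have "pi \<in> range f \<or> - pi \<in> range f"
    proof cases
      case 1
      then have "1 * pi \<le> of_int (2 * j) * pi" by (intro mult_right_mono) auto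
      then show ?thesis using connectedD_interval[OF conn f0 rangeI[of f x], of pi] j by simp
    next
      case 2
      then have "of_int (2 * j) * pi \<le> (-1) * pi" by (intro mult_right_mono) auto
      then show ?thesis using connectedD_interval[OF conn rangeI[of f x] f0, of "- pi"] j by simp
    qed
    then obtain y where "f y = pi \<or> f y = - pi" by (metis rangeE)
    then show False using sf[of y] by auto
  qed
  then have "p x = q x + 2 * pi * of_int k" for x by (simp add: f_def algebra_simps)
  then show ?thesis by (rule that)
qed

lemma acts_as_unique_at:
  assumes "p \<in> Diff3_cover" "acts_as p a b c d" "q \<in> Diff3_cover" "acts_as q a b c d" "p x = q x"
  shows "p = q"
proof -
  obtain k :: int where k: "\<And>x. p x = q x + 2 * pi * of_int k" using acts_as_unique[OF assms(1-4)] by blast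
  then have "k = 0" using k[of x] assms(5) by simp
  then show ?thesis using k by auto
qed

section \<open>Explicit lifts of projective maps\<close>

text \<open>A positive definite matrix of determinant 1, up to scaling, is
  \<open>(\<alpha> + 1 - \<beta>, \<gamma>; \<gamma>, \<alpha> + 1 + \<beta>)\<close> with \<open>\<alpha>\<^sup>2 = 1 + \<beta>\<^sup>2 + \<gamma>\<^sup>2\<close>.  It turns no vector by as much as a right
  angle, so the turning angle is given by the principal branch of the arctangent.  The derivative of the lift is the
  Poisson kernel \<open>1 / (\<alpha> + \<beta> cos \<phi> + \<gamma> sin \<phi>)\<close>.\<close>

definition polar_alpha :: "real \<Rightarrow> real \<Rightarrow> real" where "polar_alpha \<beta> \<gamma> = sqrt (1 + \<beta>\<^sup>2 + \<gamma>\<^sup>2)"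

definition polar_denom :: "real \<Rightarrow> real \<Rightarrow> real \<Rightarrow> real"
  where "polar_denom \<beta> \<gamma> \<phi> = polar_alpha \<beta> \<gamma> + \<beta> * cos \<phi> + \<gamma> * sin \<phi>"

definition polar_slope :: "real \<Rightarrow> real \<Rightarrow> real \<Rightarrow> real"
  where "polar_slope \<beta> \<gamma> \<phi> = \<gamma> * cos \<phi> - \<beta> * sin \<phi>"

definition polar :: "real \<Rightarrow> real \<Rightarrow> real \<Rightarrow> real"
  where "polar \<beta> \<gamma> \<phi> = \<phi> + 2 * arctan (polar_slope \<beta> \<gamma> \<phi> / (1 + polar_denom \<beta> \<gamma> \<phi>))"

lemma polar_alpha: "(polar_alpha \<beta> \<gamma>)\<^sup>2 = 1 + \<beta>\<^sup>2 + \<gamma>\<^sup>2" "polar_alpha \<beta> \<gamma> \<ge> 1"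
  by (simp_all add: polar_alpha_def)

lemma polar_alpha_eqI: "a \<ge> 0 \<Longrightarrow> a\<^sup>2 = 1 + \<beta>\<^sup>2 + \<gamma>\<^sup>2 \<Longrightarrow> polar_alpha \<beta> \<gamma> = a"
  unfolding polar_alpha_def by (metis real_sqrt_unique)

text \<open>The vector \<open>(D - \<alpha>, D')\<close> is a rotation of \<open>(\<beta>, \<gamma>)\<close>, so this is \<open>\<alpha>\<^sup>2 = 1 + \<beta>\<^sup>2 + \<gamma>\<^sup>2\<close> again.\<close>

lemma polar_relation:
  "(polar_denom \<beta> \<gamma> \<phi>)\<^sup>2 + (polar_slope \<beta> \<gamma> \<phi>)\<^sup>2 + 1 = 2 * polar_alpha \<beta> \<gamma> * polar_denom \<beta> \<gamma> \<phi>"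
proof -
  define a where "a = polar_alpha \<beta> \<gamma>"
  have "a\<^sup>2 = 1 + \<beta>\<^sup>2 + \<gamma>\<^sup>2" unfolding a_def by (rule polar_alpha)
  moreover have "(sin \<phi>)\<^sup>2 + (cos \<phi>)\<^sup>2 = 1" by simp
  ultimately show ?thesis
    unfolding polar_denom_def polar_slope_def a_def[symmetric] by algebra
qed

lemma polar_denom_pos: "polar_denom \<beta> \<gamma> \<phi> > 0"
proof -
  have "0 < 2 * polar_alpha \<beta> \<gamma> * polar_denom \<beta> \<gamma> \<phi>"
    unfolding polar_relation[symmetric] by (simp add: add_nonneg_pos)
  then show ?thesis using polar_alpha(2)[of \<beta> \<gamma>] by (simp add: zero_less_mult_iff)
qed

lemma DERIV_polar_denom: "(polar_denom \<beta> \<gamma> has_real_derivative polar_slope \<beta> \<gamma> \<phi>) (at \<phi>)"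
  unfolding polar_denom_def[abs_def] polar_slope_def by (auto intro!: derivative_eq_intros)

lemma DERIV_polar_slope:
  "(polar_slope \<beta> \<gamma> has_real_derivative polar_alpha \<beta> \<gamma> - polar_denom \<beta> \<gamma> \<phi>) (at \<phi>)"
  unfolding polar_denom_def polar_slope_def[abs_def] by (auto intro!: derivative_eq_intros)

lemma C3_jet_polar:
  "C3_jet (polar \<beta> \<gamma>) (\<lambda>\<phi>. 1 / polar_denom \<beta> \<gamma> \<phi>)
    (\<lambda>\<phi>. - polar_slope \<beta> \<gamma> \<phi> / (polar_denom \<beta> \<gamma> \<phi>)\<^sup>2)
    (\<lambda>\<phi>. (polar_denom \<beta> \<gamma> \<phi> - polar_alpha \<beta> \<gamma>) / (polar_denom \<beta> \<gamma> \<phi>)\<^sup>2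
        + 2 * (polar_slope \<beta> \<gamma> \<phi>)\<^sup>2 / polar_denom \<beta> \<gamma> \<phi> ^ 3)"
proof -
  have pos: "polar_denom \<beta> \<gamma> \<phi> > 0" for \<phi> by (rule polar_denom_pos)
  then have ne: "polar_denom \<beta> \<gamma> \<phi> \<noteq> 0" "1 + polar_denom \<beta> \<gamma> \<phi> \<noteq> 0" for \<phi>
    by (smt (verit))+
  note [derivative_intros] = DERIV_polar_denom DERIV_polar_slope
  have cont: "continuous_on UNIV (polar_denom \<beta> \<gamma>)" "continuous_on UNIV (polar_slope \<beta> \<gamma>)"
    unfolding polar_denom_def[abs_def] polar_slope_def[abs_def] by (intro continuous_intros)+
  have 1: "(polar \<beta> \<gamma> has_real_derivative 1 / polar_denom \<beta> \<gamma> \<phi>) (at \<phi>)" for \<phi>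
  proof -
    define D N a where defs: "D = polar_denom \<beta> \<gamma> \<phi>" "N = polar_slope \<beta> \<gamma> \<phi>" "a = polar_alpha \<beta> \<gamma>"
    have rel: "D\<^sup>2 + N\<^sup>2 + 1 = 2 * a * D" unfolding defs by (rule polar_relation)
    have D: "D > 0" and a: "a \<ge> 1" unfolding defs by (rule pos, rule polar_alpha)
    have "(polar \<beta> \<gamma> has_real_derivative 1 + 2 * ((((a - D) * (1 + D) - N * N) / ((1 + D) * (1 + D))) / (1 + (N / (1 + D))\<^sup>2))) (at \<phi>)"
      unfolding polar_def[abs_def] defs
      by (auto intro!: derivative_eq_intros simp: ne field_simps)
    moreover have "1 + 2 * ((((a - D) * (1 + D) - N * N) / ((1 + D) * (1 + D))) / (1 + (N / (1 + D))\<^sup>2)) = 1 / D"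
    proof -
      have "(1 + D)\<^sup>2 + N\<^sup>2 = 2 * D * (1 + a)" using rel by algebra
      moreover have "1 + (N / (1 + D))\<^sup>2 = ((1 + D)\<^sup>2 + N\<^sup>2) / ((1 + D) * (1 + D))"
        using D by (simp add: power_divide add_divide_distrib) (simp add: power2_eq_square)
      ultimately have "1 + (N / (1 + D))\<^sup>2 = 2 * D * (1 + a) / ((1 + D) * (1 + D))" by simp
      moreover have "(a - D) * (1 + D) - N * N = (a + 1) * (1 - D)" using rel by algebra
      ultimately have "(((a - D) * (1 + D) - N * N) / ((1 + D) * (1 + D))) / (1 + (N / (1 + D))\<^sup>2)
          = (a + 1) * (1 - D) / (2 * D * (1 + a))" using D by simp
      also have "\<dots> = ((1 + a) * (1 - D)) / ((1 + a) * (2 * D))" by (simp add: mult.commute add.commute)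
      also have "\<dots> = (1 - D) / (2 * D)" using a by (intro mult_divide_mult_cancel_left) simp
      finally show ?thesis using D by (simp add: field_simps)
    qed
    ultimately show ?thesis by (simp add: defs)
  qed
  have 2: "((\<lambda>\<phi>. 1 / polar_denom \<beta> \<gamma> \<phi>) has_real_derivative - polar_slope \<beta> \<gamma> \<phi> / (polar_denom \<beta> \<gamma> \<phi>)\<^sup>2) (at \<phi>)" for \<phi>
    by (auto intro!: derivative_eq_intros simp: ne power2_eq_square)
  have 3: "((\<lambda>\<phi>. - polar_slope \<beta> \<gamma> \<phi> / (polar_denom \<beta> \<gamma> \<phi>)\<^sup>2) has_real_derivative
    (polar_denom \<beta> \<gamma> \<phi> - polar_alpha \<beta> \<gamma>) / (polar_denom \<beta> \<gamma> \<phi>)\<^sup>2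
        + 2 * (polar_slope \<beta> \<gamma> \<phi>)\<^sup>2 / polar_denom \<beta> \<gamma> \<phi> ^ 3) (at \<phi>)" for \<phi>
    by (rule derivative_eq_intros refl | (simp add: ne; fail))+
       (use ne[of \<phi>] in \<open>simp add: divide_simps, simp add: algebra_simps eval_nat_numeral\<close>)
  show ?thesis
    unfolding C3_jet_def by (intro conjI allI 1 2 3 continuous_intros cont) (simp_all add: ne)
qed

lemma polar_Diff3_cover: "polar \<beta> \<gamma> \<in> Diff3_cover"
proof (rule Diff3_coverI[OF C3_jet_polar])
  show "0 < 1 / polar_denom \<beta> \<gamma> x" for x by (simp add: polar_denom_pos)
qed (simp add: polar_def polar_denom_def polar_slope_def)

lemma acts_as_polar:
  "acts_as (polar \<beta> \<gamma>) (polar_alpha \<beta> \<gamma> + 1 - \<beta>) \<gamma> \<gamma> (polar_alpha \<beta> \<gamma> + 1 + \<beta>)"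
  unfolding acts_as_def
proof
  fix \<phi>
  define D N a where defs: "D = polar_denom \<beta> \<gamma> \<phi>" "N = polar_slope \<beta> \<gamma> \<phi>" "a = polar_alpha \<beta> \<gamma>"
  define S C where SC: "S = sin (\<phi> / 2)" "C = cos (\<phi> / 2)"
  have sc: "S\<^sup>2 + C\<^sup>2 = 1" by (simp add: SC)
  have "sin \<phi> = 2 * S * C" "cos \<phi> = C\<^sup>2 - S\<^sup>2"
    using sin_double[of "\<phi> / 2"] cos_double[of "\<phi> / 2"] by (simp_all add: SC)
  then have DN: "D = a + \<beta> * (C\<^sup>2 - S\<^sup>2) + \<gamma> * (2 * S * C)" "N = \<gamma> * (C\<^sup>2 - S\<^sup>2) - \<beta> * (2 * S * C)"
    by (simp_all add: defs polar_denom_def polar_slope_def)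
  have D: "D > 0" unfolding defs by (rule polar_denom_pos)
  define t where "t = N / (1 + D)"
  have half: "polar \<beta> \<gamma> \<phi> / 2 = \<phi> / 2 + arctan t" by (simp add: polar_def t_def defs)
  define r where "r = 1 / ((1 + D) * sqrt (1 + t\<^sup>2))"
  have sq: "sqrt (1 + t\<^sup>2) \<noteq> 0" by (smt (verit) real_sqrt_eq_zero_cancel_iff zero_le_power2)
  have r: "r \<noteq> 0" using D sq by (simp add: r_def)
  have arc: "cos (arctan t) = r * (1 + D)" "sin (arctan t) = r * N"
    using D sq by (simp_all add: cos_arctan sin_arctan r_def t_def)
  have "sin (polar \<beta> \<gamma> \<phi> / 2) = r * ((a + 1 - \<beta>) * S + \<gamma> * C)"
    "cos (polar \<beta> \<gamma> \<phi> / 2) = r * (\<gamma> * S + (a + 1 + \<beta>) * C)"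
    unfolding half sin_add cos_add arc SC[symmetric] DN using sc by algebra+
  then show "\<exists>r. r \<noteq> 0 \<and>
      sin (polar \<beta> \<gamma> \<phi> / 2) = r * ((polar_alpha \<beta> \<gamma> + 1 - \<beta>) * sin (\<phi> / 2) + \<gamma> * cos (\<phi> / 2)) \<and>
      cos (polar \<beta> \<gamma> \<phi> / 2) = r * (\<gamma> * sin (\<phi> / 2) + (polar_alpha \<beta> \<gamma> + 1 + \<beta>) * cos (\<phi> / 2))"
    using r unfolding SC defs by blast
qed

lemma polar_SL2_cover: "polar \<beta> \<gamma> \<in> SL2_cover"
proof (rule SL2_coverI[OF polar_Diff3_cover acts_as_polar])
  have "(polar_alpha \<beta> \<gamma> + 1 - \<beta>) * (polar_alpha \<beta> \<gamma> + 1 + \<beta>) - \<gamma> * \<gamma>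
      = (polar_alpha \<beta> \<gamma>)\<^sup>2 - (1 + \<beta>\<^sup>2 + \<gamma>\<^sup>2) + 2 * polar_alpha \<beta> \<gamma> + 2" by algebra
  then show "(polar_alpha \<beta> \<gamma> + 1 - \<beta>) * (polar_alpha \<beta> \<gamma> + 1 + \<beta>) - \<gamma> * \<gamma> > 0"
    using polar_alpha[of \<beta> \<gamma>] by simp
qed


text \<open>A hyperbolic element: the lift of \<open>x \<mapsto> x / 2\<close> that fixes \<open>0\<close> and \<open>\<pi>\<close>.\<close>

definition contraction :: "real \<Rightarrow> real" where "contraction = polar (3 / 4) 0"

lemma contraction: "contraction \<in> SL2_cover" "acts_as contraction 1 0 0 2"
  "contraction 0 = 0" "contraction pi = pi"
proof -
  have a: "polar_alpha (3 / 4) 0 = 5 / 4" by (rule polar_alpha_eqI) (simp_all add: power2_eq_square)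
  show "contraction \<in> SL2_cover" unfolding contraction_def by (rule polar_SL2_cover)
  have "acts_as contraction (3 / 2) 0 0 3"
    using acts_as_polar[of "3/4" 0] by (simp add: a contraction_def)
  from acts_as_scale[OF this, of "2 / 3"] show "acts_as contraction 1 0 0 2" by simp
  show "contraction 0 = 0" "contraction pi = pi"
    by (simp_all add: contraction_def polar_def polar_slope_def)
qed

lemma contraction_pow:
  "contraction ^^ n \<in> SL2_cover" "acts_as (contraction ^^ n) 1 0 0 (2 ^ n)"
  "(contraction ^^ n) 0 = 0" "(contraction ^^ n) pi = pi"
proof -
  show "contraction ^^ n \<in> SL2_cover"
  proof (induction n)
    case (Suc n)
    from SL2_cover_compose[OF contraction(1) Suc] show ?case by (simp only: funpow.simps)
  qed (simp only: funpow.simps(1) SL2_cover_id)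
  show "acts_as (contraction ^^ n) 1 0 0 (2 ^ n)"
  proof (induction n)
    case 0
    show ?case using acts_as_translation[of 0] by (simp add: id_def)
  next
    case (Suc n)
    have "acts_as (contraction \<circ> contraction ^^ n) 1 0 0 (2 * 2 ^ n)"
      using acts_as_compose[OF contraction(2) Suc] by simp
    then show ?case by (simp only: funpow.simps power_Suc)
  qed
  show "(contraction ^^ n) 0 = 0" "(contraction ^^ n) pi = pi"
    by (induction n) (simp_all add: contraction)
qed

text \<open>The lift of \<open>x \<mapsto> x + t\<close> that fixes the point at infinity.\<close>

definition unipotent :: "real \<Rightarrow> real \<Rightarrow> real"
  where "unipotent t \<phi> = polar (t\<^sup>2 / 2) t \<phi> + 2 * arctan (t / 2)"

lemma polar_alpha_unipotent: "polar_alpha (t\<^sup>2 / 2) t = 1 + t\<^sup>2 / 2"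
  by (rule polar_alpha_eqI) (simp_all add: power2_eq_square algebra_simps)

lemma unipotent: "unipotent t \<in> SL2_cover" "acts_as (unipotent t) 1 t 0 1" "unipotent t pi = pi"
proof -
  have comp: "unipotent t = (\<lambda>x. x + 2 * arctan (t / 2)) \<circ> polar (t\<^sup>2 / 2) t"
    by (auto simp: unipotent_def)
  show "unipotent t \<in> SL2_cover"
    unfolding comp by (intro SL2_cover_compose SL2_cover_translation polar_SL2_cover)
  define r where "r = 1 / sqrt (1 + (t / 2)\<^sup>2)"
  have r: "r > 0" unfolding r_def by (simp add: add_pos_nonneg)
  have arc: "cos (arctan (t / 2)) = r" "sin (arctan (t / 2)) = r * (t / 2)"
    by (simp_all add: cos_arctan sin_arctan r_def)
  have "acts_as (\<lambda>x. x + 2 * arctan (t / 2)) r (r * (t / 2)) (- (r * (t / 2))) r"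
    using acts_as_translation[of "2 * arctan (t / 2)"] by (simp add: arc)
  moreover have "acts_as (polar (t\<^sup>2 / 2) t) 2 t t (2 + t\<^sup>2)"
  proof -
    have "polar_alpha (t\<^sup>2 / 2) t + 1 - t\<^sup>2 / 2 = 2" "polar_alpha (t\<^sup>2 / 2) t + 1 + t\<^sup>2 / 2 = 2 + t\<^sup>2"
      by (simp_all add: polar_alpha_unipotent)
    then show ?thesis using acts_as_polar[of "t\<^sup>2 / 2" t] by (simp only:)
  qed
  ultimately have "acts_as (unipotent t) (r * 2 + r * (t / 2) * t) (r * t + r * (t / 2) * (2 + t\<^sup>2))
    (- (r * (t / 2)) * 2 + r * t) (- (r * (t / 2)) * t + r * (2 + t\<^sup>2))"
    unfolding comp by (rule acts_as_compose)
  moreover have "r * 2 + r * (t / 2) * t = r * (2 + t\<^sup>2 / 2) * 1"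
    "r * t + r * (t / 2) * (2 + t\<^sup>2) = r * (2 + t\<^sup>2 / 2) * t"
    "- (r * (t / 2)) * 2 + r * t = r * (2 + t\<^sup>2 / 2) * 0"
    "- (r * (t / 2)) * t + r * (2 + t\<^sup>2) = r * (2 + t\<^sup>2 / 2) * 1"
    by (simp_all add: algebra_simps power2_eq_square)
  ultimately have acts: "acts_as (unipotent t) (r * (2 + t\<^sup>2 / 2) * 1) (r * (2 + t\<^sup>2 / 2) * t)
    (r * (2 + t\<^sup>2 / 2) * 0) (r * (2 + t\<^sup>2 / 2) * 1)" by simp
  define m where "m = r * (2 + t\<^sup>2 / 2)"
  have m: "m \<noteq> 0" using r by (simp add: m_def add_pos_nonneg less_imp_neq[symmetric])
  have "acts_as (unipotent t) (1 / m * (m * 1)) (1 / m * (m * t)) (1 / m * (m * 0)) (1 / m * (m * 1))"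
    unfolding m_def[symmetric] using m by (intro acts_as_scale acts[folded m_def]) simp
  then show "acts_as (unipotent t) 1 t 0 1" using m by simp
  show "unipotent t pi = pi"
    by (simp add: unipotent_def polar_def polar_slope_def polar_denom_def polar_alpha_unipotent arctan_minus)
qed

text \<open>The lift of \<open>x \<mapsto> x / (1 - t x)\<close> that fixes \<open>0\<close>.\<close>

definition opposite_unipotent :: "real \<Rightarrow> real \<Rightarrow> real"
  where "opposite_unipotent t = (\<lambda>x. x + pi) \<circ> unipotent t \<circ> (\<lambda>x. x + (- pi))"

lemma opposite_unipotent:
  "opposite_unipotent t \<in> SL2_cover" "acts_as (opposite_unipotent t) 1 0 (- t) 1"
  "opposite_unipotent t 0 = 0"
proof -
  show "opposite_unipotent t \<in> SL2_cover"
    unfolding opposite_unipotent_def by (intro SL2_cover_compose SL2_cover_translation unipotent)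
  have "acts_as (\<lambda>x. x + pi) 0 1 (-1) 0" "acts_as (\<lambda>x. x + (- pi)) 0 (-1) 1 0"
    using acts_as_translation[of pi] acts_as_translation[of "- pi"] by simp_all
  from acts_as_compose[OF acts_as_compose[OF this(1) unipotent(2)] this(2)]
  show "acts_as (opposite_unipotent t) 1 0 (- t) 1" by (simp add: opposite_unipotent_def)
  have "unipotent t (- pi) = - pi"
    using Diff3_coverD(3)[OF SL2_cover_Diff3[OF unipotent(1)], of t "- pi"] unipotent(3)[of t] by simp
  then show "opposite_unipotent t 0 = 0" by (simp add: opposite_unipotent_def)
qed

lemmas lift_Diff3 = contraction(1)[THEN SL2_cover_Diff3] contraction_pow(1)[THEN SL2_cover_Diff3]
  unipotent(1)[THEN SL2_cover_Diff3] opposite_unipotent(1)[THEN SL2_cover_Diff3]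

text \<open>Both sides of the next two identities lift the same projective map and agree at a common fixed point of the
  factors.  They say that conjugation by the contraction or by its inverse shrinks the unipotent elements to the identity.\<close>

lemma contraction_unipotent:
  "(contraction ^^ n) \<circ> unipotent t = unipotent (t / 2 ^ n) \<circ> (contraction ^^ n)"
proof (rule acts_as_unique_at[where x = pi])
  show "acts_as ((contraction ^^ n) \<circ> unipotent t) 1 t 0 (2 ^ n)"
    using acts_as_compose[OF contraction_pow(2) unipotent(2)] by simp
  show "acts_as (unipotent (t / 2 ^ n) \<circ> (contraction ^^ n)) 1 t 0 (2 ^ n)"
    using acts_as_compose[OF unipotent(2)[of "t / 2 ^ n"] contraction_pow(2)[of n]] by simp
qed (simp_all add: Diff3_cover_compose lift_Diff3 unipotent(3) contraction_pow)

lemma opposite_unipotent_contraction: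
  "opposite_unipotent t \<circ> (contraction ^^ n) = (contraction ^^ n) \<circ> opposite_unipotent (t / 2 ^ n)"
proof (rule acts_as_unique_at[where x = 0])
  show "acts_as (opposite_unipotent t \<circ> (contraction ^^ n)) 1 0 (- t) (2 ^ n)"
    using acts_as_compose[OF opposite_unipotent(2)[of t] contraction_pow(2)] by simp
  show "acts_as ((contraction ^^ n) \<circ> opposite_unipotent (t / 2 ^ n)) 1 0 (- t) (2 ^ n)"
    using acts_as_compose[OF contraction_pow(2)[of n] opposite_unipotent(2)[of "t / 2 ^ n"]] by simp
qed (simp_all add: Diff3_cover_compose lift_Diff3 opposite_unipotent(3) contraction_pow)

lemma acts_as_id_shift:
  assumes "p \<in> Diff3_cover" "q \<in> Diff3_cover" "acts_as p a b c d" "acts_as q a b c d"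
  obtains k :: int where "p = (\<lambda>x. x + 2 * pi * of_int k) \<circ> q"
proof -
  obtain k :: int where "\<And>x. p x = q x + 2 * pi * of_int k"
    using acts_as_unique[OF assms(1,3,2,4)] by blast
  then have "p = (\<lambda>x. x + 2 * pi * of_int k) \<circ> q" by (auto simp: fun_eq_iff)
  then show ?thesis by (rule that)
qed

text \<open>Up to a deck transformation, every element is a product of unipotent ones because \<open>SL\<^sub>2(\<real>)\<close> is
  generated by elementary matrices.  The deck transformations arise from the Weyl element
  \<open>n\<^sub>1 l\<^sub>1 n\<^sub>1\<close>: it lifts the half turn, and the fixed points of its factors confine it to the translation by
  \<open>\<pi>\<close> or \<open>- \<pi>\<close>, so its square generates them.\<close>

theorem SL2_cover_generated:
  assumes comp: "\<And>p q. p \<in> H \<Longrightarrow> q \<in> H \<Longrightarrow> p \<circ> q \<in> H"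
    and inv: "\<And>p. p \<in> H \<Longrightarrow> inv_into UNIV p \<in> H"
    and n: "\<And>t. unipotent t \<in> H" and l: "\<And>t. opposite_unipotent t \<in> H"
  shows "SL2_cover \<subseteq> H"
proof -
  let ?T = "\<lambda>k x. x + 2 * pi * of_int k :: real"
  have inv_T: "inv_into UNIV (\<lambda>x. x + c :: real) = (\<lambda>x. x + (- c))" for c
  proof
    fix y
    show "inv_into UNIV (\<lambda>x. x + c) y = y + - c" by (rule inv_f_eq) (auto intro: injI)
  qed
  define w where "w = unipotent 1 \<circ> opposite_unipotent 1 \<circ> unipotent 1"
  have wD: "w \<in> Diff3_cover" by (simp add: w_def Diff3_cover_compose lift_Diff3)
  have wH: "w \<in> H" unfolding w_def by (intro comp n l)
  have "acts_as w 0 1 (-1) 0"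
    using acts_as_compose[OF acts_as_compose[OF unipotent(2)[of 1] opposite_unipotent(2)[of 1]] unipotent(2)[of 1]]
    by (simp add: w_def)
  moreover have "acts_as (\<lambda>x. x + pi) 0 1 (-1) 0" using acts_as_translation[of pi] by simp
  ultimately obtain k :: int where k: "\<And>x. w x = x + pi + 2 * pi * of_int k"
    using acts_as_unique[OF wD _ Diff3_cover_translation] by blast
  \<comment> \<open>The fixed points \<open>\<plusminus>\<pi>\<close> and \<open>3\<pi>\<close> of the unipotent element give \<open>- \<pi> < w \<pi> < 3 \<pi>\<close>.\<close>
  have "k = 0 \<or> k = -1"
  proof -
    note u = Diff3_coverD(3,4)[OF lift_Diff3(3)[of 1]]
    have fix': "unipotent 1 (- pi) = - pi" "unipotent 1 (3 * pi) = 3 * pi"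
      using u(1)[of "- pi"] u(1)[of pi] unipotent(3)[of 1] by simp_all
    define z where "z = unipotent 1 0"
    have z: "- pi < z" "z < pi"
      using strict_monoD[OF u(2), of "- pi" 0] strict_monoD[OF u(2), of 0 pi] unipotent(3)[of 1] fix'
      by (simp_all add: z_def)
    have "w pi = unipotent 1 (z + pi)"
      by (simp add: w_def unipotent(3) opposite_unipotent_def z_def)
    moreover have "unipotent 1 (z + pi) < 3 * pi"
      using strict_monoD[OF u(2), of "z + pi" "3 * pi"] z fix' pi_gt_zero by linarith
    moreover have "- pi < unipotent 1 (z + pi)"
      using strict_monoD[OF u(2), of "- pi" "z + pi"] z fix' pi_gt_zero by linarith
    ultimately have "- pi < 2 * pi + 2 * pi * of_int k" "2 * pi + 2 * pi * of_int k < 3 * pi"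
      using k[of pi] by simp_all
    then have "pi * (-3) < pi * (2 * of_int k)" "pi * (2 * of_int k) < pi * 1"
      by (simp_all add: algebra_simps)
    then have "-3 < 2 * (of_int k :: real)" "2 * (of_int k :: real) < 1"
      using mult_less_cancel_left_pos[OF pi_gt_zero] by blast+
    then show ?thesis by linarith
  qed
  then have T1: "?T 1 \<in> H"
  proof
    assume "k = 0"
    then have "?T 1 = w \<circ> w" by (auto simp: k)
    then show ?thesis using comp[OF wH wH] by simp
  next
    assume "k = -1"
    then have "inv_into UNIV (w \<circ> w) = ?T 1"
      using inv_T[of "- 2 * pi"] by (simp add: k o_def)
    then show ?thesis using inv[OF comp[OF wH wH]] by simp
  qed
  have T: "?T j \<in> H" for j
  proof (induction j rule: int_induct[where k = 1])
    case base
    show ?case using T1 by simp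
  next
    case (step1 i)
    have "?T (i + 1) = ?T 1 \<circ> ?T i" by (auto simp: algebra_simps)
    then show ?case using comp[OF T1 step1(2)] by simp
  next
    case (step2 i)
    have "?T (i - 1) = inv_into UNIV (?T 1) \<circ> ?T i"
      using inv_T[of "2 * pi"] by (auto simp: algebra_simps)
    then show ?case using comp[OF inv[OF T1] step2(2)] by simp
  qed
  have main: "q \<in> H" if q: "q \<in> Diff3_cover" "acts_as q a b c d" "a * d - b * c = 1" "c \<noteq> 0" for q a b c d
  proof -
    \<comment> \<open>The factorization of \<open>(a, b; c, d)\<close> with \<open>c \<noteq> 0\<close> into an upper, a lower and an upper unitriangular matrix.\<close>
    define h where "h = unipotent ((a - 1) / c) \<circ> opposite_unipotent (- c) \<circ> unipotent ((d - 1) / c)"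
    have h: "h \<in> H" unfolding h_def by (intro comp n l)
    have "acts_as h (1 + (a - 1) / c * c) ((1 + (a - 1) / c * c) * ((d - 1) / c) + (a - 1) / c)
        c (c * ((d - 1) / c) + 1)"
      using acts_as_compose[OF acts_as_compose[OF unipotent(2)[of "(a - 1) / c"] opposite_unipotent(2)[of "- c"]]
        unipotent(2)[of "(d - 1) / c"]] by (simp add: h_def)
    moreover have "(1 + (a - 1) / c * c) * ((d - 1) / c) + (a - 1) / c = b"
      using q(3,4) by (simp add: field_simps)
    ultimately have "acts_as h a b c d" using q(4) by simp
    moreover have "h \<in> Diff3_cover" by (simp add: h_def Diff3_cover_compose lift_Diff3)
    ultimately obtain j :: int where "q = ?T j \<circ> h"
      using acts_as_id_shift[OF q(1) _ q(2)] by blast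
    then show ?thesis using comp[OF T h] by simp
  qed
  show ?thesis
  proof
    fix q assume "q \<in> SL2_cover"
    then obtain a b c d where q: "q \<in> Diff3_cover" "a * d - b * c = 1" "acts_as q a b c d"
      unfolding SL2_cover_iff by blast
    show "q \<in> H"
    proof (cases "c = 0")
      case False
      then show ?thesis using main q by blast
    next
      case True
      then have "d \<noteq> 0" using q(2) by auto
      have "acts_as (q \<circ> opposite_unipotent 1) (a - b) b (- d) d"
        using acts_as_compose[OF q(3) opposite_unipotent(2)[of 1]] True by simp
      then have qH: "q \<circ> opposite_unipotent 1 \<in> H"
        using q True \<open>d \<noteq> 0\<close>
        by (intro main[of _ "a - b" b "- d" d]) (simp_all add: Diff3_cover_compose lift_Diff3 algebra_simps)
      have "q = (q \<circ> opposite_unipotent 1) \<circ> inv_into UNIV (opposite_unipotent 1)"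
        using inv_into_compose(2)[OF lift_Diff3(4)[of 1]] by (metis comp_assoc comp_id)
      then show ?thesis using comp[OF qH inv[OF l[of 1]]] by simp
    qed
  qed
qed

text \<open>The lifts fixing \<open>0\<close> form a two-parameter family, which realizes every orientation preserving 2-jet there.  The third derivative is then
  determined by the vanishing of the projective Schwarzian derivative, which characterizes projective maps.\<close>

lemma SL2_cover_jet_exists:
  fixes \<mu> \<nu> :: real
  assumes "\<mu> > 0"
  obtains k where "k \<in> SL2_cover" "k 0 = 0" "deriv k 0 = \<mu>" "D2 k 0 = \<nu>"
    "D3 k 0 / \<mu> - 3 / 2 * (\<nu> / \<mu>)\<^sup>2 + (\<mu>\<^sup>2 - 1) / 2 = 0"
proof -
  \<comment> \<open>These values solve \<open>D(0) = 1 / \<mu>\<close> and \<open>D'(0) = - \<nu> / \<mu>\<^sup>2\<close> for \<open>D = a + \<beta> cos \<phi> + \<gamma> sin \<phi>\<close> with \<open>a\<^sup>2 = 1 + \<beta>\<^sup>2 + \<gamma>\<^sup>2\<close>.\<close>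
  define \<gamma> where "\<gamma> = - \<nu> / \<mu>\<^sup>2"
  define \<beta> where "\<beta> = (1 / \<mu> - \<mu> * (1 + \<gamma>\<^sup>2)) / 2"
  define a where "a = (1 / \<mu> + \<mu> * (1 + \<gamma>\<^sup>2)) / 2"
  have alpha: "polar_alpha \<beta> \<gamma> = a"
  proof (rule polar_alpha_eqI)
    show "a \<ge> 0" using assms by (simp add: a_def)
    have "a\<^sup>2 - \<beta>\<^sup>2 = (a - \<beta>) * (a + \<beta>)" by algebra
    also have "\<dots> = \<mu> * (1 + \<gamma>\<^sup>2) * (1 / \<mu>)"
      by (rule arg_cong2[where f = "(*)"]) (simp_all add: a_def \<beta>_def diff_divide_distrib add_divide_distrib)
    also have "\<dots> = 1 + \<gamma>\<^sup>2" using assms by simp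
    finally show "a\<^sup>2 = 1 + \<beta>\<^sup>2 + \<gamma>\<^sup>2" by simp
  qed
  define c where "c = - polar \<beta> \<gamma> 0"
  define k where "k = (\<lambda>x. x + c) \<circ> polar \<beta> \<gamma>"
  have "C3_jet (\<lambda>_. c) (\<lambda>_. 0) (\<lambda>_. 0) (\<lambda>_. 0)" by (simp add: C3_jet_def)
  from C3_jet_add[OF C3_jet_polar this]
  have jet: "C3_jet k (\<lambda>\<phi>. 1 / polar_denom \<beta> \<gamma> \<phi>)
    (\<lambda>\<phi>. - polar_slope \<beta> \<gamma> \<phi> / (polar_denom \<beta> \<gamma> \<phi>)\<^sup>2)
    (\<lambda>\<phi>. (polar_denom \<beta> \<gamma> \<phi> - polar_alpha \<beta> \<gamma>) / (polar_denom \<beta> \<gamma> \<phi>)\<^sup>2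
        + 2 * (polar_slope \<beta> \<gamma> \<phi>)\<^sup>2 / polar_denom \<beta> \<gamma> \<phi> ^ 3)"
    by (simp add: k_def o_def)
  have "a + \<beta> = 1 / \<mu>" by (simp add: a_def \<beta>_def diff_divide_distrib add_divide_distrib)
  then have D: "polar_denom \<beta> \<gamma> 0 = 1 / \<mu>" by (simp add: polar_denom_def alpha)
  have N: "polar_slope \<beta> \<gamma> 0 = \<gamma>" by (simp add: polar_slope_def)
  show ?thesis
  proof
    show "k \<in> SL2_cover" unfolding k_def by (intro SL2_cover_compose SL2_cover_translation polar_SL2_cover)
    show "k 0 = 0" by (simp add: k_def c_def)
    show "deriv k 0 = \<mu>" by (simp add: C3_jetD(5)[OF jet] D)
    have "D2 k 0 = - \<gamma> * \<mu>\<^sup>2" by (simp add: C3_jetD(5,6)[OF jet] D N power_divide)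
    then show "D2 k 0 = \<nu>" using assms by (simp add: \<gamma>_def)
    have "D3 k 0 = (1 / \<mu> - a) * \<mu>\<^sup>2 + 2 * \<gamma>\<^sup>2 * \<mu> ^ 3"
      using assms by (simp only: C3_jetD(5-7)[OF jet] D N alpha) (simp add: power_divide)
    then have "D3 k 0 / \<mu> = 1 - a * \<mu> + 2 * (\<gamma>\<^sup>2 * \<mu>\<^sup>2)"
      using assms
      by (simp add: add_divide_distrib diff_divide_distrib left_diff_distrib power2_eq_square power3_eq_cube)
    moreover have "a * \<mu> = (1 + \<mu>\<^sup>2 + \<gamma>\<^sup>2 * \<mu>\<^sup>2) / 2"
      using assms by (simp add: a_def field_simps power2_eq_square)
    moreover have "(\<nu> / \<mu>)\<^sup>2 = \<gamma>\<^sup>2 * \<mu>\<^sup>2"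
      using assms by (simp add: \<gamma>_def field_simps power2_eq_square)
    ultimately show "D3 k 0 / \<mu> - 3 / 2 * (\<nu> / \<mu>)\<^sup>2 + (\<mu>\<^sup>2 - 1) / 2 = 0"
      by (simp only:) (simp add: field_simps)
  qed
qed

section \<open>Limits of unipotent and of hyperbolic elements\<close>

lemma bounded_uniform_limit_scalar:
  assumes "(c \<longlongrightarrow> l) F" shows "bounded_uniform_limit (\<lambda>x _. c x) (\<lambda>_. l) F"
  using assms by (auto simp: bounded_uniform_limit_def uniform_limit_iff tendsto_iff)

lemma bounded_uniform_limit_self: "bounded (range f) \<Longrightarrow> bounded_uniform_limit (\<lambda>_. f) f F"
  by (simp add: bounded_uniform_limit_def uniform_limit_iff)

lemma abs_arctan_le: "\<bar>arctan x\<bar> \<le> \<bar>x\<bar>"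
proof -
  have "arctan y \<le> y" if "y \<ge> 0" for y
  proof -
    show ?thesis
    proof (cases "y = 0")
      case False
      then have "0 < y" using that by simp
      then have "\<exists>z. 0 < z \<and> z < y \<and> arctan y - arctan 0 = (y - 0) * (1 / (1 + z\<^sup>2))"
        by (intro MVT2) (auto intro!: derivative_eq_intros simp: divide_inverse)
      then obtain z where "arctan y = y * (1 / (1 + z\<^sup>2))" by auto
      also have "\<dots> \<le> y * 1" using that by (intro mult_left_mono) (simp_all add: add_pos_nonneg)
      finally show ?thesis by simp
    qed simp
  qed
  from this[of x] this[of "- x"] show ?thesis by (cases "x \<ge> 0") (auto simp: arctan_minus)
qed

lemma limitin_unipotent:
  assumes t: "(t \<longlongrightarrow> 0) F"
  shows "limitin C3_topology (\<lambda>x. unipotent (t x)) id F"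
proof -
  define D where "D x = polar_denom ((t x)\<^sup>2 / 2) (t x)" for x
  define N where "N x = polar_slope ((t x)\<^sup>2 / 2) (t x)" for x
  define a where "a x = polar_alpha ((t x)\<^sup>2 / 2) (t x)" for x
  have bnd: "bounded (range (sin :: real \<Rightarrow> real))" "bounded (range (cos :: real \<Rightarrow> real))"
    by (auto simp: bounded_iff intro: exI[of _ 1])
  note cs = bounded_uniform_limit_self[OF bnd(1)] bounded_uniform_limit_self[OF bnd(2)]
  have t2: "((\<lambda>x. (t x)\<^sup>2 / 2) \<longlongrightarrow> 0) F" using tendsto_divide[OF tendsto_power[OF t, of 2] tendsto_const[of 2]] by simp
  have "(a \<longlongrightarrow> 1) F"
    using tendsto_add[OF tendsto_const[of 1] t2] by (simp add: a_def[abs_def] polar_alpha_unipotent)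
  then have a: "bounded_uniform_limit (\<lambda>x _. a x) (\<lambda>_. 1) F" by (rule bounded_uniform_limit_scalar)
  have D: "bounded_uniform_limit D (\<lambda>_. 1) F"
    using bounded_uniform_limit_add[OF bounded_uniform_limit_add[OF a
      bounded_uniform_limit_mult[OF bounded_uniform_limit_scalar[OF t2] cs(2)]]
      bounded_uniform_limit_mult[OF bounded_uniform_limit_scalar[OF t] cs(1)]]
    by (simp add: D_def[abs_def] polar_denom_def[abs_def] a_def)
  have N: "bounded_uniform_limit N (\<lambda>_. 0) F"
    using bounded_uniform_limit_diff[OF
      bounded_uniform_limit_mult[OF bounded_uniform_limit_scalar[OF t] cs(2)]
      bounded_uniform_limit_mult[OF bounded_uniform_limit_scalar[OF t2] cs(1)]]
    by (simp add: N_def[abs_def] polar_slope_def[abs_def])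
  have jet: "C3_jet (unipotent (t x)) (\<lambda>\<phi>. 1 / D x \<phi>) (\<lambda>\<phi>. (0 - N x \<phi>) / (D x \<phi>)\<^sup>2)
      (\<lambda>\<phi>. (D x \<phi> - a x) / (D x \<phi>)\<^sup>2 + 2 * (N x \<phi>)\<^sup>2 / D x \<phi> ^ 3)" for x
  proof -
    have "C3_jet (\<lambda>_. 2 * arctan (t x / 2)) (\<lambda>_. 0) (\<lambda>_. 0) (\<lambda>_. 0)" by (simp add: C3_jet_def)
    from C3_jet_add[OF C3_jet_polar this] show ?thesis
      by (simp add: unipotent_def[abs_def] D_def N_def a_def)
  qed
  have E: "bounded_uniform_limit (\<lambda>x \<phi>. N x \<phi> / (1 + D x \<phi>)) (\<lambda>_. 0) F"
    using bounded_uniform_limit_divide[OF N bounded_uniform_limit_add[OF bounded_uniform_limit_const[of 1] D], of 1]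
    by simp
  have u: "uniform_limit UNIV (\<lambda>x. unipotent (t x)) id F"
  proof (rule uniform_limitI)
    fix e :: real assume e: "e > 0"
    have "\<forall>\<^sub>F x in F. \<bar>t x\<bar> < e / 2" using tendstoD[OF t, of "e / 2"] e by simp
    moreover have "\<forall>\<^sub>F x in F. \<forall>\<phi>\<in>UNIV. dist (N x \<phi> / (1 + D x \<phi>)) 0 < e / 4"
    proof -
      have "uniform_limit UNIV (\<lambda>x \<phi>. N x \<phi> / (1 + D x \<phi>)) (\<lambda>_. 0) F"
        using E by (simp add: bounded_uniform_limit_def)
      from uniform_limitD[OF this, of "e / 4"] e show ?thesis by simp
    qed
    ultimately show "\<forall>\<^sub>F x in F. \<forall>\<phi>\<in>UNIV. dist (unipotent (t x) \<phi>) (id \<phi>) < e"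
    proof eventually_elim
      case (elim x)
      show ?case
      proof
        fix \<phi>
        have "\<bar>N x \<phi> / (1 + D x \<phi>)\<bar> < e / 4" using elim(2) by (simp add: dist_real_def)
        then show "dist (unipotent (t x) \<phi>) (id \<phi>) < e"
          using abs_arctan_le[of "t x / 2"] abs_arctan_le[of "N x \<phi> / (1 + D x \<phi>)"] elim(1)
          unfolding dist_real_def unipotent_def polar_def id_def D_def N_def by linarith
      qed
    qed
  qed
  have bul: "bounded_uniform_limit P r F \<Longrightarrow> uniform_limit UNIV P r F" for P r
    by (simp add: bounded_uniform_limit_def)
  note pow = bounded_uniform_limit_power[OF D, of 2, simplified] bounded_uniform_limit_power[OF D, of 3, simplified]
  have 1: "uniform_limit UNIV (\<lambda>x \<phi>. 1 / D x \<phi>) (\<lambda>_. 1) F"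
    using bounded_uniform_limit_divide[OF bounded_uniform_limit_const[of 1] D, of 1] by (simp add: bul)
  have 2: "uniform_limit UNIV (\<lambda>x \<phi>. (0 - N x \<phi>) / (D x \<phi>)\<^sup>2) (\<lambda>_. 0) F"
    using bul[OF bounded_uniform_limit_divide[OF bounded_uniform_limit_diff[OF bounded_uniform_limit_const[of 0] N]
        pow(1), of 1]] by simp
  have 3: "uniform_limit UNIV (\<lambda>x \<phi>. (D x \<phi> - a x) / (D x \<phi>)\<^sup>2 + 2 * (N x \<phi>)\<^sup>2 / D x \<phi> ^ 3) (\<lambda>_. 0) F"
    using bul[OF bounded_uniform_limit_add[OF bounded_uniform_limit_divide[OF bounded_uniform_limit_diff[OF D a] pow(1), of 1]
      bounded_uniform_limit_divide[OF bounded_uniform_limit_mult[OF bounded_uniform_limit_const[of 2]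
        bounded_uniform_limit_power[OF N, of 2]] pow(2), of 1]]] by simp
  show ?thesis
  proof (rule limitin_C3_topologyI[OF Diff3_cover_id _ _ u 1 2 3])
    show "C3_jet id (\<lambda>_. 1) (\<lambda>_. 0) (\<lambda>_. 0)" using C3_jet_translation[of 0] by (simp add: id_def)
  qed (intro always_eventually allI conjI lift_Diff3 jet)
qed

lemma limitin_opposite_unipotent:
  assumes t: "(t \<longlongrightarrow> 0) F"
  shows "limitin C3_topology (\<lambda>x. opposite_unipotent (t x)) id F"
proof -
  have "limitin C3_topology (\<lambda>x. (\<lambda>x. x + pi) \<circ> unipotent (t x) \<circ> (\<lambda>x. x + (- pi)))
      ((\<lambda>x. x + pi) \<circ> id \<circ> (\<lambda>x. x + (- pi))) F"
    by (intro limitin_C3_compose limitin_unipotent t)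
      (simp_all only: Abstract_Limits.limitin_const_iff topspace_C3_topology Diff3_cover_translation)
  moreover have "(\<lambda>x. x + pi) \<circ> id \<circ> (\<lambda>x. x + (- pi)) = id" by auto
  ultimately show ?thesis by (simp only: opposite_unipotent_def)
qed

text \<open>In the coordinate \<open>tan (x / 2)\<close> the contraction is division by 2.\<close>

lemma contraction_pow_tendsto:
  assumes "- pi < x" "x < pi"
  shows "(\<lambda>n. (contraction ^^ n) x) \<longlonglongrightarrow> 0"
proof -
  have eq: "(contraction ^^ n) x = 2 * arctan (tan (x / 2) * (1 / 2) ^ n)" for n
  proof -
    define y where "y = (contraction ^^ n) x"
    note c = Diff3_coverD(3,4)[OF lift_Diff3(2)[of n]]
    have "(contraction ^^ n) (- pi) = - pi" using c(1)[of "- pi"] contraction_pow(4)[of n] by simp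
    then have y: "- pi < y" "y < pi"
      using strict_monoD[OF c(2), of "- pi" x] strict_monoD[OF c(2), of x pi] assms contraction_pow(4)[of n]
      by (simp_all add: y_def)
    obtain r where r: "r \<noteq> 0" "sin (y / 2) = r * sin (x / 2)" "cos (y / 2) = r * (2 ^ n * cos (x / 2))"
      using contraction_pow(2)[of n] unfolding acts_as_def y_def by auto
    have "cos (x / 2) > 0" using assms by (intro cos_gt_zero_pi) auto
    then have "tan (y / 2) = tan (x / 2) * (1 / 2) ^ n"
      unfolding tan_def r using r(1) by (simp add: field_simps power_one_over)
    moreover have "arctan (tan (y / 2)) = y / 2" using y by (intro arctan_tan) auto
    ultimately show ?thesis by (simp add: y_def)
  qed
  have "(\<lambda>n. 2 * arctan (tan (x / 2) * (1 / 2) ^ n)) \<longlonglongrightarrow> 2 * arctan (tan (x / 2) * 0)"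
    by (intro tendsto_intros LIMSEQ_realpow_zero) auto
  then show ?thesis by (simp add: eq)
qed

lemma contraction_pow_uniform:
  assumes d: "d > 0" and e: "e > 0"
  obtains N where "\<And>n x. n \<ge> N \<Longrightarrow> \<bar>x\<bar> \<le> pi - d \<Longrightarrow> \<bar>(contraction ^^ n) x\<bar> < e"
proof (cases "d \<le> pi")
  case True
  define z where "z = pi - d"
  have z: "- pi < z" "z < pi" "- pi < - z" "- z < pi" using d True pi_gt_zero by (auto simp: z_def)
  obtain N1 where N1: "\<And>n. n \<ge> N1 \<Longrightarrow> \<bar>(contraction ^^ n) z\<bar> < e"
    using LIMSEQ_D[OF contraction_pow_tendsto[OF z(1,2)] e] by auto
  obtain N2 where N2: "\<And>n. n \<ge> N2 \<Longrightarrow> \<bar>(contraction ^^ n) (- z)\<bar> < e"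
    using LIMSEQ_D[OF contraction_pow_tendsto[OF z(3,4)] e] by auto
  show ?thesis
  proof (rule that)
    fix n and x :: real assume n: "n \<ge> max N1 N2" and x: "\<bar>x\<bar> \<le> pi - d"
    have mono: "mono (contraction ^^ n)"
      using Diff3_coverD(4)[OF lift_Diff3(2)] by (rule strict_mono_mono)
    have "(contraction ^^ n) (- z) \<le> (contraction ^^ n) x" "(contraction ^^ n) x \<le> (contraction ^^ n) z"
      using x by (intro monoD[OF mono]; simp add: z_def)+
    then show "\<bar>(contraction ^^ n) x\<bar> < e" using N1[of n] N2[of n] n by auto
  qed
next
  case False
  then show ?thesis by (intro that[of 0]) auto
qed

section \<open>Elements with disjoint supports commute\<close>

text \<open>At each point one of the two factors is the identity nearby, so the integrand of the Bott cocycle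
  vanishes there.\<close>

lemma disjoint_support_commute:
  assumes p: "p \<in> Diff3_cover" and q: "q \<in> Diff3_cover"
    and U: "open U" "\<And>x. x \<in> U \<Longrightarrow> p x = x" and W: "open W" "\<And>x. x \<in> W \<Longrightarrow> q x = x"
    and cover: "U \<union> W = UNIV"
  shows "p \<circ> q = q \<circ> p" "bott_cocycle p q = 0"
proof -
  have stay: "q x \<in> U" if "x \<in> U" for x
  proof (rule ccontr)
    assume "q x \<notin> U"
    then have "q x \<in> W" using cover by blast
    then have "q (q x) = q x" by (rule W(2))
    then have "q x = x" using Diff3_coverD(9)[OF q] by (simp add: inj_eq)
    with that \<open>q x \<notin> U\<close> show False by simp
  qed
  have stay': "p x \<in> W" if "x \<in> W" for x
  proof (rule ccontr)
    assume "p x \<notin> W"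
    then have "p x \<in> U" using cover by blast
    then have "p (p x) = p x" by (rule U(2))
    then have "p x = x" using Diff3_coverD(9)[OF p] by (simp add: inj_eq)
    with that \<open>p x \<notin> W\<close> show False by simp
  qed
  show "p \<circ> q = q \<circ> p"
  proof
    fix x
    have "x \<in> U \<or> x \<in> W" using cover by blast
    then show "(p \<circ> q) x = (q \<circ> p) x"
      using U(2) W(2) stay stay' by auto
  qed
  have deriv1: "deriv f x = 1" if "open S" "\<And>x. x \<in> S \<Longrightarrow> f x = x" "x \<in> S" for f :: "real \<Rightarrow> real" and S x
    by (rule DERIV_imp_deriv, rule has_field_derivative_transform_within_open[OF DERIV_ident that(1,3)])
       (simp add: that(2))
  have "ln (deriv p (q x)) * (D2 q x / deriv q x) = 0" for x
  proof (cases "x \<in> U")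
    case True
    then show ?thesis using deriv1[OF U] stay by simp
  next
    case False
    then have x: "x \<in> W" using cover by blast
    have "D2 q x = 0"
      by (rule DERIV_imp_deriv, rule has_field_derivative_transform_within_open[OF DERIV_const W(1) x])
         (simp add: deriv1[OF W])
    then show ?thesis by simp
  qed
  then show "bott_cocycle p q = 0" by (simp only: bott_cocycle_eq[OF p q] integral_0)
qed

definition identity_near :: "real \<Rightarrow> (real \<Rightarrow> real) \<Rightarrow> bool"
  where "identity_near x0 q \<longleftrightarrow> (\<exists>e>0. \<forall>x. \<bar>x - x0\<bar> < e \<longrightarrow> q x = x)"

text \<open>The contraction pulls the support of \<open>h\<close>, which avoids a neighbourhood of \<open>\<pi>\<close>, into the
  neighbourhood of \<open>0\<close> where \<open>g\<close> is the identity.\<close>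

lemma contraction_conjugate_commute:
  assumes g: "g \<in> Diff3_cover" "identity_near 0 g" and h: "h \<in> Diff3_cover" "identity_near pi h"
  obtains N where "\<And>n. n \<ge> N \<Longrightarrow>
    g \<circ> ((contraction ^^ n) \<circ> h \<circ> inv_into UNIV (contraction ^^ n))
      = ((contraction ^^ n) \<circ> h \<circ> inv_into UNIV (contraction ^^ n)) \<circ> g \<and>
    bott_cocycle g ((contraction ^^ n) \<circ> h \<circ> inv_into UNIV (contraction ^^ n)) = 0 \<and>
    bott_cocycle ((contraction ^^ n) \<circ> h \<circ> inv_into UNIV (contraction ^^ n)) g = 0"
proof -
  obtain e where e: "e > 0" "\<And>x. \<bar>x - 0\<bar> < e \<Longrightarrow> g x = x" using g(2) unfolding identity_near_def by blast
  obtain d where d: "d > 0" "\<And>x. \<bar>x - pi\<bar> < d \<Longrightarrow> h x = x" using h(2) unfolding identity_near_def by blast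
  obtain N where N: "\<And>n x. n \<ge> N \<Longrightarrow> \<bar>x\<bar> \<le> pi - d \<Longrightarrow> \<bar>(contraction ^^ n) x\<bar> < e"
    by (rule contraction_pow_uniform[OF d(1) e(1)]) blast
  let ?T = "\<lambda>(k::int) x. x + 2 * pi * of_int k"
  have shift: "q (?T k x) = ?T k (q x)" if "q \<in> Diff3_cover" for q k x
    using quasiperiodic_shift_int[of q "2 * pi" x k] Diff3_coverD(3)[OF that] by simp
  define U where "U = (\<Union>k. {x. \<bar>?T k x\<bar> < e})"
  define V where "V = (\<Union>k. {x. \<bar>?T k x - pi\<bar> < d})"
  have opens: "open U" "open V"
    unfolding U_def V_def by (intro open_UN ballI open_Collect_less continuous_intros)+
  have gU: "g x = x" if "x \<in> U" for x
  proof -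
    obtain k where "\<bar>?T k x\<bar> < e" using \<open>x \<in> U\<close> by (auto simp: U_def)
    then have "g (?T k x) = ?T k x" using e(2) by simp
    then show ?thesis by (simp add: shift[OF g(1)])
  qed
  have hV: "h x = x" if "x \<in> V" for x
  proof -
    obtain k where "\<bar>?T k x - pi\<bar> < d" using \<open>x \<in> V\<close> by (auto simp: V_def)
    then have "h (?T k x) = ?T k x" using d(2) by simp
    then show ?thesis by (simp add: shift[OF h(1)])
  qed
  show ?thesis
  proof (rule that)
    fix n assume n: "n \<ge> N"
    define a where "a = contraction ^^ n"
    define b where "b = inv_into UNIV a"
    have a: "a \<in> Diff3_cover" unfolding a_def by (rule lift_Diff3)
    have b: "b \<in> Diff3_cover" unfolding b_def by (rule Diff3_cover_inverse[OF a])
    have ab: "a (b x) = x" "b (a x) = x" for x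
      using inv_into_compose[OF a] by (simp_all add: b_def fun_eq_iff)
    define h' where "h' = a \<circ> h \<circ> b"
    have h': "h' \<in> Diff3_cover" unfolding h'_def by (intro Diff3_cover_compose a b h)
    have "open (b -` V)"
      using C3_jetD(8)[OF Diff3_coverD(1)[OF b]] opens(2) by (simp add: continuous_on_open_vimage)
    moreover have "h' x = x" if "x \<in> b -` V" for x
      using that hV[of "b x"] by (simp add: h'_def ab)
    moreover have "U \<union> (b -` V) = UNIV"
    proof -
      have "x \<in> U" if x: "x \<notin> b -` V" for x
      proof -
        obtain k where k: "- pi \<le> ?T k (b x)" "?T k (b x) < - pi + 2 * pi" by (rule real_mod_period)
        let ?y = "?T k (b x)"
        have far: "\<not> \<bar>?T j (b x) - pi\<bar> < d" for j using x by (auto simp: V_def)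
        have "?T (k + 1) (b x) = ?y + 2 * pi" by (simp add: algebra_simps)
        then have "\<bar>?y\<bar> \<le> pi - d" using far[of k] far[of "k + 1"] k by (auto simp: abs_le_iff abs_less_iff)
        then have "\<bar>a ?y\<bar> < e" unfolding a_def by (rule N[OF n])
        then have "\<bar>?T k x\<bar> < e" by (simp add: shift[OF a] ab)
        then show ?thesis by (auto simp: U_def)
      qed
      then show ?thesis by blast
    qed
    moreover from this have "(b -` V) \<union> U = UNIV" by blast
    ultimately show "g \<circ> ((contraction ^^ n) \<circ> h \<circ> inv_into UNIV (contraction ^^ n))
      = ((contraction ^^ n) \<circ> h \<circ> inv_into UNIV (contraction ^^ n)) \<circ> g \<and>
    bott_cocycle g ((contraction ^^ n) \<circ> h \<circ> inv_into UNIV (contraction ^^ n)) = 0 \<and>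
    bott_cocycle ((contraction ^^ n) \<circ> h \<circ> inv_into UNIV (contraction ^^ n)) g = 0"
      unfolding a_def[symmetric] b_def[symmetric] h'_def[symmetric]
      using disjoint_support_commute[OF g(1) h' opens(1) gU, of "b -` V"]
        disjoint_support_commute(2)[OF h' g(1), of "b -` V" U] opens(1) gU by blast
  qed
qed

section \<open>A projectively flat point\<close>

text \<open>The functions \<open>y = (q')\<^sup>-\<^sup>1\<^sup>/\<^sup>2 sin ((q - q(0)) / 2)\<close> and \<open>z = sin (x / 2)\<close> solve \<open>y'' = - (1/4 + S/2) y\<close> and
  \<open>z'' = - z / 4\<close>, where \<open>S\<close> is the projective Schwarzian derivative of \<open>q\<close>.  Both vanish at \<open>0\<close> and at
  \<open>2 \<pi>\<close>, hence so does their Wronskian, whose derivative is \<open>S y z / 2\<close>.  Since \<open>y\<close> and \<open>z\<close> have no zero in between,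
  Rolle's theorem gives a zero of \<open>S\<close>.\<close>

theorem projective_Schwarzian_zero:
  assumes q: "q \<in> Diff3_cover"
  obtains x where
    "D3 q x / deriv q x - 3 / 2 * (D2 q x / deriv q x)\<^sup>2 + ((deriv q x)\<^sup>2 - 1) / 2 = 0"
proof -
  note Q = Diff3_coverD[OF q]
  define e where "e x = 1 / sqrt (deriv q x)" for x
  have e: "e x > 0" "e x * e x * deriv q x = 1" for x
    using Q(2)[of x] by (simp_all add: e_def)
  define s where "s x = sin ((q x - q 0) / 2)" for x
  define c where "c x = cos ((q x - q 0) / 2)" for x
  define W where "W x = e x * s x * (cos (x / 2) / 2)
    - (- (1/2) * e x ^ 3 * D2 q x * s x + (1/2) * e x * deriv q x * c x) * sin (x / 2)" for x
  define S where "S x = D3 q x / deriv q x - 3 / 2 * (D2 q x / deriv q x)\<^sup>2 + ((deriv q x)\<^sup>2 - 1) / 2" for x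
  have de: "(e has_real_derivative - (1/2) * e x ^ 3 * D2 q x) (at x)" for x
  proof -
    have "(e has_real_derivative - (D2 q x / (2 * sqrt (deriv q x))) / (sqrt (deriv q x) * sqrt (deriv q x))) (at x)"
      unfolding e_def[abs_def] using Q(2)[of x]
      by (auto intro!: derivative_eq_intros C3_jetD(2)[OF Q(1)] simp: field_simps)
    moreover have "- (D2 q x / (2 * sqrt (deriv q x))) / (sqrt (deriv q x) * sqrt (deriv q x)) = - (1/2) * e x ^ 3 * D2 q x"
      by (simp add: e_def power3_eq_cube)
    ultimately show ?thesis by (simp only:)
  qed
  have ds: "(s has_real_derivative c x * deriv q x / 2) (at x)" for x
    unfolding s_def[abs_def] c_def by (auto intro!: derivative_eq_intros C3_jetD(1)[OF Q(1)])
  have dc: "(c has_real_derivative - s x * deriv q x / 2) (at x)" for x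
    unfolding c_def[abs_def] s_def by (auto intro!: derivative_eq_intros C3_jetD(1)[OF Q(1)])
  have dW: "(W has_real_derivative S x / 2 * (e x * s x) * sin (x / 2)) (at x)" for x
  proof -
    define E where "E = e x"
    define z where "z = sin (x / 2)"
    define w where "w = cos (x / 2)"
    define q1 q2 q3 where qs: "q1 = deriv q x" "q2 = D2 q x" "q3 = D3 q x"
    have E1: "E * E * q1 = 1" using e(2)[of x] by (simp add: E_def qs)
    have "q1 \<noteq> 0" using E1 by auto
    then have q1: "1 / q1 = E * E" using E1 by (simp add: divide_eq_eq)
    have Sx: "S x = q3 * (E * E) - 3 / 2 * (q2 * (E * E))\<^sup>2 + (q1\<^sup>2 - 1) / 2"
      unfolding S_def qs[symmetric] q1[symmetric] by simp
    have "(W has_real_derivative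
        ((- (1/2) * E ^ 3 * q2) * s x + E * (c x * q1 / 2)) * (w / 2) + E * s x * (- z / 4)
        - ((- (1/2) * (3 * E\<^sup>2 * (- (1/2) * E ^ 3 * q2)) * q2 * s x - (1/2) * E ^ 3 * q3 * s x
            - (1/2) * E ^ 3 * q2 * (c x * q1 / 2)
            + (1/2) * (- (1/2) * E ^ 3 * q2) * q1 * c x + (1/2) * E * q2 * c x
            + (1/2) * E * q1 * (- s x * q1 / 2)) * z
          + (- (1/2) * E ^ 3 * q2 * s x + (1/2) * E * q1 * c x) * (w / 2))) (at x)"
      unfolding W_def[abs_def] E_def z_def w_def qs
      by (rule derivative_eq_intros de ds dc C3_jetD(2,3)[OF Q(1)] refl | (simp; fail))+
        (simp add: field_simps eval_nat_numeral)
    moreover have "((- (1/2) * E ^ 3 * q2) * s x + E * (c x * q1 / 2)) * (w / 2) + E * s x * (- z / 4)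
        - ((- (1/2) * (3 * E\<^sup>2 * (- (1/2) * E ^ 3 * q2)) * q2 * s x - (1/2) * E ^ 3 * q3 * s x
            - (1/2) * E ^ 3 * q2 * (c x * q1 / 2)
            + (1/2) * (- (1/2) * E ^ 3 * q2) * q1 * c x + (1/2) * E * q2 * c x
            + (1/2) * E * q1 * (- s x * q1 / 2)) * z
          + (- (1/2) * E ^ 3 * q2 * s x + (1/2) * E * q1 * c x) * (w / 2))
        = S x / 2 * (E * s x) * z"
    proof -
      have "E ^ 3 * q2 * q1 = E * q2" using E1 by algebra
      then show ?thesis unfolding Sx by (simp add: field_simps) algebra
    qed
    ultimately have "(W has_real_derivative S x / 2 * (E * s x) * z) (at x)" by (simp only:)
    then show ?thesis by (simp only: E_def z_def)
  qed
  have "W 0 = 0" by (simp add: W_def s_def)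
  moreover have "W (2 * pi) = 0"
    using Q(3)[of 0] by (simp add: W_def s_def)
  ultimately obtain x where x: "0 < x" "x < 2 * pi" "S x / 2 * (e x * s x) * sin (x / 2) = 0"
  proof -
    have "\<exists>z. 0 < z \<and> z < 2 * pi \<and> W (2 * pi) - W 0 = (2 * pi - 0) * (S z / 2 * (e z * s z) * sin (z / 2))"
      using dW by (intro MVT2) auto
    with \<open>W 0 = 0\<close> \<open>W (2 * pi) = 0\<close> show ?thesis using that by auto
  qed
  have "sin (x / 2) > 0" using x by (intro sin_gt_zero) auto
  moreover have "s x > 0"
  proof -
    have "q 0 < q x" "q x < q 0 + 2 * pi"
      using strict_monoD[OF Q(4), of 0 x] strict_monoD[OF Q(4), of x "2 * pi"] x Q(3)[of 0] by simp_all
    then show ?thesis unfolding s_def by (intro sin_gt_zero) auto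
  qed
  ultimately have "S x = 0" using x(3) e(1)[of x] by simp
  then show ?thesis using that by (simp add: S_def)
qed

section \<open>Flattening a diffeomorphism near a point of third-order contact with the identity\<close>

lemma DERIV_positive_part_power:
  "((\<lambda>y::real. (max 0 y) ^ Suc (Suc n)) has_real_derivative real (Suc (Suc n)) * (max 0 x) ^ Suc n) (at x)"
proof -
  consider "x > 0" | "x < 0" | "x = 0" by linarith
  then show ?thesis
  proof cases
    case 1
    have "((\<lambda>y. y ^ Suc (Suc n)) has_real_derivative real (Suc (Suc n)) * x ^ Suc n) (at x)"
      using DERIV_pow[of "Suc (Suc n)" x] by simp
    then have "((\<lambda>y. (max 0 y) ^ Suc (Suc n)) has_real_derivative real (Suc (Suc n)) * x ^ Suc n) (at x)"
      by (rule has_field_derivative_transform_within_open[where S = "{0<..}"]) (use 1 in simp_all)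
    moreover have "max 0 x = x" using 1 by simp
    ultimately show ?thesis by (simp only:)
  next
    case 2
    have "((\<lambda>y. (max 0 y) ^ Suc (Suc n)) has_real_derivative 0) (at x)"
      by (rule has_field_derivative_transform_within_open[OF DERIV_const, where S = "{..<0}"]) (use 2 in simp_all)
    then show ?thesis using 2 by simp
  next
    case 3
    have "((\<lambda>y. (max 0 y) ^ Suc (Suc n)) has_real_derivative 0) (at (0::real))"
      unfolding CARAT_DERIV
      by (intro exI[of _ "\<lambda>y. (max 0 y) ^ Suc n"] conjI allI continuous_intros) (simp_all add: max_def)
    then show ?thesis using 3 by simp
  qed
qed

lemma C3_jet_positive_part: 
  "C3_jet (\<lambda>y. (max 0 y) ^ 4) (\<lambda>y. 4 * (max 0 y) ^ 3) (\<lambda>y. 12 * (max 0 y) ^ 2) (\<lambda>y. 24 * max 0 y)"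
proof -
  have 1: "((\<lambda>y::real. (max 0 y) ^ 4) has_real_derivative 4 * (max 0 x) ^ 3) (at x)" for x
    using DERIV_positive_part_power[of 2 x] by (simp add: eval_nat_numeral)
  have 2: "((\<lambda>y::real. (max 0 y) ^ 3) has_real_derivative 3 * (max 0 x) ^ 2) (at x)" for x
    using DERIV_positive_part_power[of 1 x] by (simp add: eval_nat_numeral)
  have 3: "((\<lambda>y::real. (max 0 y) ^ 2) has_real_derivative 2 * max 0 x) (at x)" for x
    using DERIV_positive_part_power[of 0 x] by (simp add: eval_nat_numeral)
  show ?thesis
    unfolding C3_jet_def
    using 1 DERIV_cmult[OF 2, of 4] DERIV_cmult[OF 3, of 12]
    by (auto intro!: continuous_intros)
qed

text \<open>Iterating the fourth power of the positive part avoids quotients: the step is \<open>(1 - (1 - y)\<^sub>+\<^sup>4)\<^sub>+\<^sup>4\<close>, where the subscript denotes the positive part.\<close>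

lemma smooth_step_exists:
  obtains \<psi> \<psi>1 \<psi>2 \<psi>3 :: "real \<Rightarrow> real" and M
  where "C3_jet \<psi> \<psi>1 \<psi>2 \<psi>3" "\<And>y. y \<le> 0 \<Longrightarrow> \<psi> y = 0"
    "\<And>y. y \<ge> 1 \<Longrightarrow> \<psi> y = 1 \<and> \<psi>1 y = 0 \<and> \<psi>2 y = 0 \<and> \<psi>3 y = 0"
    "M \<ge> 1" "\<And>y. \<bar>\<psi> y - 1\<bar> \<le> M \<and> \<bar>\<psi>1 y\<bar> \<le> M \<and> \<bar>\<psi>2 y\<bar> \<le> M \<and> \<bar>\<psi>3 y\<bar> \<le> M"
proof -
  let ?p = "\<lambda>y::real. (max 0 y) ^ 4" and ?p1 = "\<lambda>y::real. 4 * (max 0 y) ^ 3"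
    and ?p2 = "\<lambda>y::real. 12 * (max 0 y) ^ 2" and ?p3 = "\<lambda>y::real. 24 * max 0 y"
  have lin: "C3_jet (\<lambda>y. 1 - y) (\<lambda>_. -1) (\<lambda>_. 0) (\<lambda>_. 0)"
    unfolding C3_jet_def by (auto intro!: derivative_eq_intros)
  define u where "u y = 1 - ?p (1 - y)" for y
  have "C3_jet (\<lambda>y. 1 - ?p (1 - y)) (\<lambda>y. ?p1 (1 - y)) (\<lambda>y. - ?p2 (1 - y)) (\<lambda>y. ?p3 (1 - y))"
    using C3_jet_compose[OF lin C3_jet_compose[OF C3_jet_positive_part lin]] by (simp add: power3_eq_cube)
  from C3_jet_compose[OF C3_jet_positive_part this, folded u_def]
  have jet: "C3_jet (\<lambda>y. ?p (u y)) (\<lambda>y. ?p1 (u y) * ?p1 (1 - y))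
    (\<lambda>y. ?p2 (u y) * (?p1 (1 - y))\<^sup>2 + ?p1 (u y) * - ?p2 (1 - y))
    (\<lambda>y. ?p3 (u y) * ?p1 (1 - y) ^ 3 + 3 * ?p2 (u y) * ?p1 (1 - y) * - ?p2 (1 - y) + ?p1 (u y) * ?p3 (1 - y))"
    (is "C3_jet ?f ?f1 ?f2 ?f3") .
  have u0: "max 0 (u y) = 0" if "y \<le> 0" for y
  proof -
    have "1 ^ 4 \<le> (max 0 (1 - y)) ^ 4" using that by (intro power_mono) auto
    then show ?thesis by (simp add: u_def)
  qed
  have u1: "u y = 1" if "y \<ge> 1" for y using that by (simp add: u_def)
  have bound: "\<exists>M. \<forall>y. \<bar>f y\<bar> \<le> M"
    if "continuous_on UNIV f" "\<And>y. y \<le> 0 \<Longrightarrow> f y = c" "\<And>y. y \<ge> 1 \<Longrightarrow> f y = d" for f :: "real \<Rightarrow> real" and c d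
  proof -
    have "bounded (f ` {0..1})"
      by (intro compact_imp_bounded compact_continuous_image continuous_on_subset[OF that(1)]) auto
    then obtain M where "\<forall>z\<in>f ` {0..1}. norm z \<le> M" unfolding bounded_iff by blast
    then have M: "\<And>y. y \<in> {0..1} \<Longrightarrow> \<bar>f y\<bar> \<le> M" by auto
    have "\<bar>f y\<bar> \<le> max M (max \<bar>c\<bar> \<bar>d\<bar>)" for y
      using that(2,3)[of y] M[of y] by (cases "y \<le> 0"; cases "y \<ge> 1") (auto simp: le_max_iff_disj)
    then show ?thesis by blast
  qed
  obtain M0 where M0: "\<And>y. \<bar>?f y - 1\<bar> \<le> M0"
    using bound[OF continuous_on_diff[OF C3_jetD(8)[OF jet] continuous_on_const[of _ 1]], of "-1" 0] u0 u1
    by auto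
  obtain M1 where M1: "\<And>y. \<bar>?f1 y\<bar> \<le> M1"
    using bound[OF C3_jetD(9)[OF jet], of 0 0] u0 u1 by auto
  obtain M2 where M2: "\<And>y. \<bar>?f2 y\<bar> \<le> M2"
    using bound[OF C3_jetD(10)[OF jet], of 0 0] u0 u1 by auto
  obtain M3 where M3: "\<And>y. \<bar>?f3 y\<bar> \<le> M3"
    using bound[OF C3_jetD(4)[OF jet], of 0 0] u0 u1 by auto
  define M where "M = max 1 (max (max M0 M1) (max M2 M3))"
  have M: "1 \<le> M" "M0 \<le> M" "M1 \<le> M" "M2 \<le> M" "M3 \<le> M" by (simp_all add: M_def le_max_iff_disj)
  show ?thesis
  proof (rule that[OF jet])
    show "?f y = 0" if "y \<le> 0" for y using u0[OF that] by simp
    show "?f y = 1 \<and> ?f1 y = 0 \<and> ?f2 y = 0 \<and> ?f3 y = 0" if "y \<ge> 1" for y using u1[OF that] that by simp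
    show "1 \<le> M" by (rule M)
    show "\<bar>?f y - 1\<bar> \<le> M \<and> \<bar>?f1 y\<bar> \<le> M \<and> \<bar>?f2 y\<bar> \<le> M \<and> \<bar>?f3 y\<bar> \<le> M" for y
      by (intro conjI order_trans[OF M0 M(2)] order_trans[OF M1 M(3)] order_trans[OF M2 M(4)] order_trans[OF M3 M(5)])
  qed
qed

text \<open>For \<open>t = x / 2\<close> the bound \<open>\<pi> < 4\<close> gives \<open>\<bar>t\<bar> \<le> 2\<close>, so the cubic remainder of the sine is at most two thirds of \<open>\<bar>t\<bar>\<close>.\<close>

lemma one_minus_cos_ge: 
  assumes "\<bar>x\<bar> \<le> pi" shows "x\<^sup>2 \<le> 18 * (1 - cos x)"
proof -
  define t where "t = x / 2"
  have t: "\<bar>t\<bar> \<le> 2" using assms pi_less_4 by (simp add: t_def)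
  have "\<bar>sin t - t\<bar> \<le> \<bar>t\<bar> ^ 3 / 6"
    using Maclaurin_sin_bound[of t 3] by (simp add: sin_coeff_def eval_nat_numeral field_simps)
  also have "\<bar>t\<bar> ^ 3 / 6 = \<bar>t\<bar> * (t\<^sup>2 / 6)" by (simp add: power2_eq_square power3_eq_cube)
  also have "\<dots> \<le> \<bar>t\<bar> * (2 / 3)"
  proof (rule mult_left_mono)
    have "\<bar>t\<bar>\<^sup>2 \<le> 2\<^sup>2" using t by (intro power_mono) auto
    then show "t\<^sup>2 / 6 \<le> 2 / 3" by simp
  qed simp
  finally have "\<bar>t\<bar> \<le> 3 * \<bar>sin t\<bar>" by linarith
  then have "\<bar>t\<bar>\<^sup>2 \<le> (3 * \<bar>sin t\<bar>)\<^sup>2" by (intro power_mono) auto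
  then have "t\<^sup>2 \<le> 9 * (sin t)\<^sup>2" by (simp add: power_mult_distrib)
  moreover have "1 - cos x = 2 * (sin t)\<^sup>2" using cos_double_sin[of t] by (simp add: t_def)
  ultimately show ?thesis by (simp add: t_def power_divide)
qed



lemma abs_mult_le:
  fixes u v U V :: real
  shows "\<bar>u\<bar> \<le> U \<Longrightarrow> \<bar>v\<bar> \<le> V \<Longrightarrow> \<bar>u * v\<bar> \<le> U * V"
  unfolding abs_mult by (intro mult_mono) (auto intro: order_trans[OF abs_ge_zero])

lemma abs_le_mult_radius:
  fixes f :: "real \<Rightarrow> real"
  assumes d: "\<And>x. (f has_real_derivative f' x) (at x)" and "f 0 = 0"
    and B: "\<And>x. \<bar>x\<bar> \<le> a \<Longrightarrow> \<bar>f' x\<bar> \<le> B" and x: "\<bar>x\<bar> \<le> a"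
  shows "\<bar>f x\<bar> \<le> B * a"
proof -
  have "norm (f x - f 0) \<le> B * norm (x - 0)"
  proof (rule field_differentiable_bound[where S = "{-a..a}"])
    show "(f has_field_derivative f' z) (at z within {-a..a})" for z
      using d by (rule has_field_derivative_at_within)
    show "norm (f' z) \<le> B" if "z \<in> {-a..a}" for z using B[of z] that by (auto simp: abs_le_iff)
  qed (use x in auto)
  also have "\<dots> \<le> B * a"
  proof (rule mult_left_mono)
    have "0 \<le> a" using x by linarith
    then show "0 \<le> B" by (intro order_trans[OF abs_ge_zero B[of 0]]) simp
  qed (use x in simp)
  finally show ?thesis using assms(2) by simp
qed

text \<open>Write \<open>g = x + r\<close> and cut off \<open>r\<close> at distance of order \<open>1/\<sigma>\<close> from \<open>0\<close>.  The \<open>k\<close>-th derivative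
  of the cutoff function is of order \<open>\<sigma>\<^sup>k\<close>, and that of \<open>r\<close> is of order \<open>o(\<sigma>\<^sup>k\<^sup>-\<^sup>3)\<close> on the affected
  interval, because the third derivative of \<open>r\<close> is continuous and vanishes at \<open>0\<close>.  All terms of the
  Leibniz rule up to order 3 therefore tend to zero.  The argument \<open>1 - cos x\<close> makes the cutoff periodic.\<close>

theorem flatten_near_zero:
  assumes g: "g \<in> Diff3_cover" and g0: "g 0 = 0" "deriv g 0 = 1" "D2 g 0 = 0" "D3 g 0 = 0"
  obtains G :: "nat \<Rightarrow> real \<Rightarrow> real"
  where "limitin C3_topology G g sequentially" "\<And>n. identity_near 0 (G n)"
proof -
  note gD = Diff3_coverD[OF g]
  obtain \<psi> \<psi>1 \<psi>2 \<psi>3 M where \<psi>: "C3_jet \<psi> \<psi>1 \<psi>2 \<psi>3" "\<And>y. y \<le> 0 \<Longrightarrow> \<psi> y = 0"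
    "\<And>y. y \<ge> 1 \<Longrightarrow> \<psi> y = 1 \<and> \<psi>1 y = 0 \<and> \<psi>2 y = 0 \<and> \<psi>3 y = 0"
    "M \<ge> 1" "\<And>y. \<bar>\<psi> y - 1\<bar> \<le> M \<and> \<bar>\<psi>1 y\<bar> \<le> M \<and> \<bar>\<psi>2 y\<bar> \<le> M \<and> \<bar>\<psi>3 y\<bar> \<le> M"
    by (rule smooth_step_exists) (rule that)
  define r where "r x = g x + - x" for x
  define r1 where "r1 x = deriv g x + -1" for x
  define r2 r3 where "r2 = D2 g" "r3 = D3 g"
  have "C3_jet (\<lambda>x. - x) (\<lambda>_. -1) (\<lambda>_. 0) (\<lambda>_. 0)"
    unfolding C3_jet_def by (auto intro!: derivative_eq_intros)
  from C3_jet_add[OF gD(1) this] have r: "C3_jet r r1 r2 r3"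
    by (simp add: r_def[abs_def] r1_def[abs_def] r2_r3_def)
  have r_per: "r (x + 2 * pi) = r x" "r1 (x + 2 * pi) = r1 x" "r2 (x + 2 * pi) = r2 x" "r3 (x + 2 * pi) = r3 x" for x
    using gD(3,6,7,8) by (simp_all add: r_def r1_def r2_r3_def periodic_def)
  have r_0: "r 0 = 0" "r1 0 = 0" "r2 0 = 0" "r3 0 = 0" by (simp_all add: r_def r1_def r2_r3_def g0)
  define \<sigma> where "\<sigma> n = real n + 1" for n :: nat
  have \<sigma>: "\<sigma> n \<ge> 1" for n by (simp add: \<sigma>_def)
  define y where "y n x = (\<sigma> n)\<^sup>2 * (1 - cos x) - 1" for n x
  define s where "s n x = (\<sigma> n)\<^sup>2 * sin x" for n x
  define c where "c n x = (\<sigma> n)\<^sup>2 * cos x" for n x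
  have y: "C3_jet (y n) (s n) (c n) (\<lambda>x. - s n x)" for n
    unfolding C3_jet_def y_def[abs_def] s_def[abs_def] c_def[abs_def]
    by (auto intro!: derivative_eq_intros continuous_intros)
  define k where "k n x = \<psi> (y n x) + -1" for n x
  define k1 where "k1 n x = \<psi>1 (y n x) * s n x" for n x
  define k2 where "k2 n x = \<psi>2 (y n x) * (s n x)\<^sup>2 + \<psi>1 (y n x) * c n x" for n x
  define k3 where "k3 n x = \<psi>3 (y n x) * s n x ^ 3 + 3 * \<psi>2 (y n x) * s n x * c n x + \<psi>1 (y n x) * - s n x" for n x
  have k: "C3_jet (k n) (k1 n) (k2 n) (k3 n)" for n
  proof -
    have "C3_jet (\<lambda>_. -1) (\<lambda>_. 0) (\<lambda>_. 0) (\<lambda>_. 0)" by (simp add: C3_jet_def)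
    from C3_jet_add[OF C3_jet_compose[OF \<psi>(1) y[of n]] this] show ?thesis
      by (simp add: k_def[abs_def] k1_def[abs_def] k2_def[abs_def] k3_def[abs_def])
  qed
  define e where "e n x = r x * k n x" for n x
  define e1 where "e1 n x = r1 x * k n x + r x * k1 n x" for n x
  define e2 where "e2 n x = r2 x * k n x + 2 * r1 x * k1 n x + r x * k2 n x" for n x
  define e3 where "e3 n x = r3 x * k n x + 3 * r2 x * k1 n x + 3 * r1 x * k2 n x + r x * k3 n x" for n x
  have e: "C3_jet (e n) (e1 n) (e2 n) (e3 n)" for n
    using C3_jet_mult[OF r k[of n]]
    by (simp add: e_def[abs_def] e1_def[abs_def] e2_def[abs_def] e3_def[abs_def])
  have y_per: "y n (x + 2 * pi) = y n x" "s n (x + 2 * pi) = s n x" "c n (x + 2 * pi) = c n x" for n x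
    by (simp_all add: y_def s_def c_def)
  have k_per: "k n (x + 2 * pi) = k n x" "k1 n (x + 2 * pi) = k1 n x" "k2 n (x + 2 * pi) = k2 n x"
      "k3 n (x + 2 * pi) = k3 n x" for n x
    by (simp_all add: k_def k1_def k2_def k3_def y_per)
  have e_per: "periodic (e n)" "periodic (e1 n)" "periodic (e2 n)" "periodic (e3 n)" for n
    by (simp_all add: periodic_def e_def e1_def e2_def e3_def k_per r_per)
  have small: "\<exists>N. \<forall>n\<ge>N. \<forall>x. \<bar>e n x\<bar> < \<tau> \<and> \<bar>e1 n x\<bar> < \<tau> \<and> \<bar>e2 n x\<bar> < \<tau> \<and> \<bar>e3 n x\<bar> < \<tau>" if "\<tau> > 0" for \<tau>
  proof -
    \<comment> \<open>The constant exceeds \<open>1 + 3 * 36 + 3 * 1332 + 51840\<close>, the sum of the bounds for the terms of \<open>e3\<close> below.\<close>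
    define \<omega> where "\<omega> = \<tau> / (60000 * M)"
    have \<omega>: "\<omega> > 0" "60000 * (\<omega> * M) = \<tau>" using \<open>\<tau> > 0\<close> \<psi>(4) by (simp_all add: \<omega>_def)
    have "isCont r3 0" using C3_jetD(4)[OF r] by (simp add: continuous_on_eq_continuous_at)
    then obtain \<rho> where \<rho>: "\<rho> > 0" "\<And>x. \<bar>x\<bar> < \<rho> \<Longrightarrow> \<bar>r3 x\<bar> < \<omega>"
      using \<omega>(1) r_0(4) unfolding continuous_at_eps_delta by (auto simp: dist_real_def)
    obtain N :: nat where N: "6 / \<rho> < real N" using reals_Archimedean2 by blast
    have "\<bar>e n x\<bar> < \<tau> \<and> \<bar>e1 n x\<bar> < \<tau> \<and> \<bar>e2 n x\<bar> < \<tau> \<and> \<bar>e3 n x\<bar> < \<tau>" if n: "n \<ge> N" and x: "\<bar>x\<bar> \<le> pi" for n x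
    proof (cases "y n x \<ge> 1")
      case True
      then show ?thesis
        using \<psi>(3)[OF True] \<open>\<tau> > 0\<close> by (simp add: e_def e1_def e2_def e3_def k_def k1_def k2_def k3_def)
    next
      case False
      define S where "S = \<sigma> n"
      have S: "S \<ge> 1" "S > 0" using \<sigma>[of n] by (simp_all add: S_def)
      define a where "a = 6 / S"
      have aS: "a * S = 6" using S by (simp add: a_def)
      have a0: "a > 0" using S by (simp add: a_def)
      have "6 / \<rho> < S" using N n by (simp add: S_def \<sigma>_def)
      then have a\<rho>: "a < \<rho>" using \<rho>(1) S by (simp add: a_def field_simps)
      have xa: "\<bar>x\<bar> \<le> a"
      proof -
        have "S\<^sup>2 * (1 - cos x) < 2" using False by (simp add: y_def S_def)
        moreover have "S\<^sup>2 * x\<^sup>2 \<le> S\<^sup>2 * (18 * (1 - cos x))"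
          by (intro mult_left_mono one_minus_cos_ge x) simp
        moreover have "S\<^sup>2 * (18 * (1 - cos x)) = 18 * (S\<^sup>2 * (1 - cos x))" by simp
        ultimately have "S\<^sup>2 * x\<^sup>2 \<le> 36" by linarith
        then have "(S * \<bar>x\<bar>)\<^sup>2 \<le> 6\<^sup>2" by (simp add: power_mult_distrib)
        then have "S * \<bar>x\<bar> \<le> 6" by (rule power2_le_imp_le) simp
        then show ?thesis using S by (simp add: a_def field_simps)
      qed
      have R3: "\<bar>r3 z\<bar> \<le> \<omega>" if "\<bar>z\<bar> \<le> a" for z using \<rho>(2)[of z] that a\<rho> by simp
      have R2: "\<bar>r2 z\<bar> \<le> \<omega> * a" if "\<bar>z\<bar> \<le> a" for z
        by (rule abs_le_mult_radius[OF C3_jetD(3)[OF r] r_0(3) R3 that])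
      have R1: "\<bar>r1 z\<bar> \<le> \<omega> * a * a" if "\<bar>z\<bar> \<le> a" for z
        by (rule abs_le_mult_radius[OF C3_jetD(2)[OF r] r_0(2) R2 that])
      have R0: "\<bar>r z\<bar> \<le> \<omega> * a * a * a" if "\<bar>z\<bar> \<le> a" for z
        by (rule abs_le_mult_radius[OF C3_jetD(1)[OF r] r_0(1) R1 that])
      note R = R0[OF xa] R1[OF xa] R2[OF xa] R3[OF xa]
      have s: "\<bar>s n x\<bar> \<le> 6 * S"
      proof -
        have "\<bar>sin x\<bar> \<le> a" using abs_sin_x_le_abs_x[of x] xa by linarith
        then have "S\<^sup>2 * \<bar>sin x\<bar> \<le> S\<^sup>2 * a" by (intro mult_left_mono) auto
        also have "S\<^sup>2 * a = S * (a * S)" by (simp add: power2_eq_square mult.commute)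
        finally have "S\<^sup>2 * \<bar>sin x\<bar> \<le> 6 * S" by (simp add: aS)
        then show ?thesis by (simp add: s_def S_def abs_mult)
      qed
      have c: "\<bar>c n x\<bar> \<le> S\<^sup>2"
      proof -
        have "S\<^sup>2 * \<bar>cos x\<bar> \<le> S\<^sup>2 * 1" by (intro mult_left_mono) auto
        then show ?thesis by (simp add: c_def S_def abs_mult)
      qed
      have p: "\<bar>\<psi> (y n x) - 1\<bar> \<le> M" "\<bar>\<psi>1 (y n x)\<bar> \<le> M" "\<bar>\<psi>2 (y n x)\<bar> \<le> M" "\<bar>\<psi>3 (y n x)\<bar> \<le> M"
        using \<psi>(5) by blast+
      have K0: "\<bar>k n x\<bar> \<le> M" using p(1) by (simp add: k_def)
      have K1: "\<bar>k1 n x\<bar> \<le> 6 * M * S"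
        using abs_mult_le[OF p(2) s] by (simp add: k1_def mult.commute mult.left_commute)
      have K2: "\<bar>k2 n x\<bar> \<le> 37 * M * S\<^sup>2"
      proof -
        have "\<bar>(s n x)\<^sup>2\<bar> \<le> (6 * S) * (6 * S)" unfolding power2_eq_square by (rule abs_mult_le[OF s s])
        from abs_mult_le[OF p(3) this] abs_mult_le[OF p(2) c]
        show ?thesis unfolding k2_def by (simp add: power2_eq_square algebra_simps)
      qed
      have K3: "\<bar>k3 n x\<bar> \<le> 240 * M * S ^ 3"
      proof -
        have "\<bar>s n x ^ 3\<bar> \<le> ((6 * S) * (6 * S)) * (6 * S)"
          unfolding power3_eq_cube by (rule abs_mult_le[OF abs_mult_le[OF s s] s])
        from abs_mult_le[OF p(4) this] have 1: "\<bar>\<psi>3 (y n x) * s n x ^ 3\<bar> \<le> 216 * (M * S ^ 3)"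
          by (simp add: power3_eq_cube algebra_simps)
        from abs_mult_le[OF abs_mult_le[OF p(3) s] c] have 2: "\<bar>\<psi>2 (y n x) * s n x * c n x\<bar> \<le> 6 * (M * S ^ 3)"
          by (simp add: power3_eq_cube power2_eq_square algebra_simps)
        from abs_mult_le[OF p(2) s] have "\<bar>\<psi>1 (y n x) * s n x\<bar> \<le> 6 * (M * S)" by (simp add: algebra_simps)
        moreover have "M * S \<le> M * S ^ 3"
          using \<psi>(4) S self_le_power[of S 3] by (intro mult_left_mono) auto
        ultimately have 3: "\<bar>\<psi>1 (y n x) * s n x\<bar> \<le> 6 * (M * S ^ 3)" by simp
        show ?thesis using 1 2 3 unfolding k3_def by (simp add: algebra_simps)
      qed
      have \<omega>M: "\<omega> * M > 0" using \<omega>(1) \<psi>(4) by simp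
      have a6: "a \<le> 6" using S by (simp add: a_def field_simps)
      have "\<bar>r3 x * k n x\<bar> \<le> \<omega> * M" by (rule abs_mult_le[OF R(4) K0])
      moreover have "\<bar>r2 x * k1 n x\<bar> \<le> 36 * (\<omega> * M)"
      proof -
        have "\<bar>r2 x * k1 n x\<bar> \<le> \<omega> * a * (6 * M * S)" by (rule abs_mult_le[OF R(3) K1])
        also have "\<dots> = 6 * (\<omega> * M) * (a * S)" by (simp add: algebra_simps)
        finally show ?thesis by (simp add: aS)
      qed
      moreover have "\<bar>r1 x * k2 n x\<bar> \<le> 1332 * (\<omega> * M)"
      proof -
        have "\<bar>r1 x * k2 n x\<bar> \<le> \<omega> * a * a * (37 * M * S\<^sup>2)" by (rule abs_mult_le[OF R(2) K2])
        also have "\<dots> = 37 * (\<omega> * M) * ((a * S) * (a * S))" by (simp add: algebra_simps power2_eq_square)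
        finally show ?thesis by (simp add: aS)
      qed
      moreover have "\<bar>r x * k3 n x\<bar> \<le> 51840 * (\<omega> * M)"
      proof -
        have "\<bar>r x * k3 n x\<bar> \<le> \<omega> * a * a * a * (240 * M * S ^ 3)" by (rule abs_mult_le[OF R(1) K3])
        also have "\<dots> = 240 * (\<omega> * M) * ((a * S) * (a * S) * (a * S))" by (simp add: algebra_simps power3_eq_cube)
        finally show ?thesis by (simp add: aS)
      qed
      ultimately have E3: "\<bar>e3 n x\<bar> < \<tau>" using \<omega>(2) \<omega>M unfolding e3_def by linarith
      have "\<bar>r2 x * k n x\<bar> \<le> 6 * (\<omega> * M)"
      proof -
        have "\<bar>r2 x * k n x\<bar> \<le> \<omega> * a * M" by (rule abs_mult_le[OF R(3) K0])
        also have "\<dots> = a * (\<omega> * M)" by (simp add: algebra_simps)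
        also have "\<dots> \<le> 6 * (\<omega> * M)" using a6 \<omega>M by (intro mult_right_mono) auto
        finally show ?thesis .
      qed
      moreover have "\<bar>r1 x * k1 n x\<bar> \<le> 216 * (\<omega> * M)"
      proof -
        have "\<bar>r1 x * k1 n x\<bar> \<le> \<omega> * a * a * (6 * M * S)" by (rule abs_mult_le[OF R(2) K1])
        also have "\<dots> = a * (6 * (\<omega> * M) * (a * S))" by (simp add: algebra_simps)
        also have "\<dots> \<le> 6 * (6 * (\<omega> * M) * (a * S))" using a6 \<omega>M aS by (intro mult_right_mono) auto
        finally show ?thesis by (simp add: aS)
      qed
      moreover have "\<bar>r x * k2 n x\<bar> \<le> 7992 * (\<omega> * M)"
      proof -
        have "\<bar>r x * k2 n x\<bar> \<le> \<omega> * a * a * a * (37 * M * S\<^sup>2)" by (rule abs_mult_le[OF R(1) K2])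
        also have "\<dots> = a * (37 * (\<omega> * M) * ((a * S) * (a * S)))" by (simp add: algebra_simps power2_eq_square)
        also have "\<dots> \<le> 6 * (37 * (\<omega> * M) * ((a * S) * (a * S)))" using a6 \<omega>M aS by (intro mult_right_mono) auto
        finally show ?thesis by (simp add: aS)
      qed
      ultimately have E2: "\<bar>e2 n x\<bar> < \<tau>" using \<omega>(2) \<omega>M unfolding e2_def by linarith
      have aa: "a * a \<le> 36" using mult_mono[OF a6 a6] a0 by simp
      have "\<bar>r1 x * k n x\<bar> \<le> 36 * (\<omega> * M)"
      proof -
        have "\<bar>r1 x * k n x\<bar> \<le> \<omega> * a * a * M" by (rule abs_mult_le[OF R(2) K0])
        also have "\<dots> = a * a * (\<omega> * M)" by (simp add: algebra_simps)
        also have "\<dots> \<le> 36 * (\<omega> * M)" using aa \<omega>M by (intro mult_right_mono) auto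
        finally show ?thesis .
      qed
      moreover have "\<bar>r x * k1 n x\<bar> \<le> 1296 * (\<omega> * M)"
      proof -
        have "\<bar>r x * k1 n x\<bar> \<le> \<omega> * a * a * a * (6 * M * S)" by (rule abs_mult_le[OF R(1) K1])
        also have "\<dots> = a * a * (6 * (\<omega> * M) * (a * S))" by (simp add: algebra_simps)
        also have "\<dots> \<le> 36 * (6 * (\<omega> * M) * (a * S))" using aa \<omega>M aS by (intro mult_right_mono) auto
        finally show ?thesis by (simp add: aS)
      qed
      ultimately have E1: "\<bar>e1 n x\<bar> < \<tau>" using \<omega>(2) \<omega>M unfolding e1_def by linarith
      have "\<bar>r x * k n x\<bar> \<le> 216 * (\<omega> * M)"
      proof -
        have "\<bar>r x * k n x\<bar> \<le> \<omega> * a * a * a * M" by (rule abs_mult_le[OF R(1) K0])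
        also have "\<dots> = (a * a) * a * (\<omega> * M)" by (simp add: algebra_simps)
        also have "\<dots> \<le> 36 * 6 * (\<omega> * M)" using aa a6 a0 \<omega>M by (intro mult_right_mono mult_mono) auto
        finally show ?thesis by simp
      qed
      then have "\<bar>e n x\<bar> < \<tau>" using \<omega>(2) \<omega>M unfolding e_def by linarith
      then show ?thesis using E1 E2 E3 by simp
    qed
    moreover have "\<exists>z. \<bar>z\<bar> \<le> pi \<and> (\<forall>f. periodic f \<longrightarrow> f x = f z)" for x
    proof -
      obtain j where j: "- pi \<le> x + 2 * pi * of_int j" "x + 2 * pi * of_int j < - pi + 2 * pi" by (rule real_mod_period)
      then show ?thesis
        by (intro exI[of _ "x + 2 * pi * of_int j"]) (auto simp: periodic_shift_int abs_le_iff)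
    qed
    ultimately show ?thesis using e_per by metis
  qed
  define G where "G n x = g x + e n x" for n x
  have jetG: "C3_jet (G n) (\<lambda>x. deriv g x + e1 n x) (\<lambda>x. D2 g x + e2 n x) (\<lambda>x. D3 g x + e3 n x)" for n
    unfolding G_def[abs_def] by (rule C3_jet_add[OF gD(1) e])
  have lim: "uniform_limit UNIV (\<lambda>n x. f x + h n x) f sequentially"
    if "\<And>\<tau>. \<tau> > 0 \<Longrightarrow> \<exists>N. \<forall>n\<ge>N. \<forall>x. \<bar>h n x\<bar> < \<tau>" for f :: "real \<Rightarrow> real" and h
    unfolding uniform_limit_sequentially_iff using that by (simp add: dist_real_def)
  have "limitin C3_topology G g sequentially"
  proof (rule limitin_C3_topologyI[OF g gD(1)])
    obtain b where b: "b > 0" "\<And>x. b \<le> deriv g x" using Diff3_cover_bounded(4)[OF g] by blast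
    obtain N where N: "\<And>n x. n \<ge> N \<Longrightarrow> \<bar>e1 n x\<bar> < b" using small[OF b(1)] by blast
    have "G n \<in> Diff3_cover" if "n \<ge> N" for n
    proof (rule Diff3_coverI[OF jetG])
      show "0 < deriv g x + e1 n x" for x using N[OF that, of x] b(2)[of x] by linarith
      show "G n (x + 2 * pi) = G n x + 2 * pi" for x
        using e_per(1)[of n] gD(3)[of x] by (simp add: G_def periodic_def)
    qed
    then show "\<forall>\<^sub>F n in sequentially. G n \<in> Diff3_cover \<and>
        C3_jet (G n) (\<lambda>x. deriv g x + e1 n x) (\<lambda>x. D2 g x + e2 n x) (\<lambda>x. D3 g x + e3 n x)"
      using jetG by (intro eventually_sequentiallyI[of N]) blast
    show "uniform_limit UNIV G g sequentially"
      unfolding G_def[abs_def] using small by (intro lim) blast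
  qed (intro lim, use small in blast)+
  moreover have "identity_near 0 (G n)" for n
  proof -
    have "isCont (\<lambda>x. (\<sigma> n)\<^sup>2 * (1 - cos x)) 0" by (intro continuous_intros)
    then obtain d where d: "d > 0" "\<And>x. \<bar>x\<bar> < d \<Longrightarrow> \<bar>(\<sigma> n)\<^sup>2 * (1 - cos x)\<bar> < 1"
      unfolding continuous_at_eps_delta by (auto simp: dist_real_def dest: spec[of _ 1])
    have "G n x = x" if "\<bar>x\<bar> < d" for x
    proof -
      have "y n x \<le> 0" using d(2)[OF that] unfolding y_def by linarith
      then show ?thesis using \<psi>(2) by (simp add: G_def e_def r_def k_def)
    qed
    then show ?thesis unfolding identity_near_def using d(1) by auto
  qed
  ultimately show ?thesis by (rule that)
qed

section \<open>Flattening by projective maps\<close>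

definition flat_at_zero :: "(real \<Rightarrow> real) \<Rightarrow> bool"
  where "flat_at_zero q \<longleftrightarrow> q 0 = 0 \<and> deriv q 0 = 1 \<and> D2 q 0 = 0 \<and> D3 q 0 = 0"

text \<open>At a zero of the projective Schwarzian derivative the diffeomorphism has the 3-jet of a projective map, which can be
  divided off.\<close>

theorem double_coset_flat:
  assumes p: "p \<in> Diff3_cover"
  obtains k1 k2 where "k1 \<in> SL2_cover" "k2 \<in> SL2_cover" "flat_at_zero (k1 \<circ> p \<circ> k2)"
proof -
  obtain x0 where x0:
    "D3 p x0 / deriv p x0 - 3 / 2 * (D2 p x0 / deriv p x0)\<^sup>2 + ((deriv p x0)\<^sup>2 - 1) / 2 = 0"
    by (rule projective_Schwarzian_zero[OF p])
  define \<mu> where "\<mu> = deriv p x0"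
  define \<nu> where "\<nu> = D2 p x0"
  define \<kappa> where "\<kappa> = D3 p x0"
  have \<mu>: "\<mu> > 0" unfolding \<mu>_def by (rule Diff3_coverD(2)[OF p])
  obtain k where k: "k \<in> SL2_cover" "k 0 = 0" "deriv k 0 = \<mu>" "D2 k 0 = \<nu>"
    "D3 k 0 / \<mu> - 3 / 2 * (\<nu> / \<mu>)\<^sup>2 + (\<mu>\<^sup>2 - 1) / 2 = 0"
    by (rule SL2_cover_jet_exists[OF \<mu>])
  have "D3 k 0 / \<mu> = \<kappa> / \<mu>" using k(5) x0 unfolding \<mu>_def[symmetric] \<nu>_def[symmetric] \<kappa>_def[symmetric] by linarith
  then have k3: "D3 k 0 = \<kappa>" using \<mu> by simp
  define T where "T x = x + (- p x0)" for x
  define k2 where "k2 x = x + x0" for x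
  have TS: "T \<in> SL2_cover" "k2 \<in> SL2_cover"
    using SL2_cover_translation[of "- p x0"] SL2_cover_translation[of x0] by (simp_all add: T_def[abs_def] k2_def[abs_def])
  define f where "f = T \<circ> p \<circ> k2"
  note pj = Diff3_coverD(1)[OF p]
  have "C3_jet (\<lambda>x. p (x + x0)) (\<lambda>x. deriv p (x + x0)) (\<lambda>x. D2 p (x + x0)) (\<lambda>x. D3 p (x + x0))"
    using C3_jet_compose[OF pj C3_jet_translation[of x0]] by simp
  from C3_jet_compose[OF C3_jet_translation[of "- p x0"] this]
  have jf: "C3_jet f (\<lambda>x. deriv p (x + x0)) (\<lambda>x. D2 p (x + x0)) (\<lambda>x. D3 p (x + x0))"
    by (simp add: f_def T_def[abs_def] k2_def[abs_def] o_def)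
  have f0: "f 0 = 0" "deriv f 0 = \<mu>" "D2 f 0 = \<nu>" "D3 f 0 = \<kappa>"
    by (simp_all add: C3_jetD(5-7)[OF jf] \<mu>_def \<nu>_def \<kappa>_def) (simp add: f_def T_def k2_def)
  define r where "r = inv_into UNIV k"
  have kD: "k \<in> Diff3_cover" by (rule SL2_cover_Diff3[OF k(1)])
  have fD: "f \<in> Diff3_cover" unfolding f_def by (intro Diff3_cover_compose p TS[THEN SL2_cover_Diff3])
  have rD: "r \<in> Diff3_cover" unfolding r_def by (rule Diff3_cover_inverse[OF kD])
  have r0: "r 0 = 0" unfolding r_def by (rule inv_f_eq[OF Diff3_coverD(9)[OF kD] k(2)])
  note jr = Diff3_cover_inverse_jet[OF kD, folded r_def]
  have r123: "deriv r 0 = 1 / \<mu>" "D2 r 0 = - \<nu> / \<mu> ^ 3" "D3 r 0 = (3 * \<nu>\<^sup>2 - \<mu> * \<kappa>) / \<mu> ^ 5"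
    by (simp_all only: C3_jetD(5-7)[OF jr] r0 k(3,4) k3)
  note jc = C3_jetD(5-7)[OF Diff3_cover_compose_jet[OF rD fD]]
  have "flat_at_zero (r \<circ> f)"
    unfolding flat_at_zero_def
  proof (intro conjI)
    show "(r \<circ> f) 0 = 0" by (simp add: f0 r0)
    show "deriv (r \<circ> f) 0 = 1" using \<mu> by (simp only: jc(1) f0 r123) simp
    show "D2 (r \<circ> f) 0 = 0"
      using \<mu> by (simp only: jc(1,2) f0 r123) (simp add: power2_eq_square power3_eq_cube)
    show "D3 (r \<circ> f) 0 = 0"
      using \<mu> by (simp only: jc(1-3) f0 r123) (simp add: field_simps eval_nat_numeral)
  qed
  moreover have "r \<circ> f = (r \<circ> T) \<circ> p \<circ> k2" by (simp add: f_def o_assoc)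
  moreover have "r \<circ> T \<in> SL2_cover" unfolding r_def by (intro SL2_cover_compose SL2_cover_inverse k TS)
  ultimately show ?thesis using that TS(2) by simp
qed

section \<open>The subgroup and its invariant vectors\<close>

abbreviation "\<G> \<equiv> bott_extension"
abbreviation "\<T> \<equiv> bott_extension_topology"

lemma SL2_cover_liftD:
  assumes "SL2_cover_lift s"
  shows "q \<in> SL2_cover \<Longrightarrow> fst (s q) = q" "q \<in> SL2_cover \<Longrightarrow> s q \<in> carrier \<G>"
    "p \<in> SL2_cover \<Longrightarrow> q \<in> SL2_cover \<Longrightarrow> s (p \<circ> q) = s p \<otimes>\<^bsub>\<G>\<^esub> s q"
    "s id = \<one>\<^bsub>\<G>\<^esub>" "q \<in> SL2_cover \<Longrightarrow> s (inv_into UNIV q) = inv\<^bsub>\<G>\<^esub> (s q)"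
    "q \<in> SL2_cover \<Longrightarrow> q ^^ n \<in> SL2_cover \<and> s (q ^^ n) = s q [^]\<^bsub>\<G>\<^esub> n"
    "eventually (\<lambda>x. f x \<in> SL2_cover) F \<Longrightarrow> limitin C3_topology f id F \<Longrightarrow> limitin \<T> (\<lambda>x. s (f x)) \<one>\<^bsub>\<G>\<^esub> F"
proof -
  interpret group \<G> by (rule group_bott_extension)
  have hom: "s \<in> hom (Diff3_cover_group\<lparr>carrier := SL2_cover\<rparr>) \<G>"
    and cont: "continuous_map (subtopology C3_topology SL2_cover) \<T> s"
    and fst: "\<And>q. q \<in> SL2_cover \<Longrightarrow> fst (s q) = q"
    using assms unfolding SL2_cover_lift_def by simp_all
  show "fst (s q) = q" if "q \<in> SL2_cover" for q using fst that .
  show carr: "s q \<in> carrier \<G>" if "q \<in> SL2_cover" for q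
    using hom that by (auto simp: hom_def Diff3_cover_group_def)
  show mult: "s (p \<circ> q) = s p \<otimes>\<^bsub>\<G>\<^esub> s q" if "p \<in> SL2_cover" "q \<in> SL2_cover" for p q
    using hom that by (auto simp: hom_def Diff3_cover_group_def)
  have "s id \<otimes>\<^bsub>\<G>\<^esub> s id = s id" using mult[OF SL2_cover_id SL2_cover_id] by simp
  then show one: "s id = \<one>\<^bsub>\<G>\<^esub>" using carr[OF SL2_cover_id] by (metis l_cancel_one')
  show "s (inv_into UNIV q) = inv\<^bsub>\<G>\<^esub> (s q)" if q: "q \<in> SL2_cover" for q
  proof (rule inv_equality[symmetric])
    show "s (inv_into UNIV q) \<otimes>\<^bsub>\<G>\<^esub> s q = \<one>\<^bsub>\<G>\<^esub>"
      using mult[OF SL2_cover_inverse[OF q] q] by (simp add: inv_into_compose[OF SL2_cover_Diff3[OF q]] one)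
  qed (intro carr q SL2_cover_inverse)+
  show "q ^^ n \<in> SL2_cover \<and> s (q ^^ n) = s q [^]\<^bsub>\<G>\<^esub> n" if q: "q \<in> SL2_cover" for q
  proof (induction n)
    case (Suc n)
    have "q ^^ Suc n = q ^^ n \<circ> q" by (simp only: funpow_Suc_right)
    then show ?case using Suc mult[of "q ^^ n" q] SL2_cover_compose[of "q ^^ n" q] q by (simp only: nat_pow_Suc)
  qed (simp_all only: funpow.simps(1) SL2_cover_id one nat_pow_0 simp_thms)
  show "limitin \<T> (\<lambda>x. s (f x)) \<one>\<^bsub>\<G>\<^esub> F"
    if "eventually (\<lambda>x. f x \<in> SL2_cover) F" "limitin C3_topology f id F"
  proof -
    have "limitin (subtopology C3_topology SL2_cover) f id F"
      using that SL2_cover_id by (simp add: limitin_subtopology)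
    from continuous_map_limit[OF cont this] show ?thesis by (simp add: one o_def)
  qed
qed

lemma subgroup_SL2_cover_lift:
  assumes s: "SL2_cover_lift s" shows "subgroup (s ` SL2_cover) \<G>"
proof (rule group.subgroupI[OF group_bott_extension])
  note sD = SL2_cover_liftD[OF s]
  show "s ` SL2_cover \<subseteq> carrier \<G>" using sD(2) by auto
  show "s ` SL2_cover \<noteq> {}" using SL2_cover_id by auto
  show "inv\<^bsub>\<G>\<^esub> a \<in> s ` SL2_cover" if "a \<in> s ` SL2_cover" for a
    using that by (auto simp: sD(5)[symmetric] SL2_cover_inverse)
  show "a \<otimes>\<^bsub>\<G>\<^esub> b \<in> s ` SL2_cover" if "a \<in> s ` SL2_cover" "b \<in> s ` SL2_cover" for a b
    using that by (auto simp: sD(3)[symmetric] SL2_cover_compose)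
qed

locale SL2_cover_rep =
  fixes s :: "(real \<Rightarrow> real) \<Rightarrow> (real \<Rightarrow> real) \<times> real"
    and \<rho> :: "(real \<Rightarrow> real) \<times> real \<Rightarrow> 'h::complex_hilbert_space \<Rightarrow> 'h"
  assumes lift: "SL2_cover_lift s" and rep: "unitary_rep \<G> \<T> \<rho>"
begin

sublocale group \<G> by (rule group_bott_extension)

lemmas s = SL2_cover_liftD[OF lift]
lemmas \<rho> = unitary_repD[OF group_bott_extension rep]
lemmas U = unitary_operatorD[OF \<rho>(1)]

abbreviation "V \<equiv> invariant_vectors \<rho> (s ` SL2_cover)"

text \<open>A vector fixed by the contraction is fixed by the two unipotent subgroups, which
  the contraction expands and contracts, and these generate the subgroup.\<close>

theorem contraction_fixed_eq_invariant: "{v. \<rho> (s contraction) v = v} = V"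
proof
  show "V \<subseteq> {v. \<rho> (s contraction) v = v}" using contraction(1) by (auto simp: invariant_vectors_def)
  show "{v. \<rho> (s contraction) v = v} \<subseteq> V"
  proof
    fix v assume "v \<in> {v. \<rho> (s contraction) v = v}"
    then have v: "\<rho> (s contraction) v = v" by simp
    define a where "a = s contraction"
    have a: "a \<in> carrier \<G>" unfolding a_def by (rule s(2)[OF contraction(1)])
    have an: "s (contraction ^^ n) = a [^]\<^bsub>\<G>\<^esub> n" for n using s(6)[OF contraction(1)] by (simp add: a_def)
    have v': "\<rho> (inv\<^bsub>\<G>\<^esub> a) v = v" using \<rho>(4)[OF a, of v] v by (simp add: a_def)
    have null: "(\<lambda>n. t / 2 ^ n) \<longlonglongrightarrow> 0" for t :: real
      using tendsto_mult[OF tendsto_const[of t] LIMSEQ_realpow_zero[of "1/2"]]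
      by (simp add: power_one_over)
    define H where "H = {q \<in> SL2_cover. \<rho> (s q) v = v}"
    have "SL2_cover \<subseteq> H"
    proof (rule SL2_cover_generated)
      show "p \<circ> q \<in> H" if "p \<in> H" "q \<in> H" for p q
        using that by (simp add: H_def SL2_cover_compose s(2,3) \<rho>(2))
      show "inv_into UNIV p \<in> H" if "p \<in> H" for p
        using that \<rho>(4)[OF s(2), of p v] by (simp add: H_def SL2_cover_inverse s(5))
      show "unipotent t \<in> H" for t
      proof -
        have n: "s (unipotent t) \<in> carrier \<G>" for t by (rule s(2)[OF unipotent(1)])
        have conj: "inv\<^bsub>\<G>\<^esub> (inv\<^bsub>\<G>\<^esub> a [^]\<^bsub>\<G>\<^esub> n) \<otimes>\<^bsub>\<G>\<^esub> s (unipotent t) \<otimes>\<^bsub>\<G>\<^esub> inv\<^bsub>\<G>\<^esub> a [^]\<^bsub>\<G>\<^esub> n = s (unipotent (t / 2 ^ n))" for n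
        proof -
          have "a [^]\<^bsub>\<G>\<^esub> n \<otimes>\<^bsub>\<G>\<^esub> s (unipotent t) = s (unipotent (t / 2 ^ n)) \<otimes>\<^bsub>\<G>\<^esub> a [^]\<^bsub>\<G>\<^esub> n"
            using arg_cong[OF contraction_unipotent[of n t], of s]
            by (simp add: s(3) contraction_pow(1) unipotent(1) an)
          then show ?thesis using a n by (simp add: nat_pow_inv m_assoc)
        qed
        have "\<rho> (s (unipotent t)) v = v"
        proof (rule Mautner_phenomenon[OF group_bott_extension rep inv_closed[OF a] v' n])
          show "limitin \<T> (\<lambda>n. inv\<^bsub>\<G>\<^esub> (inv\<^bsub>\<G>\<^esub> a [^]\<^bsub>\<G>\<^esub> n) \<otimes>\<^bsub>\<G>\<^esub> s (unipotent t) \<otimes>\<^bsub>\<G>\<^esub> inv\<^bsub>\<G>\<^esub> a [^]\<^bsub>\<G>\<^esub> n) \<one>\<^bsub>\<G>\<^esub> sequentially"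
            unfolding conj by (intro s(7) limitin_unipotent null always_eventually allI unipotent(1))
        qed
        then show ?thesis by (simp add: H_def unipotent(1))
      qed
      show "opposite_unipotent t \<in> H" for t
      proof -
        have n: "s (opposite_unipotent t) \<in> carrier \<G>" for t by (rule s(2)[OF opposite_unipotent(1)])
        have conj: "inv\<^bsub>\<G>\<^esub> (a [^]\<^bsub>\<G>\<^esub> n) \<otimes>\<^bsub>\<G>\<^esub> s (opposite_unipotent t) \<otimes>\<^bsub>\<G>\<^esub> a [^]\<^bsub>\<G>\<^esub> n = s (opposite_unipotent (t / 2 ^ n))" for n
        proof -
          have "s (opposite_unipotent t) \<otimes>\<^bsub>\<G>\<^esub> a [^]\<^bsub>\<G>\<^esub> n = a [^]\<^bsub>\<G>\<^esub> n \<otimes>\<^bsub>\<G>\<^esub> s (opposite_unipotent (t / 2 ^ n))"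
            using arg_cong[OF opposite_unipotent_contraction[of t n], of s]
            by (simp add: s(3) contraction_pow(1) opposite_unipotent(1) an)
          then show ?thesis using a n by (simp add: m_assoc) (simp add: m_assoc[symmetric])
        qed
        have "\<rho> (s (opposite_unipotent t)) v = v"
        proof (rule Mautner_phenomenon[OF group_bott_extension rep a v[folded a_def] n])
          show "limitin \<T> (\<lambda>n. inv\<^bsub>\<G>\<^esub> (a [^]\<^bsub>\<G>\<^esub> n) \<otimes>\<^bsub>\<G>\<^esub> s (opposite_unipotent t) \<otimes>\<^bsub>\<G>\<^esub> a [^]\<^bsub>\<G>\<^esub> n) \<one>\<^bsub>\<G>\<^esub> sequentially"
            unfolding conj by (intro s(7) limitin_opposite_unipotent null always_eventually allI opposite_unipotent(1))
        qed
        then show ?thesis by (simp add: H_def opposite_unipotent(1))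
      qed
    qed
    then show "v \<in> V" by (auto simp: H_def invariant_vectors_def)
  qed
qed

lemma V_subspace: "complex_vector.subspace V"
  using s(2) by (intro subspace_invariant_vectors[OF group_bott_extension rep]) auto

definition P :: "'h \<Rightarrow> 'h" where "P = (SOME P. orthogonal_projection_onto V P)"

lemma P: "orthogonal_projection_onto V P"
proof -
  have "closed V"
    unfolding contraction_fixed_eq_invariant[symmetric]
    by (intro closed_Collect_eq linear_continuous_on U(8) s(2) contraction(1) continuous_on_id)
  then have "\<exists>m\<in>V. \<forall>y\<in>V. cinner (x - m) y = 0" for x
    by (rule orthogonal_projection_exists[OF V_subspace])
  then have "\<exists>P. orthogonal_projection_onto V P"
    unfolding orthogonal_projection_onto_def by metis
  then show ?thesis unfolding P_def by (rule someI_ex)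
qed

lemmas PD = orthogonal_projectionD[OF V_subspace P]

lemma P_invariant:
  assumes "k \<in> SL2_cover" shows "\<rho> (s k) (P x) = P x" "P (\<rho> (s k) x) = P x"
proof -
  have fixed: "\<rho> (s q) y = y" if "q \<in> SL2_cover" "y \<in> V" for q y
    using that by (auto simp: invariant_vectors_def)
  show "\<rho> (s k) (P x) = P x" by (rule fixed[OF assms PD(1)])
  have adj: "cinner (\<rho> (s k) x) y = cinner x y" if "y \<in> V" for y
    using \<rho>(6)[OF s(2)[OF assms], of x y] fixed[OF SL2_cover_inverse[OF assms] that] by (simp add: s(5)[OF assms])
  show "P (\<rho> (s k) x) = P x"
    by (rule orthogonal_projection_unique[OF V_subspace P PD(1)])
       (simp add: cinner_diff_left adj PD(4))
qed

lemma P_eqI: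
  assumes "\<And>w. w \<in> V \<Longrightarrow> cinner x w = cinner y w" shows "P x = P y"
proof (rule orthogonal_projection_unique[OF V_subspace P PD(1)])
  show "cinner (x - P y) w = 0" if "w \<in> V" for w
    using assms[OF that] PD(4)[OF that, of y] by (simp add: cinner_diff_left)
qed

section \<open>The compressions commute\<close>

definition commuting :: "(real \<Rightarrow> real) \<times> real \<Rightarrow> (real \<Rightarrow> real) \<times> real \<Rightarrow> bool"
  where "commuting g h \<longleftrightarrow> (\<forall>v\<in>V. P (\<rho> g (P (\<rho> h v))) = P (\<rho> h (P (\<rho> g v))))"

lemma commuting_sym: "commuting g h \<Longrightarrow> commuting h g"
  by (simp add: commuting_def)

text \<open>\<open>P\<close> absorbs the elements of the subgroup on either side.\<close>

lemma commuting_double_coset: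
  assumes k: "k \<in> SL2_cover" "l \<in> SL2_cover" and g: "g \<in> carrier \<G>"
  shows "commuting (s k \<otimes>\<^bsub>\<G>\<^esub> g \<otimes>\<^bsub>\<G>\<^esub> s l) h \<longleftrightarrow> commuting g h"
proof -
  have "P (\<rho> (s k \<otimes>\<^bsub>\<G>\<^esub> g \<otimes>\<^bsub>\<G>\<^esub> s l) x) = P (\<rho> g x)" if "x \<in> V" for x
  proof -
    have "\<rho> (s l) x = x" using that k by (auto simp: invariant_vectors_def)
    then show ?thesis using k g by (simp add: \<rho>(2) s(2) P_invariant)
  qed
  then show ?thesis by (simp add: commuting_def PD(1))
qed

text \<open>For large \<open>n\<close> the elements \<open>g\<close> and \<open>a\<^sup>n h a\<^sup>-\<^sup>n\<close> commute, so \<open>g a\<^sup>n h\<close> and \<open>h a\<^sup>-\<^sup>n g\<close> have the same matrix elements between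
  invariant vectors.  By the mean ergodic theorem, averaging over \<open>n\<close> replaces both \<open>a\<^sup>n\<close> and \<open>a\<^sup>-\<^sup>n\<close> by \<open>P\<close>.\<close>

lemma commuting_disjoint:
  assumes p: "p \<in> Diff3_cover" "identity_near 0 p" and q: "q \<in> Diff3_cover" "identity_near pi q"
  shows "commuting (p, t) (q, u)"
  unfolding commuting_def
proof
  fix v assume v: "v \<in> V"
  define g where "g = (p, t)"
  define h where "h = (q, u)"
  have gh: "g \<in> carrier \<G>" "h \<in> carrier \<G>" using p q by (simp_all add: g_def h_def bott_extension_simps)
  define a where "a = s contraction"
  have a: "a \<in> carrier \<G>" unfolding a_def by (rule s(2)[OF contraction(1)])
  have an: "s (contraction ^^ n) = a [^]\<^bsub>\<G>\<^esub> n" for n using s(6)[OF contraction(1)] by (simp add: a_def)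
  obtain N where N: "\<And>n. n \<ge> N \<Longrightarrow>
    p \<circ> ((contraction ^^ n) \<circ> q \<circ> inv_into UNIV (contraction ^^ n))
      = ((contraction ^^ n) \<circ> q \<circ> inv_into UNIV (contraction ^^ n)) \<circ> p \<and>
    bott_cocycle p ((contraction ^^ n) \<circ> q \<circ> inv_into UNIV (contraction ^^ n)) = 0 \<and>
    bott_cocycle ((contraction ^^ n) \<circ> q \<circ> inv_into UNIV (contraction ^^ n)) p = 0"
    by (rule contraction_conjugate_commute[OF p q]) blast
  have comm: "g \<otimes>\<^bsub>\<G>\<^esub> a [^]\<^bsub>\<G>\<^esub> n \<otimes>\<^bsub>\<G>\<^esub> h = a [^]\<^bsub>\<G>\<^esub> n \<otimes>\<^bsub>\<G>\<^esub> (h \<otimes>\<^bsub>\<G>\<^esub> (inv\<^bsub>\<G>\<^esub> (a [^]\<^bsub>\<G>\<^esub> n) \<otimes>\<^bsub>\<G>\<^esub> (g \<otimes>\<^bsub>\<G>\<^esub> a [^]\<^bsub>\<G>\<^esub> n)))"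
    if n: "n \<ge> N" for n
  proof -
    define b where "b = a [^]\<^bsub>\<G>\<^esub> n"
    have b: "b \<in> carrier \<G>" using a by (simp add: b_def)
    define h' where "h' = b \<otimes>\<^bsub>\<G>\<^esub> h \<otimes>\<^bsub>\<G>\<^esub> inv\<^bsub>\<G>\<^esub> b"
    have h': "h' \<in> carrier \<G>" using b gh by (simp add: h'_def)
    have "fst b = contraction ^^ n" "fst (inv\<^bsub>\<G>\<^esub> b) = inv_into UNIV (contraction ^^ n)"
      using s(1)[OF contraction_pow(1)[of n]] s(1)[OF SL2_cover_inverse[OF contraction_pow(1)[of n]]]
      by (simp_all add: b_def an s(5)[OF contraction_pow(1)])
    then have "fst h' = (contraction ^^ n) \<circ> q \<circ> inv_into UNIV (contraction ^^ n)"
      unfolding h'_def h_def by (cases b; cases "inv\<^bsub>\<G>\<^esub> b") (simp add: bott_extension_simps)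
    then have "g \<otimes>\<^bsub>\<G>\<^esub> h' = h' \<otimes>\<^bsub>\<G>\<^esub> g"
      using N[OF n] unfolding g_def by (cases h') (simp add: bott_extension_simps)
    then have "g \<otimes>\<^bsub>\<G>\<^esub> h' \<otimes>\<^bsub>\<G>\<^esub> b = h' \<otimes>\<^bsub>\<G>\<^esub> g \<otimes>\<^bsub>\<G>\<^esub> b" by simp
    moreover have "h' \<otimes>\<^bsub>\<G>\<^esub> b = b \<otimes>\<^bsub>\<G>\<^esub> h" using b gh by (simp add: h'_def m_assoc)
    ultimately have "g \<otimes>\<^bsub>\<G>\<^esub> (b \<otimes>\<^bsub>\<G>\<^esub> h) = h' \<otimes>\<^bsub>\<G>\<^esub> (g \<otimes>\<^bsub>\<G>\<^esub> b)" using b gh h' by (simp add: m_assoc)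
    then show ?thesis unfolding b_def[symmetric] using b gh by (simp add: h'_def m_assoc)
  qed
  show "P (\<rho> (p, t) (P (\<rho> (q, u) v))) = P (\<rho> (q, u) (P (\<rho> (p, t) v)))"
    unfolding g_def[symmetric] h_def[symmetric]
  proof (rule P_eqI)
    fix w assume w: "w \<in> V"
    have fixa: "\<rho> (a [^]\<^bsub>\<G>\<^esub> n) x = x" "\<rho> (inv\<^bsub>\<G>\<^esub> (a [^]\<^bsub>\<G>\<^esub> n)) x = x" if "x \<in> V" for x and n :: nat
    proof -
      show "\<rho> (a [^]\<^bsub>\<G>\<^esub> n) x = x"
        using that contraction_pow(1)[of n] unfolding an[symmetric] invariant_vectors_def by blast
      then show "\<rho> (inv\<^bsub>\<G>\<^esub> (a [^]\<^bsub>\<G>\<^esub> n)) x = x" using \<rho>(4)[of "a [^]\<^bsub>\<G>\<^esub> n" x] a by simp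
    qed
    have fix_inv: "{x. \<rho> (inv\<^bsub>\<G>\<^esub> a) x = x} = V"
    proof -
      have "\<rho> (inv\<^bsub>\<G>\<^esub> a) x = x \<longleftrightarrow> \<rho> a x = x" for x using \<rho>(4,5)[OF a, of x] by metis
      then show ?thesis using contraction_fixed_eq_invariant by (simp add: a_def)
    qed
    show "cinner (\<rho> g (P (\<rho> h v))) w = cinner (\<rho> h (P (\<rho> g v))) w"
    proof (rule mean_ergodic_eq[where U = "\<rho> a" and W = "\<rho> (inv\<^bsub>\<G>\<^esub> a)" and L = "\<lambda>x. cinner (\<rho> g x) w"
          and M = "\<lambda>x. cinner (\<rho> h x) w" and P = P and x = "\<rho> h v" and y = "\<rho> g v" and ?N0.0 = N])
      show "unitary_operator (\<rho> a)" "unitary_operator (\<rho> (inv\<^bsub>\<G>\<^esub> a))" using a by (simp_all add: \<rho>(1))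
      show "orthogonal_projection_onto {x. \<rho> a x = x} P"
        using P contraction_fixed_eq_invariant by (simp add: a_def)
      show "orthogonal_projection_onto {x. \<rho> (inv\<^bsub>\<G>\<^esub> a) x = x} P" using P fix_inv by simp
      show "bounded_linear (\<lambda>x. cinner (\<rho> g x) w)" "bounded_linear (\<lambda>x. cinner (\<rho> h x) w)"
        using bounded_linear_compose[OF bounded_bilinear.bounded_linear_left[OF bounded_bilinear_cinner, of w] U(8)] gh
        by blast+
      fix n assume n: "n \<ge> N"
      let ?b = "a [^]\<^bsub>\<G>\<^esub> n"
      have b: "?b \<in> carrier \<G>" using a by simp
      have "\<rho> g (\<rho> ?b (\<rho> h v)) = \<rho> ?b (\<rho> h (\<rho> (inv\<^bsub>\<G>\<^esub> ?b) (\<rho> g (\<rho> ?b v))))"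
        using arg_cong[OF comm[OF n], of "\<lambda>x. \<rho> x v"] b gh by (simp add: \<rho>(2))
      then have "cinner (\<rho> g (\<rho> ?b (\<rho> h v))) w = cinner (\<rho> h (\<rho> (inv\<^bsub>\<G>\<^esub> ?b) (\<rho> g v))) w"
        using fixa[OF v] fixa[OF w] b by (simp add: \<rho>(6)[OF b])
      moreover have "(\<rho> a ^^ n) (\<rho> h v) = \<rho> ?b (\<rho> h v)" by (simp add: \<rho>(7)[OF a])
      moreover have "(\<rho> (inv\<^bsub>\<G>\<^esub> a) ^^ n) (\<rho> g v) = \<rho> (inv\<^bsub>\<G>\<^esub> ?b) (\<rho> g v)"
        using a by (simp add: \<rho>(7)[symmetric] nat_pow_inv)
      ultimately show "cinner (\<rho> g ((\<rho> a ^^ n) (\<rho> h v))) w = cinner (\<rho> h ((\<rho> (inv\<^bsub>\<G>\<^esub> a) ^^ n) (\<rho> g v))) w"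
        by simp
    qed
  qed
qed

lemma commuting_limit:
  assumes lim: "limitin \<T> G g sequentially" and G: "\<forall>\<^sub>F n in sequentially. commuting (G n) h"
    and h: "h \<in> carrier \<G>"
  shows "commuting g h"
  unfolding commuting_def
proof
  fix v assume v: "v \<in> V"
  note Plim = bounded_linear.tendsto[OF PD(6)]
  have 1: "(\<lambda>n. P (\<rho> (G n) (P (\<rho> h v)))) \<longlonglongrightarrow> P (\<rho> g (P (\<rho> h v)))"
    by (intro Plim limitin_orbit[OF rep lim])
  have 2: "(\<lambda>n. P (\<rho> h (P (\<rho> (G n) v)))) \<longlonglongrightarrow> P (\<rho> h (P (\<rho> g v)))"
    by (intro Plim bounded_linear.tendsto[OF U(8)[OF h]] limitin_orbit[OF rep lim])
  have "\<forall>\<^sub>F n in sequentially. P (\<rho> (G n) (P (\<rho> h v))) = P (\<rho> h (P (\<rho> (G n) v)))"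
    using G by eventually_elim (use v in \<open>simp add: commuting_def\<close>)
  from Lim_transform_eventually[OF 1 this] 2
  show "P (\<rho> g (P (\<rho> h v))) = P (\<rho> h (P (\<rho> g v)))" by (rule LIMSEQ_unique)
qed

text \<open>Conjugation by the half turn carries a neighbourhood of \<open>0\<close> to one of \<open>\<pi>\<close> and does not change the compression.\<close>

lemma commuting_identity_near:
  assumes p: "p \<in> Diff3_cover" "identity_near 0 p" and q: "q \<in> Diff3_cover" "identity_near 0 q"
  shows "commuting (p, t) (q, u)"
proof -
  define R where "R x = x + pi" for x :: real
  define R' where "R' x = x + (- pi)" for x :: real
  have R: "R \<in> SL2_cover" "R' \<in> SL2_cover"
    using SL2_cover_translation[of pi] SL2_cover_translation[of "- pi"] by (simp_all add: R_def[abs_def] R'_def[abs_def])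
  have carr: "(q, u) \<in> carrier \<G>" using q by (simp add: bott_extension_simps)
  define h where "h = s R \<otimes>\<^bsub>\<G>\<^esub> (q, u) \<otimes>\<^bsub>\<G>\<^esub> s R'"
  have "fst h = R \<circ> q \<circ> R'"
    using s(1)[OF R(1)] s(1)[OF R(2)] unfolding h_def by (cases "s R"; cases "s R'") (simp add: bott_extension_simps)
  then obtain u' where h: "h = (R \<circ> q \<circ> R', u')" by (cases h) auto
  have "identity_near pi (R \<circ> q \<circ> R')"
    using q(2) unfolding identity_near_def R_def R'_def by fastforce
  then have "commuting (p, t) h"
    unfolding h by (intro commuting_disjoint p Diff3_cover_compose q SL2_cover_Diff3 R)
  then have "commuting h (p, t)" by (rule commuting_sym)
  then have "commuting (q, u) (p, t)" unfolding h_def using commuting_double_coset[OF R carr] by simp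
  then show ?thesis by (rule commuting_sym)
qed

text \<open>The first element may be replaced by a limit, and by another one of its double coset; by symmetry so may the second.\<close>

lemma commuting_extend:
  assumes h: "h \<in> carrier \<G>" and near: "\<And>p t. p \<in> Diff3_cover \<Longrightarrow> identity_near 0 p \<Longrightarrow> commuting (p, t) h"
    and g: "g \<in> carrier \<G>"
  shows "commuting g h"
proof -
  have flat: "commuting (p, t) h" if p: "p \<in> Diff3_cover" "flat_at_zero p" for p t
  proof -
    obtain G where G: "limitin C3_topology G p sequentially" "\<And>n. identity_near 0 (G n)"
      using flatten_near_zero[OF p(1)] p(2) unfolding flat_at_zero_def by blast
    show ?thesis
    proof (rule commuting_limit[OF _ _ h])
      show "limitin \<T> (\<lambda>n. (G n, t)) (p, t) sequentially"
        using G(1) by (simp add: limitin_bott_extension)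
      show "\<forall>\<^sub>F n in sequentially. commuting (G n, t) h"
        using limitin_C3_topologyD(2)[OF G(1)] by eventually_elim (rule near[OF _ G(2)])
    qed
  qed
  obtain p t where pt: "g = (p, t)" "p \<in> Diff3_cover" using g by (auto simp: bott_extension_simps)
  obtain k l where kl: "k \<in> SL2_cover" "l \<in> SL2_cover" "flat_at_zero (k \<circ> p \<circ> l)"
    by (rule double_coset_flat[OF pt(2)])
  have "fst (s k \<otimes>\<^bsub>\<G>\<^esub> g \<otimes>\<^bsub>\<G>\<^esub> s l) = k \<circ> p \<circ> l"
    using s(1)[OF kl(1)] s(1)[OF kl(2)] unfolding pt(1) by (cases "s k"; cases "s l") (simp add: bott_extension_simps)
  then obtain t' where t': "s k \<otimes>\<^bsub>\<G>\<^esub> g \<otimes>\<^bsub>\<G>\<^esub> s l = (k \<circ> p \<circ> l, t')" by (metis prod.collapse)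
  have "commuting (s k \<otimes>\<^bsub>\<G>\<^esub> g \<otimes>\<^bsub>\<G>\<^esub> s l) h"
    unfolding t' by (intro flat kl(3) Diff3_cover_compose pt(2) SL2_cover_Diff3 kl(1,2))
  then show ?thesis using commuting_double_coset[OF kl(1,2) g] by simp
qed

theorem compressions_commute:
  assumes g: "g \<in> carrier \<G>" and h: "h \<in> carrier \<G>"
  shows "commuting g h"
proof (rule commuting_extend[OF h _ g])
  fix p t assume p: "p \<in> Diff3_cover" "identity_near 0 p"
  then have carr: "(p, t) \<in> carrier \<G>" by (simp add: bott_extension_simps)
  have "commuting h (p, t)"
    by (rule commuting_extend[OF carr _ h]) (rule commuting_identity_near[OF _ _ p])
  then show "commuting (p, t) h" by (rule commuting_sym)
qed

end

section \<open>Sphericity\<close>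

theorem theorem2:
  fixes s :: "(real \<Rightarrow> real) \<Rightarrow> (real \<Rightarrow> real) \<times> real"
  assumes "SL2_cover_lift s"
  shows "spherical_subgroup TYPE('h::complex_hilbert_space)
           bott_extension bott_extension_topology (s ` SL2_cover)"
  unfolding spherical_subgroup_def
proof (intro conjI allI impI)
  show "topological_group bott_extension bott_extension_topology"
    by (rule topological_group_bott_extension)
  show "subgroup (s ` SL2_cover) bott_extension"
    by (rule subgroup_SL2_cover_lift[OF assms])
  fix \<rho> :: "(real \<Rightarrow> real) \<times> real \<Rightarrow> 'h \<Rightarrow> 'h"
  assume irr: "irreducible_unitary_rep bott_extension bott_extension_topology \<rho>"
  then have "unitary_rep bott_extension bott_extension_topology \<rho>"
    by (simp add: irreducible_unitary_rep_def)
  with assms interpret SL2_cover_rep s \<rho> by unfold_locales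
  show "\<exists>B. complex_vector.independent B \<and> complex_vector.span B = invariant_vectors \<rho> (s ` SL2_cover) \<and>
      finite B \<and> card B \<le> 1"
    using compressions_commute
    by (intro commuting_compressions_dim_le_1[OF group_bott_extension irr V_subspace P]) (simp add: commuting_def)
qed

end
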